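(* Let $\Bbbk$ be a field of characteristic zero, let $R=\Bbbk[x_1,\ldots,x_4]$ with its standard grading and with $\mathfrak{S}_4$ acting by permuting the variables, and let $\mathfrak{m}=(x_1,\ldots,x_4)$. Let $I\subseteq R$ be a homogeneous $\mathfrak{S}_4$-stable complete intersection ideal. Assume that, as a graded $\mathfrak{S}_4$-representation, $I/\mathfrak{m}I$ is isomorphic to a direct sum of one copy of $S^{(2,2)}$ in degree $d$ and $m\geqslant 0$ trivial representations in degrees $c_1,\ldots,c_m$. Then the graded character of $R/I$ is $$\chi_{R/I}=\chi_R\left(\chi^{(4)}-\chi^{(2,2)}t^d+\chi^{(1^4)}t^{2d}\right)\prod_{i=1}^m(1-t^{c_i}).$$
   Context: The group $\mathfrak{S}_4$ acts on $R$ by $\Bbbk$-algebra automorphisms permuting the variables, $\sigma\cdot x_i=x_{\sigma(i)}$. An ideal of $R$ is called a complete intersection ideal if it is generated by a regular sequence. Let $\mathcal{C}$ be the commutative ring of $\Bbbk$-valued class functions on $\mathfrak{S}_4$ under pointwise addition and multiplication. For a graded $\mathfrak{S}_4$-representation $V=\bigoplus_{d\geqslant 0}V_d$ over $\Bbbk$ with finite-dimensional components, the graded character of $V$ is $\chi_V=\sum_{d}\chi_{V_d}t^d\in\mathcal{C}[[t]]$, where $\chi_{V_d}$ is the character of $V_d$. $S^{(2,2)}$ is the two-dimensional irreducible representation of $\mathfrak{S}_4$ over $\Bbbk$ (Specht module of the partition $(2,2)$), and $\chi^{(2,2)}$ is its character; $\chi^{(4)}$ is the trivial character (the identity of $\mathcal{C}$)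 and $\chi^{(1^4)}$ is the sign character. $R$, $I/\mathfrak{m}I$ and $R/I$ carry the induced gradings and $\mathfrak{S}_4$-actions; the displayed equality is in $\mathcal{C}[[t]]$, and an empty product is $1$. A representation "in degree $c$" is a graded representation concentrated in degree $c$. *)

theory Defs
  imports
    "HOL-Library.Numeral_Type"
    "HOL-Library.Poly_Mapping"
    "HOL-Combinatorics.Permutations"
    "HOL-Combinatorics.Perm"
    "HOL-Computational_Algebra.Formal_Power_Series"
begin

section \<open>Class functions on the symmetric group\<close>

text \<open>The four-element type \<open>4\<close> indexes the variables, and \<open>4 perm\<close> is the group
  of its permutations, with \<open>(\<sigma> * \<tau>) i = \<sigma> (\<tau> i)\<close>.\<close>

type_synonym S4 = "4 Perm.perm"

typedef 'k class_fun =
  "{f :: S4 \<Rightarrow> 'k. \<forall>\<sigma> \<tau>. f (\<sigma> * \<tau> * inverse \<sigma>) = f \<tau>}"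
  morphisms class_fun_apply Class_fun
  by (rule exI[of _ "\<lambda>_. undefined"]) simp

setup_lifting type_definition_class_fun

instantiation class_fun :: (comm_ring_1) comm_ring_1
begin

lift_definition zero_class_fun :: "'a class_fun" is "\<lambda>_. 0" by simp
lift_definition one_class_fun :: "'a class_fun" is "\<lambda>_. 1" by simp
lift_definition plus_class_fun :: "'a class_fun \<Rightarrow> 'a class_fun \<Rightarrow> 'a class_fun"
  is "\<lambda>f g \<sigma>. f \<sigma> + g \<sigma>" by simp
lift_definition minus_class_fun :: "'a class_fun \<Rightarrow> 'a class_fun \<Rightarrow> 'a class_fun"
  is "\<lambda>f g \<sigma>. f \<sigma> - g \<sigma>" by simp
lift_definition uminus_class_fun :: "'a class_fun \<Rightarrow> 'a class_fun"
  is "\<lambda>f \<sigma>. - f \<sigma>" by simp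
lift_definition times_class_fun :: "'a class_fun \<Rightarrow> 'a class_fun \<Rightarrow> 'a class_fun"
  is "\<lambda>f g \<sigma>. f \<sigma> * g \<sigma>" by simp

instance
proof
  show "(0::'a class_fun) \<noteq> 1"
    by transfer (simp add: fun_eq_iff)
qed (transfer; simp add: fun_eq_iff algebra_simps)+

end

lemma perm_conj_inverse_apply:
  "apply (inverse \<sigma>) (apply \<sigma> i) = i" "apply \<sigma> (apply (inverse \<sigma>) i) = i"
  by (simp_all add: apply_inverse bij_is_inj bij_is_surj surj_f_inv_f)

lemma permutation_apply_S4: "permutation (apply (\<sigma> :: S4))"
  by (simp add: permutation)

lift_definition sign_class_fun :: "'k::comm_ring_1 class_fun"
  is "\<lambda>\<sigma>. of_int (sign (apply \<sigma>))"
proof -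
  fix \<sigma> \<tau> :: S4
  have c: "apply (\<sigma> * \<tau> * inverse \<sigma>) = apply \<sigma> \<circ> apply \<tau> \<circ> apply (inverse \<sigma>)"
    by (simp add: apply_times)
  have "apply \<sigma> \<circ> apply (inverse \<sigma>) = id"
    by (simp add: fun_eq_iff perm_conj_inverse_apply)
  hence "sign (apply \<sigma>) * sign (apply (inverse \<sigma>)) = 1"
    using sign_compose[OF permutation_apply_S4 permutation_apply_S4, of \<sigma> "inverse \<sigma>"]
    by (simp add: sign_id)
  hence "sign (apply (\<sigma> * \<tau> * inverse \<sigma>)) = sign (apply \<tau>)"
    unfolding c
    by (simp add: sign_compose permutation_compose permutation_apply_S4)
  thus "(of_int (sign (apply (\<sigma> * \<tau> * inverse \<sigma>))) :: 'k) = of_int (sign (apply \<tau>))"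
    by simp
qed


section \<open>Representations and characters\<close>

text \<open>Carriers are explicit so that quotients can be formed.  The records hold only
  the data of a representation; the operations are relevant on \<open>space\<close> only.\<close>

record ('k, 'v) rep =
  space :: "'v set"
  vzero :: 'v
  vadd :: "'v \<Rightarrow> 'v \<Rightarrow> 'v"
  vscale :: "'k \<Rightarrow> 'v \<Rightarrow> 'v"
  act :: "S4 \<Rightarrow> 'v \<Rightarrow> 'v"

record ('k, 'v) graded_rep = "('k, 'v) rep" +
  homog :: "nat \<Rightarrow> 'v set"

definition component :: "('k, 'v) graded_rep \<Rightarrow> nat \<Rightarrow> ('k, 'v) rep" where
  "component V e = \<lparr>space = homog V e, vzero = vzero V, vadd = vadd V,
     vscale = vscale V, act = act V\<rparr>"

text \<open>A linear isomorphism of \<open>V\<close> onto \<open>k\<^sup>n\<close>, the latter realised as the sequences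
  vanishing from \<open>n\<close> on; equivalently, the choice of an ordered basis of \<open>V\<close>.\<close>

definition coordinates ::
    "('k::field, 'v) rep \<Rightarrow> nat \<Rightarrow> ('v \<Rightarrow> nat \<Rightarrow> 'k) \<Rightarrow> bool" where
  "coordinates V n \<phi> \<longleftrightarrow>
     bij_betw \<phi> (space V) {a. \<forall>i\<ge>n. a i = 0} \<and>
     (\<forall>u\<in>space V. \<forall>v\<in>space V. \<phi> (vadd V u v) = (\<lambda>i. \<phi> u i + \<phi> v i)) \<and>
     (\<forall>c. \<forall>v\<in>space V. \<phi> (vscale V c v) = (\<lambda>i. c * \<phi> v i))"

definition unit_vector :: "nat \<Rightarrow> nat \<Rightarrow> 'k::zero_neq_one" where
  "unit_vector i = (\<lambda>j. if j = i then 1 else 0)"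

definition matrix_trace ::
    "('k::field, 'v) rep \<Rightarrow> nat \<Rightarrow> ('v \<Rightarrow> nat \<Rightarrow> 'k) \<Rightarrow> ('v \<Rightarrow> 'v) \<Rightarrow> 'k" where
  "matrix_trace V n \<phi> f = (\<Sum>i<n. \<phi> (f (inv_into (space V) \<phi> (unit_vector i))) i)"

text \<open>The trace of a linear endomorphism of a finite-dimensional space does not depend
  on the basis (see the lemmas below); for an infinite-dimensional space the value is
  meaningless.\<close>

definition trace :: "('k::field, 'v) rep \<Rightarrow> ('v \<Rightarrow> 'v) \<Rightarrow> 'k" where
  "trace V f = (THE t. \<exists>n \<phi>. coordinates V n \<phi> \<and> t = matrix_trace V n \<phi> f)"

lemma linear_functional_expansion:
  fixes V :: "('k::field, 'v) rep" and g :: "'v \<Rightarrow> 'k"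
  assumes add_closed: "\<And>u v. u \<in> space V \<Longrightarrow> v \<in> space V \<Longrightarrow> vadd V u v \<in> space V"
    and scale_closed: "\<And>c v. v \<in> space V \<Longrightarrow> vscale V c v \<in> space V"
    and g_add: "\<And>u v. u \<in> space V \<Longrightarrow> v \<in> space V \<Longrightarrow> g (vadd V u v) = g u + g v"
    and g_scale: "\<And>c v. v \<in> space V \<Longrightarrow> g (vscale V c v) = c * g v"
    and \<phi>: "coordinates V n \<phi>" and v: "v \<in> space V"
  shows "g v = (\<Sum>i<n. \<phi> v i * g (inv_into (space V) \<phi> (unit_vector i)))"
proof -
  define w where "w i = inv_into (space V) \<phi> (unit_vector i)" for i
  have inj: "inj_on \<phi> (space V)" and img: "\<phi> ` space V = {a. \<forall>i\<ge>n. a i = 0}"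
    and \<phi>_add: "\<And>u v. u \<in> space V \<Longrightarrow> v \<in> space V \<Longrightarrow>
      \<phi> (vadd V u v) = (\<lambda>i. \<phi> u i + \<phi> v i)"
    and \<phi>_scale: "\<And>c v. v \<in> space V \<Longrightarrow> \<phi> (vscale V c v) = (\<lambda>i. c * \<phi> v i)"
    using \<phi> by (auto simp: coordinates_def bij_betw_def)
  have w: "w i \<in> space V" "\<phi> (w i) = unit_vector i" if "i < n" for i
  proof -
    have "(unit_vector i :: nat \<Rightarrow> 'k) \<in> \<phi> ` space V"
      using that by (auto simp: img unit_vector_def)
    thus "w i \<in> space V" "\<phi> (w i) = unit_vector i"
      by (simp_all add: w_def inv_into_into f_inv_into_f)
  qed
  have "g v = (\<Sum>i<k. \<phi> v i * g (w i))"
    if "k \<le> n" "v \<in> space V" "\<forall>i\<ge>k. \<phi> v i = 0" for k v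
    using that
  proof (induction k arbitrary: v)
    case 0
    hence "\<phi> (vscale V 0 v) = \<phi> v"
      by (simp add: \<phi>_scale fun_eq_iff)
    hence "vscale V 0 v = v"
      by (rule inj_onD[OF inj]) (simp_all add: scale_closed 0)
    thus ?case
      using g_scale[of v 0] 0 by simp
  next
    case (Suc k)
    have "(\<phi> v)(k := 0) \<in> \<phi> ` space V"
      unfolding img using Suc.prems by auto
    then obtain u where "(\<phi> v)(k := 0) = \<phi> u" and "u \<in> space V"
      by (rule imageE)
    hence u: "u \<in> space V" "\<phi> u = (\<phi> v)(k := 0)"
      by simp_all
    have wk: "w k \<in> space V" "\<phi> (w k) = unit_vector k"
      using w Suc.prems by auto
    have "\<phi> (vadd V u (vscale V (\<phi> v k) (w k))) = \<phi> v"
      by (simp add: \<phi>_add \<phi>_scale u wk scale_closed unit_vector_def fun_eq_iff)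
    hence "vadd V u (vscale V (\<phi> v k) (w k)) = v"
      by (rule inj_onD[OF inj]) (simp_all add: add_closed scale_closed u wk Suc.prems)
    hence "g v = g u + \<phi> v k * g (w k)"
      using g_add[OF u(1) scale_closed[OF wk(1)], of "\<phi> v k"]
      by (simp add: g_scale[OF wk(1)])
    moreover have "g u = (\<Sum>i<k. \<phi> u i * g (w i))"
      using Suc.prems u by (intro Suc.IH) auto
    moreover have "\<dots> = (\<Sum>i<k. \<phi> v i * g (w i))"
      by (intro sum.cong) (simp_all add: u)
    ultimately show ?case by simp
  qed
  moreover have "\<forall>i\<ge>n. \<phi> v i = 0"
    using img v by auto
  ultimately show ?thesis
    using v by (simp add: w_def)
qed

lemma trace_eq_matrix_trace:
  fixes V :: "('k::field, 'v) rep"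
  assumes add_closed: "\<And>u v. u \<in> space V \<Longrightarrow> v \<in> space V \<Longrightarrow> vadd V u v \<in> space V"
    and scale_closed: "\<And>c v. v \<in> space V \<Longrightarrow> vscale V c v \<in> space V"
    and f_closed: "\<And>v. v \<in> space V \<Longrightarrow> f v \<in> space V"
    and f_add: "\<And>u v. u \<in> space V \<Longrightarrow> v \<in> space V \<Longrightarrow> f (vadd V u v) = vadd V (f u) (f v)"
    and f_scale: "\<And>c v. v \<in> space V \<Longrightarrow> f (vscale V c v) = vscale V c (f v)"
    and \<phi>: "coordinates V n \<phi>"
  shows "trace V f = matrix_trace V n \<phi> f"
proof -
  have "matrix_trace V n' \<psi> f = matrix_trace V n \<phi> f" if \<psi>: "coordinates V n' \<psi>" for n' \<psi>
  proof -
    define w where "w i = inv_into (space V) \<phi> (unit_vector i)" for i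
    define w' where "w' i = inv_into (space V) \<psi> (unit_vector i)" for i
    have mem: "inv_into (space V) \<chi> (unit_vector i) \<in> space V"
      if "coordinates V l \<chi>" "i < l" for l i and \<chi> :: "'v \<Rightarrow> nat \<Rightarrow> 'k"
    proof (rule inv_into_into)
      show "unit_vector i \<in> \<chi> ` space V"
        using that by (auto simp: coordinates_def bij_betw_def unit_vector_def)
    qed
    have w: "w i \<in> space V" if "i < n" for i
      using mem[OF \<phi> that] by (simp add: w_def)
    have w': "w' j \<in> space V" if "j < n'" for j
      using mem[OF \<psi> that] by (simp add: w'_def)
    have \<phi>_lin: "\<And>u v. u \<in> space V \<Longrightarrow> v \<in> space V \<Longrightarrow> \<phi> (vadd V u v) = (\<lambda>i. \<phi> u i + \<phi> v i)"
      "\<And>c v. v \<in> space V \<Longrightarrow> \<phi> (vscale V c v) = (\<lambda>i. c * \<phi> v i)"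
      using \<phi> by (simp_all add: coordinates_def)
    have \<psi>_lin: "\<And>u v. u \<in> space V \<Longrightarrow> v \<in> space V \<Longrightarrow> \<psi> (vadd V u v) = (\<lambda>i. \<psi> u i + \<psi> v i)"
      "\<And>c v. v \<in> space V \<Longrightarrow> \<psi> (vscale V c v) = (\<lambda>i. c * \<psi> v i)"
      using \<psi> by (simp_all add: coordinates_def)
    have "\<phi> (f (w i)) i = (\<Sum>j<n'. \<psi> (f (w i)) j * \<phi> (w' j) i)" if "i < n" for i
      unfolding w'_def
      by (rule linear_functional_expansion[OF add_closed scale_closed _ _ \<psi>])
        (simp_all add: \<phi>_lin f_closed w that)
    hence "matrix_trace V n \<phi> f = (\<Sum>i<n. \<Sum>j<n'. \<psi> (f (w i)) j * \<phi> (w' j) i)"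
      by (simp add: matrix_trace_def w_def)
    also have "\<dots> = (\<Sum>j<n'. \<Sum>i<n. \<psi> (f (w i)) j * \<phi> (w' j) i)"
      by (rule sum.swap)
    also have "\<dots> = (\<Sum>j<n'. \<psi> (f (w' j)) j)"
    proof (rule sum.cong)
      fix j assume "j \<in> {..<n'}"
      hence j: "j < n'" by simp
      have "\<psi> (f (w' j)) j = (\<Sum>i<n. \<phi> (w' j) i * \<psi> (f (w i)) j)"
        unfolding w_def
        by (rule linear_functional_expansion[OF add_closed scale_closed _ _ \<phi>,
              where g = "\<lambda>v. \<psi> (f v) j"])
          (simp_all add: \<psi>_lin f_add f_scale f_closed w' j)
      thus "(\<Sum>i<n. \<psi> (f (w i)) j * \<phi> (w' j) i) = \<psi> (f (w' j)) j"
        by (simp add: mult.commute)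
    qed simp
    finally show ?thesis
      by (simp add: matrix_trace_def w'_def)
  qed
  with \<phi> show ?thesis
    unfolding trace_def by (intro the_equality) blast+
qed

definition character :: "('k::field, 'v) rep \<Rightarrow> 'k class_fun" where
  "character V = Class_fun (\<lambda>\<sigma>. trace V (act V \<sigma>))"

definition graded_character :: "('k::field, 'v) graded_rep \<Rightarrow> 'k class_fun fps" where
  "graded_character V = Abs_fps (\<lambda>e. character (component V e))"

text \<open>The use of \<^const>\<open>Class_fun\<close> in \<^const>\<open>character\<close> is justified by the next two lemmas.\<close>

lemma coordinates_conjugate:
  fixes V :: "('k::field, 'v) rep"
  assumes closed: "\<And>\<sigma> v. v \<in> space V \<Longrightarrow> act V \<sigma> v \<in> space V"
    and add: "\<And>\<sigma> u v. u \<in> space V \<Longrightarrow> v \<in> space V \<Longrightarrow>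
      act V \<sigma> (vadd V u v) = vadd V (act V \<sigma> u) (act V \<sigma> v)"
    and scale: "\<And>\<sigma> c v. v \<in> space V \<Longrightarrow> act V \<sigma> (vscale V c v) = vscale V c (act V \<sigma> v)"
    and one: "\<And>v. v \<in> space V \<Longrightarrow> act V 1 v = v"
    and mult: "\<And>\<sigma> \<tau> v. v \<in> space V \<Longrightarrow> act V (\<sigma> * \<tau>) v = act V \<sigma> (act V \<tau> v)"
    and \<phi>: "coordinates V n \<phi>"
  shows "coordinates V n (\<phi> \<circ> act V \<sigma>)"
    and "matrix_trace V n (\<phi> \<circ> act V \<sigma>) (act V \<tau>)
       = matrix_trace V n \<phi> (act V (\<sigma> * \<tau> * inverse \<sigma>))"
proof -
  have inv: "act V (inverse \<sigma>) (act V \<sigma> v) = v" "act V \<sigma> (act V (inverse \<sigma>) v) = v"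
    if "v \<in> space V" for \<sigma> v
    using that by (simp_all flip: mult add: one)
  have bij: "bij_betw (act V \<sigma>) (space V) (space V)"
    by (rule bij_betw_byWitness[where f' = "act V (inverse \<sigma>)"]) (auto simp: inv closed)
  have bij\<phi>: "bij_betw \<phi> (space V) {a. \<forall>i\<ge>n. a i = 0}"
    using \<phi> by (simp add: coordinates_def)
  show "coordinates V n (\<phi> \<circ> act V \<sigma>)"
    using \<phi> bij_betw_trans[OF bij bij\<phi>]
    by (simp add: coordinates_def closed add scale)
  have "\<phi> (act V \<sigma> (act V \<tau> (inv_into (space V) (\<phi> \<circ> act V \<sigma>) (unit_vector i))))
      = \<phi> (act V (\<sigma> * \<tau> * inverse \<sigma>) (inv_into (space V) \<phi> (unit_vector i)))"
    if "i < n" for i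
  proof -
    define w where "w = inv_into (space V) \<phi> (unit_vector i :: nat \<Rightarrow> 'k)"
    have u: "(unit_vector i :: nat \<Rightarrow> 'k) \<in> \<phi> ` space V"
      using bij\<phi> that by (auto simp: bij_betw_def unit_vector_def)
    hence w: "w \<in> space V" "\<phi> w = unit_vector i"
      by (simp_all add: w_def inv_into_into f_inv_into_f)
    have inj: "inj_on (\<phi> \<circ> act V \<sigma>) (space V)"
      using bij_betw_trans[OF bij bij\<phi>] by (simp add: bij_betw_def)
    have "inv_into (space V) (\<phi> \<circ> act V \<sigma>) (unit_vector i) = act V (inverse \<sigma>) w"
      using w by (intro inv_into_f_eq[OF inj]) (simp_all add: closed inv)
    thus ?thesis
      by (simp flip: w_def add: mult w closed)
  qed
  thus "matrix_trace V n (\<phi> \<circ> act V \<sigma>) (act V \<tau>)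
      = matrix_trace V n \<phi> (act V (\<sigma> * \<tau> * inverse \<sigma>))"
    by (simp add: matrix_trace_def)
qed

lemma class_fun_apply_character:
  fixes V :: "('k::field, 'v) rep"
  assumes closed: "\<And>\<sigma> v. v \<in> space V \<Longrightarrow> act V \<sigma> v \<in> space V"
    and add: "\<And>\<sigma> u v. u \<in> space V \<Longrightarrow> v \<in> space V \<Longrightarrow>
      act V \<sigma> (vadd V u v) = vadd V (act V \<sigma> u) (act V \<sigma> v)"
    and scale: "\<And>\<sigma> c v. v \<in> space V \<Longrightarrow> act V \<sigma> (vscale V c v) = vscale V c (act V \<sigma> v)"
    and one: "\<And>v. v \<in> space V \<Longrightarrow> act V 1 v = v"
    and mult: "\<And>\<sigma> \<tau> v. v \<in> space V \<Longrightarrow> act V (\<sigma> * \<tau>) v = act V \<sigma> (act V \<tau> v)"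
  shows "class_fun_apply (character V) \<sigma> = trace V (act V \<sigma>)"
proof -
  let ?P = "\<lambda>\<tau> t. \<exists>n \<phi>. coordinates V n \<phi> \<and> t = matrix_trace V n \<phi> (act V \<tau>)"
  note conj = coordinates_conjugate[where V = V, OF closed add scale one mult]
  have imp: "?P \<tau> t" if "?P (\<sigma> * \<tau> * inverse \<sigma>) t" for \<sigma> \<tau> t
    using that conj by metis
  have "?P (\<sigma> * \<tau> * inverse \<sigma>) t" if "?P \<tau> t" for \<sigma> \<tau> t
  proof -
    have "inverse \<sigma> * (\<sigma> * \<tau> * inverse \<sigma>) * inverse (inverse \<sigma>) = \<tau>"
      by (rule perm_eqI) (simp add: apply_times perm_conj_inverse_apply)
    thus ?thesis
      using imp[where \<sigma> = "inverse \<sigma>" and \<tau> = "\<sigma> * \<tau> * inverse \<sigma>" and t = t] that by metis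
  qed
  with imp have "?P (\<sigma> * \<tau> * inverse \<sigma>) = ?P \<tau>" for \<sigma> \<tau>
    by (intro ext) blast
  hence "\<forall>\<sigma> \<tau>. trace V (act V (\<sigma> * \<tau> * inverse \<sigma>)) = trace V (act V \<tau>)"
    by (simp add: trace_def)
  thus ?thesis
    by (simp add: character_def Class_fun_inverse)
qed


section \<open>Constructions on graded representations\<close>

definition graded_iso :: "('k, 'v) graded_rep \<Rightarrow> ('k, 'w) graded_rep \<Rightarrow> bool" where
  "graded_iso V W \<longleftrightarrow> (\<exists>\<phi>.
     bij_betw \<phi> (space V) (space W) \<and>
     (\<forall>u\<in>space V. \<forall>v\<in>space V. \<phi> (vadd V u v) = vadd W (\<phi> u) (\<phi> v)) \<and>
     (\<forall>c. \<forall>v\<in>space V. \<phi> (vscale V c v) = vscale W c (\<phi> v)) \<and>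
     (\<forall>\<sigma>. \<forall>v\<in>space V. \<phi> (act V \<sigma> v) = act W \<sigma> (\<phi> v)) \<and>
     (\<forall>e. \<phi> ` homog V e = homog W e))"

definition in_degree :: "nat \<Rightarrow> ('k, 'v) rep \<Rightarrow> ('k, 'v) graded_rep" where
  "in_degree c V = rep.extend V
     (graded_rep.fields (\<lambda>e. if e = c then space V else {vzero V}))"

definition direct_sum ::
    "('k, 'v) graded_rep \<Rightarrow> ('k, 'w) graded_rep \<Rightarrow> ('k, 'v \<times> 'w) graded_rep" where
  "direct_sum V W = \<lparr>space = space V \<times> space W,
     vzero = (vzero V, vzero W),
     vadd = (\<lambda>(v, w) (v', w'). (vadd V v v', vadd W w w')),
     vscale = (\<lambda>c (v, w). (vscale V c v, vscale W c w)),
     act = (\<lambda>\<sigma> (v, w). (act V \<sigma> v, act W \<sigma> w)),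
     homog = (\<lambda>e. homog V e \<times> homog W e)\<rparr>"

text \<open>For a finite index set \<open>J\<close>; it is the zero representation if \<open>J\<close> is empty.\<close>

definition direct_sum_family ::
    "'i set \<Rightarrow> ('i \<Rightarrow> ('k, 'v) graded_rep) \<Rightarrow> ('k, 'i \<Rightarrow> 'v) graded_rep" where
  "direct_sum_family J V = \<lparr>space = (\<Pi>\<^sub>E i\<in>J. space (V i)),
     vzero = (\<lambda>i\<in>J. vzero (V i)),
     vadd = (\<lambda>u v. \<lambda>i\<in>J. vadd (V i) (u i) (v i)),
     vscale = (\<lambda>c v. \<lambda>i\<in>J. vscale (V i) c (v i)),
     act = (\<lambda>\<sigma> v. \<lambda>i\<in>J. act (V i) \<sigma> (v i)),
     homog = (\<lambda>e. \<Pi>\<^sub>E i\<in>J. homog (V i) e)\<rparr>"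

definition subrep :: "('k, 'v) graded_rep \<Rightarrow> 'v set \<Rightarrow> ('k, 'v) graded_rep" where
  "subrep V U = V\<lparr>space := U, homog := (\<lambda>e. homog V e \<inter> U)\<rparr>"

definition coset :: "('k, 'v) graded_rep \<Rightarrow> 'v set \<Rightarrow> 'v \<Rightarrow> 'v set" where
  "coset V W v = vadd V v ` W"

text \<open>Representatives are added, scaled and permuted; in \<open>vscale\<close> the summand \<open>W\<close>
  is there for the scalar \<open>0\<close>.\<close>

definition quotient_rep :: "('k, 'v) graded_rep \<Rightarrow> 'v set \<Rightarrow> ('k, 'v set) graded_rep" where
  "quotient_rep V W = \<lparr>space = coset V W ` space V,
     vzero = W,
     vadd = (\<lambda>A B. {vadd V a b | a b. a \<in> A \<and> b \<in> B}),
     vscale = (\<lambda>c A. {vadd V (vscale V c a) w | a w. a \<in> A \<and> w \<in> W}),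
     act = (\<lambda>\<sigma> A. act V \<sigma> ` A),
     homog = (\<lambda>e. coset V W ` homog V e)\<rparr>"

definition trivial_rep :: "('k::field, 'k) rep" where
  "trivial_rep = \<lparr>space = UNIV, vzero = 0, vadd = (+), vscale = (*), act = (\<lambda>_ a. a)\<rparr>"

definition scalar_mult :: "'k::semiring_0 \<Rightarrow> ('a \<Rightarrow>\<^sub>0 'k) \<Rightarrow> ('a \<Rightarrow>\<^sub>0 'k)" where
  "scalar_mult c p = Poly_Mapping.map ((*) c) p"


section \<open>Specht modules\<close>

text \<open>A tableau of shape \<open>\<mu>\<close> is a bijection from the cells to \<open>4\<close> (its values off the
  cells are irrelevant).  A tabloid is encoded by the function sending an entry to the
  row containing it, so \<open>\<sigma>\<close> sends the tabloid \<open>r\<close> to \<open>r \<circ> \<sigma>\<^sup>-\<^sup>1\<close>, and the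
  permutation module of \<open>\<mu>\<close> consists of formal linear combinations of tabloids.\<close>

definition cells :: "nat list \<Rightarrow> (nat \<times> nat) set" where
  "cells \<mu> = {(i, j). i < length \<mu> \<and> j < \<mu> ! i}"

definition tableaux :: "nat list \<Rightarrow> (nat \<times> nat \<Rightarrow> 4) set" where
  "tableaux \<mu> = {T. bij_betw T (cells \<mu>) UNIV}"

definition row_of :: "nat list \<Rightarrow> (nat \<times> nat \<Rightarrow> 4) \<Rightarrow> 4 \<Rightarrow> nat" where
  "row_of \<mu> T x = fst (inv_into (cells \<mu>) T x)"

definition column_of :: "nat list \<Rightarrow> (nat \<times> nat \<Rightarrow> 4) \<Rightarrow> 4 \<Rightarrow> nat" where
  "column_of \<mu> T x = snd (inv_into (cells \<mu>) T x)"

definition column_stabilizer :: "nat list \<Rightarrow> (nat \<times> nat \<Rightarrow> 4) \<Rightarrow> S4 set" where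
  "column_stabilizer \<mu> T = {\<pi>. \<forall>x. column_of \<mu> T (apply \<pi> x) = column_of \<mu> T x}"

definition polytabloid :: "nat list \<Rightarrow> (nat \<times> nat \<Rightarrow> 4) \<Rightarrow> ((4 \<Rightarrow> nat) \<Rightarrow>\<^sub>0 'k::field)" where
  "polytabloid \<mu> T = (\<Sum>\<pi>\<in>column_stabilizer \<mu> T.
     Poly_Mapping.single (row_of \<mu> (apply \<pi> \<circ> T)) (of_int (sign (apply \<pi>))))"

definition specht :: "nat list \<Rightarrow> ('k::field, (4 \<Rightarrow> nat) \<Rightarrow>\<^sub>0 'k) rep" where
  "specht \<mu> = \<lparr>space = module.span scalar_mult (polytabloid \<mu> ` tableaux \<mu>),
     vzero = 0, vadd = (+), vscale = scalar_mult,
     act = (\<lambda>\<sigma> v. \<Sum>r\<in>Poly_Mapping.keys v.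
       Poly_Mapping.single (r \<circ> apply (inverse \<sigma>)) (Poly_Mapping.lookup v r))\<rparr>"

lemma vector_space_scalar_mult:
  "vector_space (scalar_mult :: 'k::field \<Rightarrow> ('a \<Rightarrow>\<^sub>0 'k) \<Rightarrow> ('a \<Rightarrow>\<^sub>0 'k))"
proof -
  have l: "Poly_Mapping.lookup (scalar_mult c p) x = c * Poly_Mapping.lookup p x"
    for c :: 'k and p :: "'a \<Rightarrow>\<^sub>0 'k" and x
    by (simp add: scalar_mult_def Poly_Mapping.map.rep_eq when_def)
  show ?thesis
    by unfold_locales (auto intro!: poly_mapping_eqI simp: l lookup_add algebra_simps)
qed


section \<open>Ideals of the polynomial ring in four variables\<close>

text \<open>A monomial is its exponent vector, and multiplication in \<^typ>\<open>(4 \<Rightarrow>\<^sub>0 nat) \<Rightarrow>\<^sub>0 'k::field\<close>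
  is convolution.  Ideals of a commutative ring are its submodules over itself.\<close>

type_synonym 'k poly4 = "(4 \<Rightarrow>\<^sub>0 nat) \<Rightarrow>\<^sub>0 'k"

lemma module_times: "module ((*) :: 'a::comm_ring_1 \<Rightarrow> 'a \<Rightarrow> 'a)"
  by unfold_locales (simp_all add: algebra_simps)

abbreviation is_ideal :: "'a::comm_ring_1 set \<Rightarrow> bool" where
  "is_ideal \<equiv> module.subspace (*)"

abbreviation ideal_generated :: "'a::comm_ring_1 set \<Rightarrow> 'a set" where
  "ideal_generated \<equiv> module.span (*)"

definition ideal_product :: "'a::comm_ring_1 set \<Rightarrow> 'a set \<Rightarrow> 'a set" where
  "ideal_product I J = ideal_generated {a * b | a b. a \<in> I \<and> b \<in> J}"

definition regular_sequence :: "'a::comm_ring_1 list \<Rightarrow> bool" where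
  "regular_sequence fs \<longleftrightarrow>
     (\<forall>i<length fs. \<forall>g. fs ! i * g \<in> ideal_generated (set (take i fs)) \<longrightarrow>
        g \<in> ideal_generated (set (take i fs))) \<and>
     ideal_generated (set fs) \<noteq> UNIV"

definition complete_intersection :: "'a::comm_ring_1 set \<Rightarrow> bool" where
  "complete_intersection I \<longleftrightarrow> (\<exists>fs. regular_sequence fs \<and> I = ideal_generated (set fs))"

definition var :: "4 \<Rightarrow> 'k::field poly4" where
  "var i = Poly_Mapping.single (Poly_Mapping.single i 1) 1"

definition irrelevant_ideal :: "'k::field poly4 set" where
  "irrelevant_ideal = ideal_generated (range var)"

definition homogeneous_polys :: "nat \<Rightarrow> 'k::field poly4 set" where
  "homogeneous_polys e =
     {p. \<forall>\<alpha>\<in>Poly_Mapping.keys p. (\<Sum>i\<in>UNIV. Poly_Mapping.lookup \<alpha> i) = e}"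

definition homogeneous_ideal :: "'k::field poly4 set \<Rightarrow> bool" where
  "homogeneous_ideal I \<longleftrightarrow>
     (\<exists>S. S \<subseteq> (\<Union>e. homogeneous_polys e) \<and> I = ideal_generated S)"

text \<open>Substitution of \<open>var (\<sigma> i)\<close> for \<open>var i\<close>.\<close>

definition permute_vars :: "S4 \<Rightarrow> 'k::field poly4 \<Rightarrow> 'k poly4" where
  "permute_vars \<sigma> p = (\<Sum>\<alpha>\<in>Poly_Mapping.keys p.
     Poly_Mapping.single 0 (Poly_Mapping.lookup p \<alpha>) *
     (\<Prod>i\<in>UNIV. var (apply \<sigma> i) ^ Poly_Mapping.lookup \<alpha> i))"

definition S4_stable :: "'k::field poly4 set \<Rightarrow> bool" where
  "S4_stable I \<longleftrightarrow> (\<forall>\<sigma>. permute_vars \<sigma> ` I \<subseteq> I)"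

definition poly_rep :: "('k::field, 'k poly4) graded_rep" where
  "poly_rep = \<lparr>space = UNIV, vzero = 0, vadd = (+), vscale = scalar_mult,
     act = permute_vars, homog = homogeneous_polys\<rparr>"

end

theory Submission
  imports
    Defs
    "HOL-Library.Product_Plus"
begin

text \<open>The ideal \<open>I\<close> is generated by \<open>g\<^sub>0, g\<^sub>1\<close> of degree \<open>d\<close>, which span a copy of the
  Specht module \<open>S\<close> of shape \<open>(2,2)\<close>, and
  by invariants \<open>g\<^sub>2, \<dots>, g\<^sub>m\<^sub>+\<^sub>1\<close> of degrees \<open>c\<^sub>1, \<dots>, c\<^sub>m\<close>: lift a basis of \<open>I/\<mm>I\<close>,
  where \<open>\<mm>\<close> is the irrelevant ideal, to \<open>I\<close>, make the lift equivariant by averaging over the group (\<open>equivariant_lift\<close>), and apply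
  Nakayama's lemma in its graded form (\<open>generators_of_nakayama\<close>).

  These generators form a regular sequence.  The hypothesis only provides some regular sequence
  \<open>f\<close> generating \<open>I\<close>, which need be neither homogeneous nor related to the group action, so
  regularity has to be carried over from \<open>f\<close> to \<open>g\<close>.  The property that survives a change of
  generators is the vanishing of the first Koszul homology: every relation \<open>\<Sum>c\<^sub>i g\<^sub>i = 0\<close> has
  the form \<open>c = M g\<close> with a skew-symmetric matrix \<open>M\<close>.  For \<open>f\<close> this is an induction on the
  length (\<open>regular_sequence_relations\<close>).  If \<open>g = A f\<close> and \<open>f = B g\<close>, then a relation \<open>c\<close> of
  \<open>g\<close> yields the relation \<open>A\<^sup>T c = M f\<close> of \<open>f\<close>, hence \<open>(A B)\<^sup>T c = (B\<^sup>T M B) g\<close>; and \<open>c\<close> differs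
  from \<open>(A B)\<^sup>T c\<close> by a combination of the rows of \<open>1 - A B\<close>, which are relations of \<open>g\<close>, with the
  coefficients \<open>c\<^sub>k\<close>, which lie in \<open>\<mm>\<close> because \<open>g\<close> is minimal.  So modulo Koszul relations
  every relation lies in \<open>\<mm>\<close> times the module of relations, and graded Nakayama finishes
  (\<open>minimal_generators_koszul\<close>).  Removing the last generator preserves the property and shows that
  this generator is not a zero divisor modulo the previous ones (\<open>homogeneous_relations_koszul_drop\<close>,
  \<open>homogeneous_nonzerodivisor\<close>).

  The characters are computed for one permutation \<open>\<sigma>\<close> at a time, as traces on graded pieces.
  The pair \<open>g\<^sub>0, g\<^sub>1\<close> has the equivariant Koszul resolution
  \<open>0 \<rightarrow> R(-2d) \<otimes> det \<rightarrow> R(-d) \<otimes> S \<rightarrow> (g\<^sub>0, g\<^sub>1) \<rightarrow> 0\<close>, which produces the quadratic factor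
  (\<open>trace_ideal_of_pair\<close>), since the determinant of \<open>S\<close> is the sign (\<open>specht_determinant\<close>).
  Each invariant \<open>g\<^sub>l\<close> then contributes a factor \<open>1 - t\<^sup>c\<close> with \<open>c = deg g\<^sub>l\<close>, because multiplication
  by \<open>g\<^sub>l\<close> is injective and equivariant on the quotient by the previous generators
  (\<open>trace_adjoin_invariant\<close>).\<close>

section \<open>Traces of endomorphisms of subquotients\<close>

text \<open>A separate locale, because notions added to \<^locale>\<open>vector_space\<close> itself would be inherited
  by each of its interpretations.\<close>

locale endomorphism_traces = vector_space scale
  for scale :: "'a::field \<Rightarrow> 'b::ab_group_add \<Rightarrow> 'b"
begin

text \<open>The map \<open>p\<close> exhibits \<open>V\<close> as \<open>X/A\<close>.  This covers subspaces (\<open>A = {0}\<close>), quotients by cosets and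
  images of linear maps, so that a single trace formula serves all of them.\<close>

definition presents :: "'b set \<Rightarrow> 'b set \<Rightarrow> ('b \<Rightarrow> 'v) \<Rightarrow> ('a, 'v) rep \<Rightarrow> bool" where
  "presents X A p V \<longleftrightarrow> subspace X \<and> subspace A \<and> A \<subseteq> X \<and> p ` X = space V \<and>
     (\<forall>x\<in>X. \<forall>y\<in>X. p (x + y) = vadd V (p x) (p y)) \<and>
     (\<forall>c. \<forall>x\<in>X. p (scale c x) = vscale V c (p x)) \<and>
     (\<forall>x\<in>X. \<forall>y\<in>X. p x = p y \<longleftrightarrow> x - y \<in> A)"

definition endomorphism :: "'b set \<Rightarrow> ('b \<Rightarrow> 'b) \<Rightarrow> bool" where
  "endomorphism X f \<longleftrightarrow> f ` X \<subseteq> X \<and> (\<forall>x\<in>X. \<forall>y\<in>X. f (x + y) = f x + f y) \<and>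
     (\<forall>c. \<forall>x\<in>X. f (scale c x) = scale c (f x))"

definition space_rep :: "'b set \<Rightarrow> ('a, 'b) rep" where
  "space_rep X = \<lparr>space = X, vzero = 0, vadd = (+), vscale = scale, act = (\<lambda>_ v. v)\<rparr>"

definition subspace_trace :: "'b set \<Rightarrow> ('b \<Rightarrow> 'b) \<Rightarrow> 'a" where
  "subspace_trace X f = trace (space_rep X) f"

lemma presents_space_rep:
  assumes "subspace X"
  shows "presents X {0} (\<lambda>x. x) (space_rep X)"
  using assms subspace_0[OF assms] by (auto simp: presents_def space_rep_def)

text \<open>If a basis \<open>B - C\<close> of \<open>A\<close> is extended to a basis \<open>B\<close> of \<open>X\<close>, the images of the elements of \<open>C\<close>
  form a basis of \<open>X/A\<close>, and the coordinates of a class are the coefficients at \<open>C\<close> of any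
  representative.\<close>

lemma coordinates_presented:
  assumes P: "presents X A p V" and B: "independent B" "finite B" "X = span B"
    and C: "C \<subseteq> B" "A = span (B - C)"
  shows "\<exists>n \<phi> h. coordinates V n \<phi> \<and> bij_betw h {..<n} C \<and>
    (\<forall>x\<in>X. \<forall>i<n. \<phi> (p x) i = representation B x (h i)) \<and>
    (\<forall>i<n. inv_into (space V) \<phi> (unit_vector i) = p (h i))"
proof -
  have finC: "finite C" using B C finite_subset by blast
  obtain h where h: "bij_betw h {..<card C} C"
    using ex_bij_betw_nat_finite[OF finC] by (auto simp: atLeast0LessThan)
  define n where "n = card C"
  define \<phi> where "\<phi> v = (\<lambda>i. if i < n then representation B (inv_into X p v) (h i) else 0)" for v
  note P' = P[unfolded presents_def]
  have hC: "h i \<in> C" if "i < n" for i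
    using h that by (auto simp: bij_betw_def n_def)
  have rep0: "representation B x b = 0" if "x \<in> A" "b \<in> C" for x b
  proof -
    have "representation B x = representation (B - C) x"
      by (rule representation_extend) (use B C that in auto)
    thus ?thesis using representation_ne_zero[of "B - C" x b] that by auto
  qed
  have \<phi>p: "\<phi> (p x) = (\<lambda>i. if i < n then representation B x (h i) else 0)" if x: "x \<in> X" for x
  proof -
    define y where "y = inv_into X p (p x)"
    have y: "y \<in> X" "p y = p x"
      using x by (auto simp: y_def inv_into_into f_inv_into_f)
    have "y - x \<in> A" using P' x y by blast
    hence "representation B (y - x) (h i) = 0" if "i < n" for i
      using rep0 hC that by blast
    moreover have "representation B (y - x) = (\<lambda>b. representation B y b - representation B x b)"
      by (rule representation_diff) (use x y B in auto)
    ultimately show ?thesis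
      by (auto simp: \<phi>_def fun_eq_iff simp flip: y_def)
  qed
  have add: "\<phi> (vadd V u v) = (\<lambda>i. \<phi> u i + \<phi> v i)" if uv: "u \<in> space V" "v \<in> space V" for u v
  proof -
    obtain x y where xy: "x \<in> X" "u = p x" "y \<in> X" "v = p y" using uv P' by blast
    have "vadd V u v = p (x + y)" "x + y \<in> X" using xy P' subspace_add by auto
    thus ?thesis using xy B
      by (auto simp: \<phi>p fun_eq_iff representation_add)
  qed
  have scl: "\<phi> (vscale V c v) = (\<lambda>i. c * \<phi> v i)" if v: "v \<in> space V" for c v
  proof -
    obtain x where x: "x \<in> X" "v = p x" using v P' by blast
    have "vscale V c v = p (scale c x)" "scale c x \<in> X" using x P' subspace_scale by auto
    thus ?thesis using x B
      by (auto simp: \<phi>p fun_eq_iff representation_scale)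
  qed
  have inj: "inj_on \<phi> (space V)"
  proof (rule inj_onI)
    fix u v assume uv: "u \<in> space V" "v \<in> space V" and eq: "\<phi> u = \<phi> v"
    obtain x y where xy: "x \<in> X" "u = p x" "y \<in> X" "v = p y" using uv P' by blast
    have xyX: "x - y \<in> X" using xy P' subspace_diff by blast
    have r: "representation B (x - y) = (\<lambda>b. representation B x b - representation B y b)"
      by (rule representation_diff) (use xy B in auto)
    have z: "representation B (x - y) b = 0" if b: "b \<in> C" for b
    proof -
      obtain i where "i < n" "b = h i" using h b by (auto simp: bij_betw_def n_def)
      thus ?thesis using fun_cong[OF eq, of i] xy by (simp add: r \<phi>p)
    qed
    have "x - y = (\<Sum>b\<in>B. scale (representation B (x - y) b) b)"
      using sum_representation_eq[of B "x - y" B] B xyX by simp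
    also have "\<dots> = (\<Sum>b\<in>B - C. scale (representation B (x - y) b) b)"
      by (rule sum.mono_neutral_right) (use B z in auto)
    also have "\<dots> \<in> A" unfolding C by (intro span_sum span_scale span_base)
    finally show "u = v" using xy P' by blast
  qed
  have ph: "\<phi> (p (h i)) = unit_vector i" if i: "i < n" for i
  proof -
    have "h i \<in> X" using hC[OF i] C B span_base by blast
    moreover have "representation B (h i) = (\<lambda>v. if v = h i then 1 else 0)"
      by (rule representation_basis) (use B C hC[OF i] in auto)
    moreover have "h j = h i \<longleftrightarrow> j = i" if "j < n" for j
      using h i that by (auto simp: bij_betw_def inj_on_def n_def)
    ultimately show ?thesis using i by (auto simp: \<phi>p unit_vector_def fun_eq_iff)
  qed
  have phs: "p (h i) \<in> space V" if "i < n" for i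
    using hC[OF that] C B P' span_base by blast
  have "\<phi> ` space V = {a. \<forall>i\<ge>n. a i = 0}"
  proof (intro equalityI subsetI)
    fix a assume "a \<in> \<phi> ` space V" thus "a \<in> {a. \<forall>i\<ge>n. a i = 0}" by (auto simp: \<phi>_def)
  next
    fix a :: "nat \<Rightarrow> 'a" assume a: "a \<in> {a. \<forall>i\<ge>n. a i = 0}"
    define g where "g b = a (inv_into {..<n} h b)" for b
    define x where "x = (\<Sum>b\<in>C. scale (g b) b)"
    have x: "x \<in> X" unfolding x_def B using C by (intro span_sum span_scale span_base) auto
    have "representation B x = (\<lambda>b. if b \<in> C then g b else 0)"
    proof (rule representation_eqI)
      have "(\<Sum>b | (if b \<in> C then g b else 0) \<noteq> 0. scale (if b \<in> C then g b else 0) b)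
          = (\<Sum>b\<in>C. scale (if b \<in> C then g b else 0) b)"
        by (rule sum.mono_neutral_left) (use finC in auto)
      thus "(\<Sum>b | (if b \<in> C then g b else 0) \<noteq> 0. scale (if b \<in> C then g b else 0) b) = x"
        by (simp add: x_def)
      show "finite {b. (if b \<in> C then g b else 0) \<noteq> 0}"
        by (rule finite_subset[OF _ finC]) auto
      show "b \<in> B" if "(if b \<in> C then g b else 0) \<noteq> 0" for b
        using that C by (auto split: if_splits)
    qed (use B x in auto)
    moreover have "g (h i) = a i" if "i < n" for i
      using h that by (simp add: g_def bij_betw_def n_def inv_into_f_f)
    ultimately have "\<phi> (p x) = a"
      using a hC x by (auto simp: \<phi>p fun_eq_iff)
    thus "a \<in> \<phi> ` space V" using x P' by blast
  qed
  hence "coordinates V n \<phi>"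
    using inj add scl by (auto simp: coordinates_def bij_betw_def)
  moreover have "inv_into (space V) \<phi> (unit_vector i) = p (h i)" if "i < n" for i
    by (rule inv_into_f_eq) (use inj ph phs that in auto)
  ultimately show ?thesis
    using h \<phi>p unfolding n_def by (intro exI[of _ "card C"] exI[of _ \<phi>] exI[of _ h]) auto
qed

lemma trace_presented_basis:
  assumes P: "presents X A p V" and B: "independent B" "finite B" "X = span B"
    and C: "C \<subseteq> B" "A = span (B - C)"
    and f: "endomorphism X f" and F: "\<And>x. x \<in> X \<Longrightarrow> F (p x) = p (f x)"
  shows "trace V F = (\<Sum>b\<in>C. representation B (f b) b)"
proof -
  note P' = P[unfolded presents_def]
  note f' = f[unfolded endomorphism_def]
  obtain n \<phi> h where co: "coordinates V n \<phi>" and h: "bij_betw h {..<n} C"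
    and ph: "\<And>x i. x \<in> X \<Longrightarrow> i < n \<Longrightarrow> \<phi> (p x) i = representation B x (h i)"
    and inv: "\<And>i. i < n \<Longrightarrow> inv_into (space V) \<phi> (unit_vector i) = p (h i)"
    using coordinates_presented[OF P B C] by blast
  have ad: "vadd V u v \<in> space V \<and> F (vadd V u v) = vadd V (F u) (F v)"
    if uv: "u \<in> space V" "v \<in> space V" for u v
  proof -
    obtain x y where xy: "x \<in> X" "u = p x" "y \<in> X" "v = p y" using uv P' by blast
    have 1: "vadd V (p x) (p y) = p (x + y)" and 2: "x + y \<in> X" using xy P' subspace_add by auto
    have 3: "f (x + y) = f x + f y" "f x \<in> X" "f y \<in> X" using f' xy by auto
    have "F (p (x + y)) = p (f x + f y)" using F[OF 2] 3(1) by simp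
    also have "\<dots> = vadd V (p (f x)) (p (f y))" using P' 3(2,3) by blast
    finally have "F (p (x + y)) = vadd V (p (f x)) (p (f y))" .
    moreover have "p (x + y) \<in> space V" using P' 2 by blast
    ultimately show ?thesis unfolding xy(2,4) 1 F[OF xy(1)] F[OF xy(3)] by blast
  qed
  have sc: "vscale V c v \<in> space V \<and> F (vscale V c v) = vscale V c (F v) \<and> F v \<in> space V"
    if v: "v \<in> space V" for c v
  proof -
    obtain x where x: "x \<in> X" "v = p x" using v P' by blast
    have 1: "vscale V c (p x) = p (scale c x)" and 2: "scale c x \<in> X" using x P' subspace_scale by auto
    have 3: "f (scale c x) = scale c (f x)" "f x \<in> X" using f' x by auto
    have "F (p (scale c x)) = p (scale c (f x))" using F[OF 2] 3(1) by simp
    also have "p (scale c (f x)) = vscale V c (p (f x))" using P' 3(2) by blast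
    finally have "F (p (scale c x)) = vscale V c (p (f x))" .
    moreover have "p (scale c x) \<in> space V" "p (f x) \<in> space V" using P' 2 3 by blast+
    ultimately show ?thesis unfolding x(2) 1 F[OF x(1)] by blast
  qed
  have "trace V F = matrix_trace V n \<phi> F"
    by (rule trace_eq_matrix_trace) (use ad sc co in auto)
  also have "\<dots> = (\<Sum>i<n. representation B (f (h i)) (h i))"
    unfolding matrix_trace_def
  proof (intro sum.cong)
    fix i assume "i \<in> {..<n}"
    hence i: "i < n" by simp
    have hX: "h i \<in> X" using h i C B span_base by (auto simp: bij_betw_def)
    show "\<phi> (F (inv_into (space V) \<phi> (unit_vector i))) i = representation B (f (h i)) (h i)"
      using hX f' i by (simp add: inv F ph image_subset_iff)
  qed simp
  also have "\<dots> = (\<Sum>b\<in>C. representation B (f b) b)"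
    by (rule sum.reindex_bij_betw[OF h])
  finally show ?thesis .
qed

lemma bases_of_pair:
  assumes "subspace X" "subspace A" "A \<subseteq> X" "finite S" "X \<subseteq> span S"
  obtains B C where "independent B" "finite B" "X = span B" "C \<subseteq> B" "A = span (B - C)"
    "independent (B - C)"
proof -
  obtain D where D: "D \<subseteq> A" "independent D" "A \<subseteq> span D"
    using maximal_independent_subset[of A] by blast
  obtain B where B: "D \<subseteq> B" "B \<subseteq> X" "independent B" "X \<subseteq> span B"
    using maximal_independent_subset_extend[of D X] D assms by blast
  have "finite B" using independent_span_bound[OF assms(4) B(3)] B assms by blast
  moreover have "X = span B" using B assms span_minimal by blast
  moreover have "A = span (B - (B - D))"
  proof -
    have "B - (B - D) = D" using B by blast
    thus ?thesis using D assms span_minimal by (metis subset_antisym)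
  qed
  moreover have "independent (B - (B - D))"
    using B independent_mono by blast
  ultimately show ?thesis using B that[of B "B - D"] by blast
qed

lemma endomorphism_restrict:
  assumes "endomorphism X f" "A \<subseteq> X" "f ` A \<subseteq> A"
  shows "endomorphism A f"
  using assms unfolding endomorphism_def by (auto simp: subset_iff)

text \<open>In a basis of \<open>X\<close> that extends one of \<open>A\<close>, the matrix of \<open>f\<close> is block triangular, with the matrices
  on \<open>A\<close> and on \<open>X/A\<close> as diagonal blocks.\<close>

lemma trace_presented:
  assumes P: "presents X A p V" and S: "finite S" "X \<subseteq> span S"
    and f: "endomorphism X f" "f ` A \<subseteq> A" and F: "\<And>x. x \<in> X \<Longrightarrow> F (p x) = p (f x)"
  shows "trace V F = subspace_trace X f - subspace_trace A f"
proof -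
  note P' = P[unfolded presents_def]
  obtain B C where B: "independent B" "finite B" "X = span B" and C: "C \<subseteq> B" "A = span (B - C)"
    and BC: "independent (B - C)"
    using bases_of_pair[of X A S] P' S by blast
  have "trace V F = (\<Sum>b\<in>C. representation B (f b) b)"
    by (rule trace_presented_basis[OF P B C f(1) F])
  moreover have "subspace_trace X f = (\<Sum>b\<in>B. representation B (f b) b)"
    unfolding subspace_trace_def
    by (rule trace_presented_basis[OF presents_space_rep B]) (use f P' B in auto)
  moreover have "subspace_trace A f = (\<Sum>b\<in>B - C. representation (B - C) (f b) b)"
    unfolding subspace_trace_def
    by (rule trace_presented_basis[OF presents_space_rep BC])
      (use f P' B C endomorphism_restrict[OF f(1) _ f(2)] in auto)
  moreover have "(\<Sum>b\<in>B - C. representation (B - C) (f b) b) = (\<Sum>b\<in>B - C. representation B (f b) b)"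
  proof (intro sum.cong refl)
    fix b assume "b \<in> B - C"
    hence "f b \<in> span (B - C)" using f C span_base by blast
    thus "representation (B - C) (f b) b = representation B (f b) b"
      using representation_extend[of B "f b" "B - C"] B by simp
  qed
  moreover have "(\<Sum>b\<in>B. representation B (f b) b) =
      (\<Sum>b\<in>B - C. representation B (f b) b) + (\<Sum>b\<in>C. representation B (f b) b)"
    using sum.subset_diff[OF C(1) B(2)] by simp
  ultimately show ?thesis by simp
qed

lemma subspace_trace_zero: 
  assumes "endomorphism {0} f"
  shows "subspace_trace {0} f = 0"
proof -
  have "trace (space_rep {0}) f = subspace_trace {0} f - subspace_trace {0} f"
    by (rule trace_presented[where S = "{}", OF presents_space_rep]) (use assms in \<open>auto simp: endomorphism_def\<close>)
  thus ?thesis by (simp add: subspace_trace_def)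
qed

lemma subspace_trace_scale:
  assumes X: "subspace X" and S: "finite S" "X \<subseteq> span S" and f: "endomorphism X f"
  shows "subspace_trace X (\<lambda>x. scale c (f x)) = c * subspace_trace X f"
proof -
  obtain B where B: "independent B" "finite B" "X = span B"
    using bases_of_pair[of X X S] X S by blast
  have g: "endomorphism X (\<lambda>x. scale c (f x))"
    using f X subspace_scale by (auto simp: endomorphism_def scale_right_distrib)
  have *: "subspace_trace X h = (\<Sum>b\<in>B. representation B (h b) b)" if "endomorphism X h" for h
    unfolding subspace_trace_def
    by (rule trace_presented_basis[OF presents_space_rep B]) (use that X B in auto)
  have "representation B (scale c (f b)) b = c * representation B (f b) b" if "b \<in> B" for b
  proof -
    have "f b \<in> span B" using f B that span_base by (auto simp: endomorphism_def)
    thus ?thesis using representation_scale[of B "f b" c] B by simp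
  qed
  thus ?thesis using * f g by (simp add: sum_distrib_left)
qed

text \<open>The subspace \<open>W\<close> need not be contained in \<open>X\<close>: a graded piece of \<open>R\<close> is mapped to the cosets of a
  whole ideal.\<close>

lemma presents_coset:
  assumes V: "vadd V = (+)" "vscale V = scale" "homog V e = X"
    and X: "subspace X" and W: "subspace W"
  shows "presents X (X \<inter> W) (coset V W) (component (quotient_rep V W) e)"
proof -
  have co: "coset V W x = {x + w | w. w \<in> W}" for x
    by (auto simp: coset_def V)
  have ad: "coset V W (x + y) = {a + b | a b. a \<in> coset V W x \<and> b \<in> coset V W y}" for x y
  proof (intro equalityI subsetI)
    fix z assume "z \<in> coset V W (x + y)"
    then obtain w where w: "w \<in> W" "z = x + y + w" by (auto simp: co)
    have "x + w \<in> coset V W x" "y \<in> coset V W y" "z = (x + w) + y"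
      using w subspace_0[OF W] by (auto simp: co algebra_simps)
    thus "z \<in> {a + b | a b. a \<in> coset V W x \<and> b \<in> coset V W y}" by blast
  next
    fix z assume "z \<in> {a + b | a b. a \<in> coset V W x \<and> b \<in> coset V W y}"
    then obtain w w' where w: "w \<in> W" "w' \<in> W" "z = x + w + (y + w')" by (auto simp: co)
    have "w + w' \<in> W" "z = x + y + (w + w')" using w subspace_add[OF W] by (auto simp: algebra_simps)
    thus "z \<in> coset V W (x + y)" unfolding co by blast
  qed
  have sc: "coset V W (scale c x) = {scale c a + w | a w. a \<in> coset V W x \<and> w \<in> W}" for c x
  proof (intro equalityI subsetI)
    fix z assume "z \<in> coset V W (scale c x)"
    moreover have "x \<in> coset V W x" using subspace_0[OF W] by (auto simp: co)
    ultimately show "z \<in> {scale c a + w | a w. a \<in> coset V W x \<and> w \<in> W}"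
      unfolding co[of "scale c x"] by blast
  next
    fix z assume "z \<in> {scale c a + w | a w. a \<in> coset V W x \<and> w \<in> W}"
    then obtain w w' where w: "w \<in> W" "w' \<in> W" "z = scale c (x + w) + w'" by (auto simp: co)
    have "scale c w + w' \<in> W" "z = scale c x + (scale c w + w')"
      using w subspace_add[OF W] subspace_scale[OF W] by (auto simp: scale_right_distrib add_ac)
    thus "z \<in> coset V W (scale c x)" unfolding co by blast
  qed
  have eq: "coset V W x = coset V W y \<longleftrightarrow> x - y \<in> W" for x y
  proof
    assume "coset V W x = coset V W y"
    moreover have "x \<in> coset V W x" using subspace_0[OF W] by (auto simp: co)
    ultimately show "x - y \<in> W" by (auto simp: co)
  next
    assume xy: "x - y \<in> W"
    have "coset V W u \<subseteq> coset V W v" if "u - v \<in> W" for u v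
    proof
      fix z assume "z \<in> coset V W u"
      then obtain w where w: "w \<in> W" "z = u + w" by (auto simp: co)
      have "u - v + w \<in> W" "z = v + (u - v + w)" using w that subspace_add[OF W] by auto
      thus "z \<in> coset V W v" unfolding co by blast
    qed
    moreover have "y - x \<in> W" using subspace_neg[OF W xy] by simp
    ultimately show "coset V W x = coset V W y" using xy by blast
  qed
  have eqX: "coset V W x = coset V W y \<longleftrightarrow> x - y \<in> X \<inter> W" if "x \<in> X" "y \<in> X" for x y
    using eq[of x y] that subspace_diff[OF X] by blast
  show ?thesis
    unfolding presents_def
  proof (intro conjI ballI allI)
    show "subspace (X \<inter> W)" by (rule subspace_inter[OF X W])
    show "coset V W ` X = space (component (quotient_rep V W) e)"
      by (simp add: component_def quotient_rep_def V)
    show "coset V W (x + y)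
        = vadd (component (quotient_rep V W) e) (coset V W x) (coset V W y)" for x y
      by (simp add: component_def quotient_rep_def V ad)
    show "coset V W (scale c x) = vscale (component (quotient_rep V W) e) c (coset V W x)" for c x
      by (simp add: component_def quotient_rep_def V sc)
  qed (use X eqX in auto)
qed

text \<open>The hypotheses say that \<open>\<mu>\<close> induces an isomorphism of \<open>X/A\<close> onto \<open>Y/B\<close> that is compatible with
  \<open>f\<close> and \<open>g\<close>; both sides are the trace on the common quotient.\<close>

lemma trace_isomorphic_quotients:
  assumes X: "subspace X" "finite S" "X \<subseteq> span S" and f: "endomorphism X f" "f ` A \<subseteq> A"
    and A: "subspace A" "A \<subseteq> X"
    and Y: "subspace Y" "finite T" "Y \<subseteq> span T" and g: "endomorphism Y g" "g ` B \<subseteq> B"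
    and B: "subspace B" "B \<subseteq> Y"
    and mu_Y: "\<And>x. x \<in> X \<Longrightarrow> \<mu> x \<in> Y"
    and mu_add: "\<And>x y. x \<in> X \<Longrightarrow> y \<in> X \<Longrightarrow> \<mu> (x + y) = \<mu> x + \<mu> y"
    and mu_scale: "\<And>c x. x \<in> X \<Longrightarrow> \<mu> (scale c x) = scale c (\<mu> x)"
    and mu_f: "\<And>x. x \<in> X \<Longrightarrow> \<mu> (f x) = g (\<mu> x)"
    and mu_A: "\<And>x. x \<in> X \<Longrightarrow> \<mu> x \<in> B \<longleftrightarrow> x \<in> A"
    and mu_onto: "\<And>y. y \<in> Y \<Longrightarrow> \<exists>x\<in>X. y - \<mu> x \<in> B"
  shows "subspace_trace Y g - subspace_trace B g = subspace_trace X f - subspace_trace A f"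
proof -
  define V :: "('a, 'b) graded_rep" where
    "V = \<lparr>space = Y, vzero = 0, vadd = (+), vscale = scale, act = (\<lambda>_ v. v), homog = (\<lambda>_. Y)\<rparr>"
  define Q where "Q = component (quotient_rep V B) 0"
  define p where "p = coset V B"
  \<comment> \<open>the endomorphism of \<open>Y/B\<close> induced by \<open>g\<close>, computed on a chosen representative\<close>
  define F where "F S = p (g (inv_into Y p S))" for S
  have pY: "presents Y B p Q"
    using presents_coset[of V 0 Y B] Y B by (simp add: V_def Q_def p_def Int_absorb1)
  note pY' = pY[unfolded presents_def]
  have QY: "space Q = p ` Y" using pY' by simp
  have p_eq: "p y = p z \<longleftrightarrow> y - z \<in> B" if "y \<in> Y" "z \<in> Y" for y z
    using pY' that by simp
  have Fp: "F (p y) = p (g y)" if y: "y \<in> Y" for y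
  proof -
    define z where "z = inv_into Y p (p y)"
    have z: "z \<in> Y" "p z = p y" using y by (auto simp: z_def inv_into_into f_inv_into_f)
    hence "z - y \<in> B" using p_eq[OF z(1) y] by simp
    hence "g (z - y) \<in> B" using g by blast
    moreover have "g z = g (z - y) + g y"
    proof -
      have "g (z - y + y) = g (z - y) + g y"
        using g(1) subspace_diff[OF Y(1) z(1) y] y unfolding endomorphism_def by blast
      thus ?thesis by simp
    qed
    ultimately have "g z - g y \<in> B" by simp
    moreover have "g z \<in> Y" "g y \<in> Y" using g(1) z y by (auto simp: endomorphism_def)
    ultimately show ?thesis using p_eq[of "g z" "g y"] by (simp add: F_def flip: z_def)
  qed
  have "presents X A (\<lambda>x. p (\<mu> x)) Q"
    unfolding presents_def
  proof (intro conjI ballI allI)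
    show "(\<lambda>x. p (\<mu> x)) ` X = space Q"
    proof (intro equalityI subsetI)
      fix v assume "v \<in> space Q"
      then obtain y where y: "y \<in> Y" "v = p y" unfolding QY by blast
      obtain x where x: "x \<in> X" "y - \<mu> x \<in> B" using mu_onto[OF y(1)] by blast
      hence "p y = p (\<mu> x)" using p_eq[OF y(1) mu_Y[OF x(1)]] by blast
      thus "v \<in> (\<lambda>x. p (\<mu> x)) ` X" using x y by blast
    qed (auto simp: QY mu_Y)
    fix x y assume xy: "x \<in> X" "y \<in> X"
    have "\<mu> x = \<mu> (x - y) + \<mu> y"
      using mu_add[OF subspace_diff[OF X(1) xy] xy(2)] by simp
    hence "\<mu> x - \<mu> y = \<mu> (x - y)" by simp
    thus "p (\<mu> x) = p (\<mu> y) \<longleftrightarrow> x - y \<in> A"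
      using mu_A[OF subspace_diff[OF X(1) xy]] p_eq[OF mu_Y[OF xy(1)] mu_Y[OF xy(2)]] by simp
  qed (use X A pY' mu_Y mu_add mu_scale in auto)
  hence "trace Q F = subspace_trace X f - subspace_trace A f"
    by (rule trace_presented[OF _ X(2,3) f]) (use Fp mu_Y mu_f in auto)
  moreover have "trace Q F = subspace_trace Y g - subspace_trace B g"
    by (rule trace_presented[OF pY Y(2,3) g]) (use Fp in auto)
  ultimately show ?thesis by simp
qed

end

definition scale_pair :: "('a \<Rightarrow> 'b \<Rightarrow> 'b) \<Rightarrow> 'a \<Rightarrow> 'b \<times> 'b \<Rightarrow> 'b \<times> 'b" where
  "scale_pair s c v = (s c (fst v), s c (snd v))"

context endomorphism_traces
begin

lemma endomorphism_traces_pair: "endomorphism_traces (scale_pair scale)"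
  by unfold_locales (auto simp: scale_pair_def scale_right_distrib scale_left_distrib)

text \<open>The endomorphism is \<open>f\<close> tensored with a two by two matrix, so its trace is the product of the
  two traces; the off-diagonal blocks do not meet the diagonal.\<close>

lemma trace_on_square:
  assumes X: "subspace X" "finite S" "X \<subseteq> span S" and f: "endomorphism X f"
    and F_def: "F = (\<lambda>v. (scale a (f (fst v)) + scale c (f (snd v)),
                    scale b (f (fst v)) + scale d (f (snd v))))"
  shows "endomorphism_traces.subspace_trace (scale_pair scale) (X \<times> X) F
    = (a + d) * subspace_trace X f"
proof -
  interpret pair: endomorphism_traces "scale_pair scale" by (rule endomorphism_traces_pair)
  let ?V = "space_rep X" and ?W = "pair.space_rep (X \<times> X)"
  obtain B where B: "independent B" "finite B" "X = span B"
    using bases_of_pair[of X X S] X by blast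
  obtain n \<phi> where co: "coordinates ?V n \<phi>"
    using coordinates_presented[OF presents_space_rep B, of B] X B by auto
  have V: "space ?V = X" "vadd ?V = (+)" "vscale ?V = scale"
    by (simp_all add: space_rep_def)
  have W: "space ?W = X \<times> X" "vadd ?W = (+)" "vscale ?W = scale_pair scale"
    by (simp_all add: pair.space_rep_def)
  have inj: "inj_on \<phi> X" and img: "\<phi> ` X = {a. \<forall>i\<ge>n. a i = 0}"
    and add: "\<And>u v. u \<in> X \<Longrightarrow> v \<in> X \<Longrightarrow> \<phi> (u + v) = (\<lambda>i. \<phi> u i + \<phi> v i)"
    and scl: "\<And>c v. v \<in> X \<Longrightarrow> \<phi> (scale c v) = (\<lambda>i. c * \<phi> v i)"
    using co by (auto simp: coordinates_def bij_betw_def V)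
  have sup: "\<phi> v i = 0" if "v \<in> X" "i \<ge> n" for v i
    using img that by blast
  have z: "0 \<in> X" by (rule subspace_0[OF X(1)])
  have \<phi>0: "\<phi> 0 = (\<lambda>i. 0)"
    using scl[OF z, of 0] by simp
  define w where "w i = inv_into X \<phi> (unit_vector i)" for i
  have w: "w i \<in> X" "\<phi> (w i) = unit_vector i" if "i < n" for i
  proof -
    have "(unit_vector i :: nat \<Rightarrow> 'a) \<in> \<phi> ` X"
      using that by (auto simp: img unit_vector_def)
    thus "w i \<in> X" "\<phi> (w i) = unit_vector i"
      by (simp_all add: w_def inv_into_into f_inv_into_f)
  qed
  define \<Phi> where "\<Phi> v = (\<lambda>i. if i < n then \<phi> (fst v) i else \<phi> (snd v) (i - n))" for v
  have injP: "inj_on \<Phi> (X \<times> X)"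
  proof (rule inj_onI)
    fix u v assume uv: "u \<in> X \<times> X" "v \<in> X \<times> X" and eq: "\<Phi> u = \<Phi> v"
    have "\<phi> (fst u) i = \<phi> (fst v) i" for i
      using fun_cong[OF eq, of i] uv sup[of _ i] by (cases "i < n") (auto simp: \<Phi>_def)
    moreover have "\<phi> (snd u) i = \<phi> (snd v) i" for i
      using fun_cong[OF eq, of "i + n"] by (simp add: \<Phi>_def)
    ultimately show "u = v"
      using inj uv by (auto simp: inj_on_def prod_eq_iff mem_Times_iff fun_eq_iff)
  qed
  have imgP: "\<Phi> ` (X \<times> X) = {a. \<forall>i\<ge>2 * n. a i = 0}"
  proof (intro equalityI subsetI)
    fix a assume "a \<in> \<Phi> ` (X \<times> X)"
    thus "a \<in> {a. \<forall>i\<ge>2 * n. a i = 0}" by (auto simp: \<Phi>_def sup)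
  next
    fix a :: "nat \<Rightarrow> 'a" assume a: "a \<in> {a. \<forall>i\<ge>2 * n. a i = 0}"
    have "(\<lambda>i. if i < n then a i else 0) \<in> \<phi> ` X" "(\<lambda>i. a (i + n)) \<in> \<phi> ` X"
      using a by (auto simp: img)
    then obtain x y where xy: "x \<in> X" "\<phi> x = (\<lambda>i. if i < n then a i else 0)"
      "y \<in> X" "\<phi> y = (\<lambda>i. a (i + n))" by (metis (no_types, lifting) imageE)
    have "\<Phi> (x, y) = a" by (auto simp: \<Phi>_def fun_eq_iff xy)
    thus "a \<in> \<Phi> ` (X \<times> X)" using xy by blast
  qed
  have coP: "coordinates ?W (2 * n) \<Phi>"
    using injP imgP
    by (auto simp: coordinates_def bij_betw_def W \<Phi>_def fun_eq_iff add scl scale_pair_def)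
  have f': "f x \<in> X" "f (x + y) = f x + f y" "f (scale c x) = scale c (f x)"
    if "x \<in> X" "y \<in> X" for x y c
    using f that by (auto simp: endomorphism_def)
  have f0: "f 0 = 0" using f'(3)[OF z z, of 0] by simp
  have FX: "F v \<in> X \<times> X" if "v \<in> X \<times> X" for v
    using that f' subspace_add[OF X(1)] subspace_scale[OF X(1)] by (auto simp: F_def)
  have "pair.subspace_trace (X \<times> X) F = matrix_trace ?W (2 * n) \<Phi> F"
    unfolding pair.subspace_trace_def
  proof (rule trace_eq_matrix_trace)
    show "F (vscale ?W c v) = vscale ?W c (F v)" if "v \<in> space ?W" for c v
      using that by (auto simp: F_def W scale_pair_def f' scale_right_distrib mult.commute)
  qed (use FX coP subspace_add[OF X(1)] subspace_scale[OF X(1)]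
      in \<open>auto simp: F_def W scale_pair_def f' scale_right_distrib\<close>)
  also have "\<dots> = (\<Sum>i<2 * n. \<Phi> (F (inv_into (X \<times> X) \<Phi> (unit_vector i))) i)"
    by (simp add: matrix_trace_def W)
  also have "\<dots> = (\<Sum>i<n. \<Phi> (F (inv_into (X \<times> X) \<Phi> (unit_vector i))) i)
      + (\<Sum>i<n. \<Phi> (F (inv_into (X \<times> X) \<Phi> (unit_vector (i + n)))) (i + n))"
  proof -
    have "{..<2 * n} = {..<n} \<union> {n..<2 * n}" by auto
    moreover have "(\<Sum>i\<in>{n..<2 * n}. g i) = (\<Sum>i<n. g (i + n))" for g :: "nat \<Rightarrow> 'a"
      using sum.shift_bounds_nat_ivl[of g 0 n n] by (simp add: atLeast0LessThan mult_2)
    ultimately show ?thesis by (simp add: sum.union_disjoint ivl_disj_int)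
  qed
  also have "(\<Sum>i<n. \<Phi> (F (inv_into (X \<times> X) \<Phi> (unit_vector i))) i) = (\<Sum>i<n. a * \<phi> (f (w i)) i)"
  proof (intro sum.cong refl)
    fix i assume "i \<in> {..<n}" hence i: "i < n" by simp
    have "\<Phi> (w i, 0) = unit_vector i"
      using i w[OF i] by (auto simp: \<Phi>_def fun_eq_iff \<phi>0 unit_vector_def)
    hence "inv_into (X \<times> X) \<Phi> (unit_vector i) = (w i, 0)"
      by (intro inv_into_f_eq[OF injP]) (use w[OF i] z in auto)
    thus "\<Phi> (F (inv_into (X \<times> X) \<Phi> (unit_vector i))) i = a * \<phi> (f (w i)) i"
      using i w[OF i] f' by (simp add: F_def f0 \<Phi>_def scl)
  qed
  also have "(\<Sum>i<n. \<Phi> (F (inv_into (X \<times> X) \<Phi> (unit_vector (i + n)))) (i + n))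
      = (\<Sum>i<n. d * \<phi> (f (w i)) i)"
  proof (intro sum.cong refl)
    fix i assume "i \<in> {..<n}" hence i: "i < n" by simp
    have "\<Phi> (0, w i) = unit_vector (i + n)"
      using i w[OF i] by (auto simp: \<Phi>_def fun_eq_iff \<phi>0 unit_vector_def)
    hence "inv_into (X \<times> X) \<Phi> (unit_vector (i + n)) = (0, w i)"
      by (intro inv_into_f_eq[OF injP]) (use w[OF i] z in auto)
    thus "\<Phi> (F (inv_into (X \<times> X) \<Phi> (unit_vector (i + n)))) (i + n) = d * \<phi> (f (w i)) i"
      using i w[OF i] f' by (simp add: F_def f0 \<Phi>_def scl)
  qed
  also have "(\<Sum>i<n. a * \<phi> (f (w i)) i) + (\<Sum>i<n. d * \<phi> (f (w i)) i)
      = (a + d) * (\<Sum>i<n. \<phi> (f (w i)) i)"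
    by (simp add: sum_distrib_left distrib_right sum.distrib)
  also have "(\<Sum>i<n. \<phi> (f (w i)) i) = subspace_trace X f"
  proof -
    have "subspace_trace X f = matrix_trace ?V n \<phi> f"
      unfolding subspace_trace_def
      by (rule trace_eq_matrix_trace)
        (use co subspace_add[OF X(1)] subspace_scale[OF X(1)] in \<open>auto simp: V f'\<close>)
    thus ?thesis by (simp add: matrix_trace_def V w_def)
  qed
  finally show ?thesis .
qed

end

section \<open>Homogeneous polynomials and permutations of the variables\<close>

abbreviation lookup where "lookup \<equiv> Poly_Mapping.lookup"
abbreviation single where "single \<equiv> Poly_Mapping.single"
abbreviation keys where "keys \<equiv> Poly_Mapping.keys"

interpretation ideal: module "(*) :: 'a::comm_ring_1 \<Rightarrow> 'a \<Rightarrow> 'a"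
  by (rule module_times)

\<comment> \<open>for multiplication this is the reverse of \<open>mult.assoc\<close>, and the two together would loop\<close>
declare ideal.scale_scale [simp del]

interpretation poly: endomorphism_traces "scalar_mult :: 'k::field \<Rightarrow> ('a \<Rightarrow>\<^sub>0 'k) \<Rightarrow> ('a \<Rightarrow>\<^sub>0 'k)"
  by (simp add: endomorphism_traces_def vector_space_scalar_mult)

lemma lookup_scalar_mult [simp]:
  "lookup (scalar_mult c p) x = (c::'k::field) * lookup p x"
  by (simp add: scalar_mult_def Poly_Mapping.map.rep_eq when_def)

lemma scalar_mult_eq_times:
  "scalar_mult c p = single 0 c * (p :: 'a::monoid_add \<Rightarrow>\<^sub>0 'k::field)"
  unfolding scalar_mult_def by (rule mult_map_scale_conv_mult)

lemma scalar_mult_times_left: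
  "scalar_mult c (p * q) = scalar_mult c p * (q :: 'k::field poly4)"
  unfolding scalar_mult_eq_times by (rule mult.assoc[symmetric])

lemma sum_singles: "(\<Sum>\<alpha>\<in>keys p. single \<alpha> (lookup p \<alpha>)) = p"
  by (rule poly_mapping_eqI)
    (auto simp: lookup_sum lookup_single when_def in_keys_iff)

definition total_degree :: "(4 \<Rightarrow>\<^sub>0 nat) \<Rightarrow> nat" where
  "total_degree \<alpha> = (\<Sum>i\<in>UNIV. lookup \<alpha> i)"

lemma total_degree_add: "total_degree (\<alpha> + \<beta>) = total_degree \<alpha> + total_degree \<beta>"
  by (simp add: total_degree_def lookup_add sum.distrib)

lemma total_degree_eq_0: "total_degree \<alpha> = 0 \<Longrightarrow> \<alpha> = 0"
  by (rule poly_mapping_eqI) (simp add: total_degree_def)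

lemma mem_homogeneous_polys:
  "p \<in> homogeneous_polys e \<longleftrightarrow> (\<forall>\<alpha>. lookup p \<alpha> \<noteq> 0 \<longrightarrow> total_degree \<alpha> = e)"
  by (auto simp: homogeneous_polys_def total_degree_def in_keys_iff)

definition hom_part :: "nat \<Rightarrow> 'k::field poly4 \<Rightarrow> 'k poly4" where
  "hom_part e p = Poly_Mapping.Abs_poly_mapping
     (\<lambda>\<alpha>. lookup p \<alpha> when total_degree \<alpha> = e)"

lemma lookup_hom_part [simp]:
  "lookup (hom_part e p) \<alpha> = (lookup p \<alpha> when total_degree \<alpha> = e)"
proof -
  have "{\<alpha>. (lookup p \<alpha> when total_degree \<alpha> = e) \<noteq> 0} \<subseteq> keys p"
    by (auto simp: in_keys_iff when_def)
  hence "finite {\<alpha>. (lookup p \<alpha> when total_degree \<alpha> = e) \<noteq> 0}"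
    by (rule finite_subset) simp
  thus ?thesis by (simp add: hom_part_def lookup_Abs_poly_mapping)
qed

lemma hom_part_mem [simp]: "hom_part e p \<in> homogeneous_polys e"
  by (auto simp: mem_homogeneous_polys when_def)

lemma hom_part_same: "p \<in> homogeneous_polys e \<Longrightarrow> hom_part e p = p"
  by (rule poly_mapping_eqI) (auto simp: mem_homogeneous_polys when_def)

lemma hom_part_other: "p \<in> homogeneous_polys e \<Longrightarrow> j \<noteq> e \<Longrightarrow> hom_part j p = 0"
  by (rule poly_mapping_eqI) (auto simp: mem_homogeneous_polys when_def)

lemma hom_part_add: "hom_part e (p + q) = hom_part e p + hom_part e q"
  by (rule poly_mapping_eqI) (auto simp: lookup_add when_def)

lemma hom_part_zero [simp]: "hom_part e 0 = 0"
  by (rule poly_mapping_eqI) (auto simp: when_def)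

lemma hom_part_sum: "hom_part e (\<Sum>i\<in>A. f i) = (\<Sum>i\<in>A. hom_part e (f i))"
  by (induction A rule: infinite_finite_induct) (auto simp: hom_part_add)

lemma hom_part_minus: "hom_part e (- p) = - hom_part e p"
  by (rule poly_mapping_eqI) (auto simp: when_def)

lemma sum_hom_parts: "(\<Sum>e\<in>total_degree ` keys p. hom_part e p) = p"
  by (rule poly_mapping_eqI)
    (auto simp: lookup_sum when_def in_keys_iff)

lemma subspace_homogeneous_polys: "poly.subspace (homogeneous_polys e :: 'a::field poly4 set)"
proof (rule poly.subspaceI)
  fix p q :: "'a poly4" assume pq: "p \<in> homogeneous_polys e" "q \<in> homogeneous_polys e"
  show "p + q \<in> homogeneous_polys e"
    unfolding mem_homogeneous_polys
  proof (intro allI impI)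
    fix \<alpha> assume "lookup (p + q) \<alpha> \<noteq> 0"
    hence "lookup p \<alpha> \<noteq> 0 \<or> lookup q \<alpha> \<noteq> 0"
      by (auto simp: lookup_add)
    thus "total_degree \<alpha> = e" using pq by (auto simp: mem_homogeneous_polys)
  qed
qed (auto simp: mem_homogeneous_polys)

lemma homogeneous_polys_mult:
  assumes "p \<in> homogeneous_polys i" "q \<in> homogeneous_polys j"
  shows "p * q \<in> homogeneous_polys (i + j)"
proof -
  have "total_degree \<alpha> = i + j" if "\<alpha> \<in> keys (p * q)" for \<alpha>
  proof -
    have "\<alpha> \<in> {a + b | a b. a \<in> keys p \<and> b \<in> keys q}"
      using keys_mult that by blast
    thus ?thesis using assms
      by (auto simp: mem_homogeneous_polys in_keys_iff total_degree_add)
  qed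
  thus ?thesis by (auto simp: mem_homogeneous_polys in_keys_iff)
qed

text \<open>Degree \<open>e\<close> in the free module \<open>R(-\<delta>)\<close>, whose generator has degree \<open>\<delta>\<close>.  The case distinction
  replaces the truncated difference \<open>e - \<delta>\<close>, which would yield constants for \<open>e < \<delta>\<close>.\<close>

definition hom_part_shifted :: "nat \<Rightarrow> nat \<Rightarrow> 'k::field poly4 \<Rightarrow> 'k poly4" where
  "hom_part_shifted \<delta> e p = (if \<delta> \<le> e then hom_part (e - \<delta>) p else 0)"

definition homogeneous_shifted :: "nat \<Rightarrow> nat \<Rightarrow> 'k::field poly4 set" where
  "homogeneous_shifted \<delta> e = (if \<delta> \<le> e then homogeneous_polys (e - \<delta>) else {0})"

lemma hom_part_times_homogeneous:
  assumes q: "q \<in> homogeneous_polys \<delta>"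
  shows "hom_part e (p * q) = hom_part_shifted \<delta> e p * q"
proof -
  define D where "D = total_degree ` keys p"
  have "hom_part e (p * q) = hom_part e (\<Sum>i\<in>D. hom_part i p * q)"
    using sum_hom_parts[of p] by (simp add: D_def flip: sum_distrib_right)
  also have "\<dots> = (\<Sum>i\<in>D. hom_part e (hom_part i p * q))"
    by (rule hom_part_sum)
  also have "\<dots> = (\<Sum>i\<in>D. if i + \<delta> = e then hom_part i p * q else 0)"
    using hom_part_same[OF homogeneous_polys_mult[OF hom_part_mem q]]
      hom_part_other[OF homogeneous_polys_mult[OF hom_part_mem q]]
    by (intro sum.cong refl) auto
  also have "\<dots> = hom_part_shifted \<delta> e p * q"
  proof (cases "\<delta> \<le> e")
    case True
    have "hom_part (e - \<delta>) p = 0" if "e - \<delta> \<notin> D"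
    proof (rule poly_mapping_eqI)
      fix \<alpha>
      have "lookup p \<alpha> = 0" if "total_degree \<alpha> = e - \<delta>"
        using that \<open>e - \<delta> \<notin> D\<close> unfolding D_def by (metis image_eqI in_keys_iff)
      thus "lookup (hom_part (e - \<delta>) p) \<alpha> = lookup 0 \<alpha>"
        by (simp add: when_def)
    qed
    moreover have "(i + \<delta> = e) = (i = e - \<delta>)" for i using True by auto
    ultimately show ?thesis using True by (auto simp: hom_part_shifted_def D_def)
  next
    case False
    thus ?thesis by (auto simp: hom_part_shifted_def intro: sum.neutral)
  qed
  finally show ?thesis .
qed

lemma hom_part_shifted_mem: "hom_part_shifted \<delta> e p \<in> homogeneous_shifted \<delta> e"
  by (simp add: hom_part_shifted_def homogeneous_shifted_def)

lemma hom_part_shifted_same: "p \<in> homogeneous_shifted \<delta> e \<Longrightarrow> hom_part_shifted \<delta> e p = p"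
  by (auto simp: hom_part_shifted_def homogeneous_shifted_def hom_part_same split: if_splits)

lemma hom_part_shifted_add:
  "hom_part_shifted \<delta> e (p + q) = hom_part_shifted \<delta> e p + hom_part_shifted \<delta> e q"
  by (simp add: hom_part_shifted_def hom_part_add)

lemma hom_part_shifted_sum:
  "hom_part_shifted \<delta> e (\<Sum>i\<in>A. f i) = (\<Sum>i\<in>A. hom_part_shifted \<delta> e (f i))"
  by (simp add: hom_part_shifted_def hom_part_sum)

lemma hom_part_shifted_times:
  assumes "q \<in> homogeneous_polys \<pi>"
  shows "hom_part_shifted \<delta> e (q * p) = q * hom_part_shifted (\<delta> + \<pi>) e p"
  using hom_part_times_homogeneous[OF assms, of "e - \<delta>" p]
  by (auto simp: hom_part_shifted_def mult.commute)

lemma homogeneous_shifted_mult: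
  assumes "p \<in> homogeneous_shifted \<delta> e" "q \<in> homogeneous_polys \<delta>"
  shows "p * q \<in> homogeneous_polys e"
  using assms homogeneous_polys_mult[of p "e - \<delta>" q \<delta>] 
  by (auto simp: homogeneous_shifted_def mem_homogeneous_polys[of 0] split: if_splits)

lemma subspace_homogeneous_shifted:
  "poly.subspace (homogeneous_shifted \<delta> e :: 'k::field poly4 set)"
  by (simp add: homogeneous_shifted_def subspace_homogeneous_polys)

lemma finite_total_degree: "finite {\<alpha>. total_degree \<alpha> = e}"
proof -
  have "lookup \<alpha> i \<le> total_degree \<alpha>" for \<alpha> i
    unfolding total_degree_def by (rule member_le_sum) auto
  hence "lookup ` {\<alpha>. total_degree \<alpha> = e} \<subseteq> (\<Pi>\<^sub>E i\<in>UNIV. {..e})"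
    by (auto simp: PiE_UNIV_domain)
  hence "finite (lookup ` {\<alpha>. total_degree \<alpha> = e})"
    by (rule finite_subset) (simp add: finite_PiE)
  thus ?thesis
    by (rule finite_imageD) (auto simp: inj_on_def lookup_inject)
qed

definition monomials_of_degree :: "nat \<Rightarrow> 'k::field poly4 set" where
  "monomials_of_degree e = (\<lambda>\<alpha>. single \<alpha> 1) ` {\<alpha>. total_degree \<alpha> = e}"

lemma finite_monomials_of_degree: "finite (monomials_of_degree e)"
  by (simp add: monomials_of_degree_def finite_total_degree)

lemma homogeneous_polys_span: "homogeneous_polys e \<subseteq> poly.span (monomials_of_degree e :: 'k::field poly4 set)"
proof
  fix p :: "'k poly4" assume p: "p \<in> homogeneous_polys e"
  have "p = (\<Sum>\<alpha>\<in>keys p. scalar_mult (lookup p \<alpha>) (single \<alpha> 1))"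
    by (rule poly_mapping_eqI)
      (auto simp: lookup_sum lookup_single when_def in_keys_iff if_distrib[of "\<lambda>x. _ * x"] cong: if_cong)
  also have "\<dots> \<in> poly.span (monomials_of_degree e)"
    using p by (intro poly.span_sum poly.span_scale poly.span_base)
      (auto simp: monomials_of_degree_def mem_homogeneous_polys in_keys_iff)
  finally show "p \<in> poly.span (monomials_of_degree e)" .
qed

lemma homogeneous_shifted_span:
  "homogeneous_shifted \<delta> e \<subseteq> poly.span (monomials_of_degree (e - \<delta>) :: 'k::field poly4 set)"
  using homogeneous_polys_span poly.span_zero by (auto simp: homogeneous_shifted_def)

definition permute_exponents :: "S4 \<Rightarrow> (4 \<Rightarrow>\<^sub>0 nat) \<Rightarrow> (4 \<Rightarrow>\<^sub>0 nat)" where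
  "permute_exponents \<sigma> \<alpha> = (\<Sum>i\<in>UNIV. single (apply \<sigma> i) (lookup \<alpha> i))"

lemma apply_eq_iff_S4: "apply \<sigma> i = j \<longleftrightarrow> i = apply (inverse \<sigma>) j" for \<sigma> :: S4
  using perm_conj_inverse_apply by metis

lemma lookup_permute_exponents:
  "lookup (permute_exponents \<sigma> \<alpha>) j = lookup \<alpha> (apply (inverse \<sigma>) j)"
  by (simp add: permute_exponents_def lookup_sum lookup_single when_def apply_eq_iff_S4)

lemma permute_exponents_add:
  "permute_exponents \<sigma> (\<alpha> + \<beta>) = permute_exponents \<sigma> \<alpha> + permute_exponents \<sigma> \<beta>"
  by (rule poly_mapping_eqI) (simp add: lookup_permute_exponents lookup_add)

lemma permute_exponents_mult:
  "permute_exponents (\<sigma> * \<tau>) \<alpha> = permute_exponents \<sigma> (permute_exponents \<tau> \<alpha>)"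
  by (rule poly_mapping_eqI) (simp add: lookup_permute_exponents apply_times)

lemma permute_exponents_one [simp]: "permute_exponents 1 \<alpha> = \<alpha>"
  by (rule poly_mapping_eqI) (simp add: lookup_permute_exponents)

lemma permute_exponents_inverse [simp]:
  "permute_exponents (inverse \<sigma>) (permute_exponents \<sigma> \<alpha>) = \<alpha>"
  "permute_exponents \<sigma> (permute_exponents (inverse \<sigma>) \<alpha>) = \<alpha>"
  by (simp_all flip: permute_exponents_mult)

lemma total_degree_permute [simp]: "total_degree (permute_exponents \<sigma> \<alpha>) = total_degree \<alpha>"
proof -
  have "bij (apply (inverse \<sigma>))" by simp
  thus ?thesis unfolding total_degree_def lookup_permute_exponents
    by (rule sum.reindex_bij_betw)
qed

lemma permute_vars_eq_sum:
  "permute_vars \<sigma> p = (\<Sum>\<alpha>\<in>keys p.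
     single (permute_exponents \<sigma> \<alpha>) (lookup p \<alpha>))"
proof -
  have pow: "var i ^ n = (single (single i n) 1 :: 'k::field poly4)" for i n
    by (induction n) (auto simp: var_def mult_single single_add[symmetric])
  have prd: "(\<Prod>i\<in>A. single (f i) 1) = (single (\<Sum>i\<in>A. f i) 1 :: 'k::field poly4)"
    for A :: "4 set" and f :: "4 \<Rightarrow> (4 \<Rightarrow>\<^sub>0 nat)"
    by (induction A rule: infinite_finite_induct) (auto simp: mult_single)
  show ?thesis
    by (simp add: permute_vars_def permute_exponents_def pow prd mult_single)
qed

lemma lookup_permute_vars:
  "lookup (permute_vars \<sigma> p) \<beta> = lookup p (permute_exponents (inverse \<sigma>) \<beta>)"
proof -
  have "(permute_exponents \<sigma> \<alpha> = \<beta>) = (\<alpha> = permute_exponents (inverse \<sigma>) \<beta>)" for \<alpha>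
    by auto
  thus ?thesis
    by (auto simp: permute_vars_eq_sum lookup_sum lookup_single when_def in_keys_iff)
qed

lemma permute_vars_add: "permute_vars \<sigma> (p + q) = permute_vars \<sigma> p + permute_vars \<sigma> q"
  by (rule poly_mapping_eqI) (simp add: lookup_permute_vars lookup_add)

lemma permute_vars_zero [simp]: "permute_vars \<sigma> 0 = 0"
  by (rule poly_mapping_eqI) (simp add: lookup_permute_vars)

lemma permute_vars_minus: "permute_vars \<sigma> (- p) = - permute_vars \<sigma> p"
  by (rule poly_mapping_eqI) (simp add: lookup_permute_vars)

lemma permute_vars_sum: "permute_vars \<sigma> (\<Sum>i\<in>A. f i) = (\<Sum>i\<in>A. permute_vars \<sigma> (f i))"
  by (induction A rule: infinite_finite_induct) (auto simp: permute_vars_add)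

lemma permute_vars_scale: "permute_vars \<sigma> (scalar_mult c p) = scalar_mult c (permute_vars \<sigma> p)"
  by (rule poly_mapping_eqI) (simp add: lookup_permute_vars)

lemma permute_vars_mult_perm: "permute_vars (\<sigma> * \<tau>) p = permute_vars \<sigma> (permute_vars \<tau> p)"
  by (rule poly_mapping_eqI) (simp add: lookup_permute_vars permute_exponents_mult)

lemma permute_vars_one [simp]: "permute_vars 1 p = p"
  by (rule poly_mapping_eqI) (simp add: lookup_permute_vars)

lemma permute_vars_single:
  "permute_vars \<sigma> (single \<alpha> c) = single (permute_exponents \<sigma> \<alpha>) c"
  by (simp add: permute_vars_eq_sum)

lemma permute_vars_times: "permute_vars \<sigma> (p * q) = permute_vars \<sigma> p * permute_vars \<sigma> q"
proof -
  define P where "P = keys p"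
  define Q where "Q = keys q"
  have "p * q = (\<Sum>\<alpha>\<in>P. single \<alpha> (lookup p \<alpha>)) *
      (\<Sum>\<beta>\<in>Q. single \<beta> (lookup q \<beta>))"
    by (simp add: P_def Q_def sum_singles)
  also have "permute_vars \<sigma> \<dots> = (\<Sum>\<alpha>\<in>P. permute_vars \<sigma> (single \<alpha> (lookup p \<alpha>))) *
      (\<Sum>\<beta>\<in>Q. permute_vars \<sigma> (single \<beta> (lookup q \<beta>)))"
    by (simp add: sum_product permute_vars_sum mult_single permute_vars_single permute_exponents_add)
  also have "\<dots> = permute_vars \<sigma> p * permute_vars \<sigma> q"
    by (simp add: P_def Q_def sum_singles flip: permute_vars_sum)
  finally show ?thesis .
qed

lemma permute_vars_homogeneous:
  "p \<in> homogeneous_polys e \<Longrightarrow> permute_vars \<sigma> p \<in> homogeneous_polys e"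
  unfolding mem_homogeneous_polys lookup_permute_vars by (metis total_degree_permute)

section \<open>Relations between generators of an ideal\<close>

definition relation :: "nat \<Rightarrow> (nat \<Rightarrow> 'a::comm_ring_1) \<Rightarrow> (nat \<Rightarrow> 'a) \<Rightarrow> bool" where
  "relation n g c \<longleftrightarrow> (\<Sum>i<n. c i * g i) = 0"

text \<open>Where \<open>2\<close> is invertible a skew-symmetric \<open>M\<close> has zero diagonal, and these are the combinations of
  the relations that express \<open>g\<^sub>i g\<^sub>j = g\<^sub>j g\<^sub>i\<close>, that is, the boundaries in the Koszul complex.\<close>

definition koszul_relation :: "nat \<Rightarrow> (nat \<Rightarrow> 'a::comm_ring_1) \<Rightarrow> (nat \<Rightarrow> 'a) \<Rightarrow> bool" where
  "koszul_relation n g c \<longleftrightarrow> (\<exists>M. (\<forall>i<n. \<forall>j<n. M i j = - M j i) \<and>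
     (\<forall>i<n. c i = (\<Sum>j<n. M i j * g j)))"

lemma mem_ideal_generated_image:
  "x \<in> ideal_generated (g ` {..<n::nat}) \<longleftrightarrow> (\<exists>a. x = (\<Sum>i<n. a i * g i))"
proof
  assume "x \<in> ideal_generated (g ` {..<n})"
  thus "\<exists>a. x = (\<Sum>i<n. a i * g i)"
  proof (induction rule: ideal.span_induct_alt)
    case base
    show ?case by (rule exI[of _ "\<lambda>_. 0"]) simp
  next
    case (step c y z)
    then obtain i a where "i < n" "y = g i" "z = (\<Sum>i<n. a i * g i)" by auto
    moreover have "(\<Sum>j<n. (if j = i then c else 0) * g j) = c * g i"
      using \<open>i < n\<close> by (simp add: if_distrib[of "\<lambda>t. t * _"] cong: if_cong)
    ultimately have "c * y + z = (\<Sum>j<n. (a j + (if j = i then c else 0)) * g j)"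
      by (simp add: distrib_right sum.distrib)
    thus ?case by (intro exI[of _ "\<lambda>j. a j + (if j = i then c else 0)"])
  qed
next
  assume "\<exists>a. x = (\<Sum>i<n. a i * g i)"
  then obtain a where a: "x = (\<Sum>i<n. a i * g i)" by blast
  show "x \<in> ideal_generated (g ` {..<n})"
    unfolding a by (intro ideal.span_sum ideal.span_scale ideal.span_base) auto
qed

lemma sum_mem_ideal_generated_image:
  "x = (\<Sum>i<n. a i * g i) \<Longrightarrow> x \<in> ideal_generated (g ` {..<n::nat})"
  unfolding mem_ideal_generated_image by (rule exI[of _ a])

text \<open>In a relation \<open>c\<close> the last coefficient lies in the ideal of the earlier elements, say
  \<open>c\<^sub>n = \<Sum>e\<^sub>j f\<^sub>j\<close>.  Subtracting the Koszul relations of \<open>f\<^sub>n\<close> and \<open>f\<^sub>j\<close> with coefficient \<open>e\<^sub>j\<close> clears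
  the last entry and leaves a relation of the shorter sequence.\<close>

lemma regular_sequence_relations:
  assumes "\<And>i x. i < n \<Longrightarrow> f i * x \<in> ideal_generated (f ` {..<i}) \<Longrightarrow> x \<in> ideal_generated (f ` {..<i})"
    and "relation n f c"
  shows "koszul_relation n f c"
  using assms
proof (induction n arbitrary: c)
  case 0
  thus ?case by (simp add: koszul_relation_def)
next
  case (Suc n)
  have "c n * f n = - (\<Sum>i<n. c i * f i)"
    using Suc.prems(2) by (simp add: relation_def eq_neg_iff_add_eq_0 add.commute)
  also have "\<dots> = (\<Sum>i<n. (- c i) * f i)"
    by (simp add: sum_negf)
  finally have "f n * c n = (\<Sum>i<n. (- c i) * f i)"
    by (simp add: mult.commute)
  hence "f n * c n \<in> ideal_generated (f ` {..<n})"
    by (rule sum_mem_ideal_generated_image)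
  hence "c n \<in> ideal_generated (f ` {..<n})"
    using Suc.prems(1) by blast
  then obtain e where e: "c n = (\<Sum>j<n. e j * f j)"
    by (auto simp: mem_ideal_generated_image)
  have "(\<Sum>i<n. (c i + e i * f n) * f i) = (\<Sum>i<n. c i * f i) + (\<Sum>i<n. e i * f i) * f n"
    by (simp add: algebra_simps sum.distrib sum_distrib_left)
  also have "\<dots> = 0"
    using Suc.prems(2) by (simp add: relation_def e)
  finally have rel: "relation n f (\<lambda>i. c i + e i * f n)"
    by (simp add: relation_def)
  have "koszul_relation n f (\<lambda>i. c i + e i * f n)"
    by (rule Suc.IH[OF Suc.prems(1) rel]) auto
  then obtain M where M: "\<forall>i<n. \<forall>j<n. M i j = - M j i"
    and cM: "\<forall>i<n. c i + e i * f n = (\<Sum>j<n. M i j * f j)"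
    unfolding koszul_relation_def by blast
  define M' where "M' i j = (if i < n then (if j < n then M i j else - e i)
    else (if j < n then e j else 0))" for i j
  have "\<forall>i<Suc n. \<forall>j<Suc n. M' i j = - M' j i"
  proof (intro allI impI)
    fix i j
    show "M' i j = - M' j i"
      using M[rule_format, of i j] by (cases "i < n"; cases "j < n") (simp_all add: M'_def)
  qed
  moreover have "c i = (\<Sum>j<Suc n. M' i j * f j)" if "i < Suc n" for i
  proof (cases "i < n")
    case True
    hence "c i = (\<Sum>j<n. M i j * f j) - e i * f n"
      using cM by (simp add: eq_diff_eq)
    thus ?thesis using True by (simp add: M'_def)
  next
    case False
    thus ?thesis using that e by (simp add: M'_def less_Suc_eq)
  qed
  ultimately show ?case unfolding koszul_relation_def by blast
qed

text \<open>A relation \<open>c\<close> of \<open>g = A f\<close> gives the relation \<open>A\<^sup>T c\<close> of \<open>f\<close>, which is \<open>M f = M B g\<close>; multiplying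
  by \<open>B\<^sup>T\<close> shows that \<open>(A B)\<^sup>T c\<close> is the Koszul relation with matrix \<open>B\<^sup>T M B\<close>.  The error
  \<open>E = 1 - A B\<close> kills \<open>g\<close>, as \<open>A B g = A f = g\<close>.\<close>

lemma relations_change_of_generators:
  assumes kos: "\<And>c. relation r f c \<Longrightarrow> koszul_relation r f c"
    and A: "\<And>i. i < n \<Longrightarrow> g i = (\<Sum>j<r. A i j * f j)"
    and B: "\<And>j. j < r \<Longrightarrow> f j = (\<Sum>k<n. B j k * g k)"
  defines "E \<equiv> \<lambda>k i. (if k = i then 1 else 0) - (\<Sum>j<r. A k j * B j i)"
  shows "\<And>k. k < n \<Longrightarrow> relation n g (E k)"
    and "\<And>c. relation n g c \<Longrightarrow> koszul_relation n g (\<lambda>i. c i - (\<Sum>k<n. c k * E k i))"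
proof -
  show "relation n g (E k)" if k: "k < n" for k
  proof -
    have "(\<Sum>i<n. E k i * g i) = (\<Sum>i<n. (if k = i then 1 else 0) * g i)
        - (\<Sum>i<n. \<Sum>j<r. A k j * B j i * g i)"
      by (simp add: E_def left_diff_distrib sum_subtractf sum_distrib_right)
    also have "(\<Sum>i<n. (if k = i then 1 else 0) * g i) = g k"
      using k by (simp add: if_distrib[of "\<lambda>t. t * _"] cong: if_cong)
    also have "(\<Sum>i<n. \<Sum>j<r. A k j * B j i * g i) = (\<Sum>j<r. \<Sum>i<n. A k j * B j i * g i)"
      by (rule sum.swap)
    also have "\<dots> = (\<Sum>j<r. A k j * f j)"
    proof (intro sum.cong refl)
      fix j assume "j \<in> {..<r}"
      hence "j < r" by simp
      show "(\<Sum>i<n. A k j * B j i * g i) = A k j * f j"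
        unfolding B[OF \<open>j < r\<close>] sum_distrib_left by (simp only: mult.assoc)
    qed
    also have "\<dots> = g k" using A[OF k] by simp
    finally show ?thesis by (simp add: relation_def)
  qed
  fix c assume c: "relation n g c"
  define y where "y j = (\<Sum>k<n. c k * A k j)" for j
  have "(\<Sum>j<r. y j * f j) = (\<Sum>j<r. \<Sum>k<n. c k * A k j * f j)"
    by (simp add: y_def sum_distrib_right)
  also have "\<dots> = (\<Sum>k<n. \<Sum>j<r. c k * A k j * f j)" by (rule sum.swap)
  also have "\<dots> = (\<Sum>k<n. c k * g k)"
  proof (intro sum.cong refl)
    fix k assume "k \<in> {..<n}"
    hence "k < n" by simp
    show "(\<Sum>j<r. c k * A k j * f j) = c k * g k"
      unfolding A[OF \<open>k < n\<close>] sum_distrib_left by (simp only: mult.assoc)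
  qed
  finally have "relation r f y" using c by (simp add: relation_def)
  from kos[OF this] obtain M where M: "\<And>i j. i < r \<Longrightarrow> j < r \<Longrightarrow> M i j = - M j i"
    and yM: "\<And>i. i < r \<Longrightarrow> y i = (\<Sum>j<r. M i j * f j)"
    unfolding koszul_relation_def by blast
  define N where "N i m = (\<Sum>j<r. \<Sum>l<r. B j i * M j l * B l m)" for i m
  have "N i m = - N m i" for i m
  proof -
    have "N i m = (\<Sum>j<r. \<Sum>l<r. - (B l m * M l j * B j i))"
      unfolding N_def
    proof (intro sum.cong refl)
      fix j l assume "j \<in> {..<r}" "l \<in> {..<r}"
      hence "B j i * M j l * B l m = B j i * - M l j * B l m" using M[of j l] by simp
      also have "\<dots> = - (B l m * M l j * B j i)" by (simp add: mult_ac)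
      finally show "B j i * M j l * B l m = - (B l m * M l j * B j i)" .
    qed
    also have "\<dots> = - (\<Sum>j<r. \<Sum>l<r. B l m * M l j * B j i)"
      by (simp add: sum_negf)
    also have "(\<Sum>j<r. \<Sum>l<r. B l m * M l j * B j i) = N m i"
      unfolding N_def by (rule sum.swap)
    finally show ?thesis .
  qed
  moreover have "c i - (\<Sum>k<n. c k * E k i) = (\<Sum>m<n. N i m * g m)" if i: "i < n" for i
  proof -
    have "(\<Sum>k<n. c k * E k i) = (\<Sum>k<n. c k * (if k = i then 1 else 0))
        - (\<Sum>k<n. \<Sum>j<r. c k * A k j * B j i)"
      by (simp add: E_def right_diff_distrib sum_subtractf sum_distrib_left mult.assoc)
    also have "(\<Sum>k<n. c k * (if k = i then 1 else 0)) = c i"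
      using i by (simp add: if_distrib[of "\<lambda>t. _ * t"] cong: if_cong)
    also have "(\<Sum>k<n. \<Sum>j<r. c k * A k j * B j i) = (\<Sum>j<r. \<Sum>k<n. c k * A k j * B j i)"
      by (rule sum.swap)
    also have "\<dots> = (\<Sum>j<r. B j i * y j)"
      by (simp add: y_def sum_distrib_left mult_ac)
    also have "\<dots> = (\<Sum>j<r. \<Sum>l<r. \<Sum>m<n. B j i * M j l * B l m * g m)"
    proof (intro sum.cong refl)
      fix j assume "j \<in> {..<r}"
      hence j: "j < r" by simp
      have "M j l * f l = (\<Sum>m<n. M j l * (B l m * g m))" if "l < r" for l
        unfolding B[OF that] sum_distrib_left ..
      hence "y j = (\<Sum>l<r. \<Sum>m<n. M j l * (B l m * g m))"
        unfolding yM[OF j] by (intro sum.cong refl) simp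
      thus "B j i * y j = (\<Sum>l<r. \<Sum>m<n. B j i * M j l * B l m * g m)"
        by (simp only: sum_distrib_left mult.assoc)
    qed
    also have "\<dots> = (\<Sum>j<r. \<Sum>m<n. \<Sum>l<r. B j i * M j l * B l m * g m)"
      by (intro sum.cong refl sum.swap)
    also have "\<dots> = (\<Sum>m<n. \<Sum>j<r. \<Sum>l<r. B j i * M j l * B l m * g m)"
      by (rule sum.swap)
    also have "\<dots> = (\<Sum>m<n. N i m * g m)"
      by (simp add: N_def sum_distrib_right)
    finally show ?thesis by simp
  qed
  ultimately show "koszul_relation n g (\<lambda>i. c i - (\<Sum>k<n. c k * E k i))"
    unfolding koszul_relation_def by blast
qed

lemma koszul_relation_add:
  assumes "koszul_relation n g c" "koszul_relation n g c'"
  shows "koszul_relation n g (\<lambda>i. c i + c' i)"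
proof -
  obtain M where M: "\<And>i j. i < n \<Longrightarrow> j < n \<Longrightarrow> M i j = - M j i"
    and c: "\<And>i. i < n \<Longrightarrow> c i = (\<Sum>j<n. M i j * g j)"
    using assms(1) unfolding koszul_relation_def by blast
  obtain M' where M': "\<And>i j. i < n \<Longrightarrow> j < n \<Longrightarrow> M' i j = - M' j i"
    and c': "\<And>i. i < n \<Longrightarrow> c' i = (\<Sum>j<n. M' i j * g j)"
    using assms(2) unfolding koszul_relation_def by blast
  have "M i j + M' i j = - (M j i + M' j i)" if "i < n" "j < n" for i j
    using M[OF that] M'[OF that] by (simp only: minus_add_distrib)
  moreover have "c i + c' i = (\<Sum>j<n. (M i j + M' i j) * g j)" if "i < n" for i
    using c[OF that] c'[OF that] by (simp add: distrib_right sum.distrib)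
  ultimately show ?thesis
    unfolding koszul_relation_def by (intro exI[of _ "\<lambda>i j. M i j + M' i j"] conjI allI impI)
qed

lemma koszul_relation_times:
  assumes "koszul_relation n g c"
  shows "koszul_relation n g (\<lambda>i. p * c i)"
proof -
  obtain M where M: "\<And>i j. i < n \<Longrightarrow> j < n \<Longrightarrow> M i j = - M j i"
    and c: "\<And>i. i < n \<Longrightarrow> c i = (\<Sum>j<n. M i j * g j)"
    using assms unfolding koszul_relation_def by blast
  have "p * M i j = - (p * M j i)" if "i < n" "j < n" for i j
    using M[OF that] by (simp only: mult_minus_right)
  moreover have "p * c i = (\<Sum>j<n. p * M i j * g j)" if "i < n" for i
    using c[OF that] by (simp add: sum_distrib_left mult.assoc)
  ultimately show ?thesis
    unfolding koszul_relation_def by (intro exI[of _ "\<lambda>i j. p * M i j"] conjI allI impI)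
qed

lemma koszul_relation_hom_part:
  assumes "koszul_relation n g c" and g: "\<And>i. i < n \<Longrightarrow> g i \<in> homogeneous_polys (\<delta> i)"
  shows "koszul_relation n g (\<lambda>i. hom_part_shifted (\<delta> i) e (c i))"
proof -
  obtain M where M: "\<And>i j. i < n \<Longrightarrow> j < n \<Longrightarrow> M i j = - M j i"
    and cM: "\<And>i. i < n \<Longrightarrow> c i = (\<Sum>j<n. M i j * g j)"
    using assms(1) unfolding koszul_relation_def by blast
  define N where "N i j = hom_part_shifted (\<delta> i + \<delta> j) e (M i j)" for i j
  have "N i j = - N j i" if "i < n" "j < n" for i j
  proof -
    have "N i j = hom_part_shifted (\<delta> i + \<delta> j) e (- M j i)"
      unfolding N_def using M[OF that] by simp
    thus ?thesis by (simp add: N_def hom_part_shifted_def hom_part_minus add.commute)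
  qed
  moreover have "hom_part_shifted (\<delta> i) e (c i) = (\<Sum>j<n. N i j * g j)" if i: "i < n" for i
  proof -
    have "hom_part_shifted (\<delta> i) e (c i) = (\<Sum>j<n. hom_part_shifted (\<delta> i) e (g j * M i j))"
      using cM[OF i] by (simp add: hom_part_shifted_sum mult.commute)
    also have "\<dots> = (\<Sum>j<n. N i j * g j)"
      by (intro sum.cong refl) (simp add: N_def hom_part_shifted_times[OF g] mult.commute)
    finally show ?thesis .
  qed
  ultimately show ?thesis unfolding koszul_relation_def by blast
qed

lemma relation_hom_part:
  assumes "relation n g c" and g: "\<And>i. i < n \<Longrightarrow> g i \<in> homogeneous_polys (\<delta> i)"
  shows "relation n g (\<lambda>i. hom_part_shifted (\<delta> i) e (c i))"
proof -
  have "hom_part e (\<Sum>i<n. c i * g i) = (\<Sum>i<n. hom_part_shifted (\<delta> i) e (c i) * g i)"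
    unfolding hom_part_sum by (intro sum.cong refl) (simp add: hom_part_times_homogeneous[OF g])
  thus ?thesis using assms(1) by (simp add: relation_def)
qed

text \<open>Read \<open>N\<close> and \<open>T\<close> as graded submodules of a product of shifted copies of \<open>R\<close>; the hypothesis \<open>step\<close>
  says that \<open>N\<close> is contained in \<open>T\<close> plus the irrelevant ideal times \<open>N\<close>.  Taking degree \<open>e\<close>
  components in such a decomposition of a homogeneous element, the factors of positive degree leave
  elements of \<open>N\<close> of smaller degree, which are in \<open>T\<close> by induction.\<close>

lemma graded_nakayama:
  fixes T N :: "(nat \<Rightarrow> 'k::field poly4) \<Rightarrow> bool" and \<delta> :: "nat \<Rightarrow> nat"
  assumes T_add: "\<And>c c'. T c \<Longrightarrow> T c' \<Longrightarrow> T (\<lambda>i. c i + c' i)"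
    and T_times: "\<And>c p. T c \<Longrightarrow> T (\<lambda>i. p * c i)"
    and T_part: "\<And>c e. T c \<Longrightarrow> T (\<lambda>i. hom_part_shifted (\<delta> i) e (c i))"
    and N_part: "\<And>c e. N c \<Longrightarrow> N (\<lambda>i. hom_part_shifted (\<delta> i) e (c i))"
    and step: "\<And>c e. N c \<Longrightarrow> \<forall>i. c i \<in> homogeneous_shifted (\<delta> i) e \<Longrightarrow>
      \<exists>(K :: 'j set) p \<pi> E. finite K \<and>
        (\<forall>k\<in>K. p k \<in> homogeneous_polys (\<pi> k) \<and> \<pi> k > 0 \<and> N (E k)) \<and>
        T (\<lambda>i. c i - (\<Sum>k\<in>K. p k * E k i))"
    and c: "N c" "\<forall>i. c i \<in> homogeneous_shifted (\<delta> i) e"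
  shows "T c"
  using c
proof (induction e arbitrary: c rule: less_induct)
  case (less e)
  obtain K :: "'j set" and p \<pi> E where K: "finite K"
    and p: "\<And>k. k \<in> K \<Longrightarrow> p k \<in> homogeneous_polys (\<pi> k)"
    and \<pi>: "\<And>k. k \<in> K \<Longrightarrow> \<pi> k > 0" and E: "\<And>k. k \<in> K \<Longrightarrow> N (E k)"
    and t: "T (\<lambda>i. c i - (\<Sum>k\<in>K. p k * E k i))"
    using step[OF less.prems] by blast
  define t where "t i = c i - (\<Sum>k\<in>K. p k * E k i)" for i
  define D where "D k i = p k * hom_part_shifted (\<delta> i + \<pi> k) e (E k i)" for k i
  have T0: "T (\<lambda>i. 0)" using T_times[OF t, of 0] by simp
  have TD: "T (D k)" if k: "k \<in> K" for k
  proof (cases "\<pi> k \<le> e")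
    case True
    have "T (\<lambda>i. hom_part_shifted (\<delta> i) (e - \<pi> k) (E k i))"
      using True \<pi>[OF k] hom_part_shifted_mem
      by (intro less.IH[of "e - \<pi> k"] N_part E k) auto
    moreover have "(\<lambda>i. hom_part_shifted (\<delta> i) (e - \<pi> k) (E k i))
        = (\<lambda>i. hom_part_shifted (\<delta> i + \<pi> k) e (E k i))"
      using True by (intro ext) (simp add: hom_part_shifted_def le_diff_conv2 add.commute)
    ultimately show ?thesis
      using T_times[of "\<lambda>i. hom_part_shifted (\<delta> i + \<pi> k) e (E k i)" "p k"]
      unfolding D_def by simp
  next
    case False
    hence "D k = (\<lambda>i. 0)" by (auto simp: D_def hom_part_shifted_def)
    thus ?thesis using T0 by simp
  qed
  have TS: "T (\<lambda>i. \<Sum>k\<in>L. D k i)" if "L \<subseteq> K" for L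
    using finite_subset[OF that K] that
  proof (induction L rule: finite_induct)
    case (insert k L)
    thus ?case using T_add[of "D k"] TD by simp
  qed (simp add: T0)
  have "c i = hom_part_shifted (\<delta> i) e (t i) + (\<Sum>k\<in>K. D k i)" for i
  proof -
    have "c i = hom_part_shifted (\<delta> i) e (c i)"
      using less.prems(2) by (simp add: hom_part_shifted_same)
    also have "\<dots> = hom_part_shifted (\<delta> i) e (t i + (\<Sum>k\<in>K. p k * E k i))"
      by (simp add: t_def)
    also have "\<dots> = hom_part_shifted (\<delta> i) e (t i) + (\<Sum>k\<in>K. D k i)"
      by (simp add: hom_part_shifted_add hom_part_shifted_sum D_def hom_part_shifted_times[OF p])
    finally show ?thesis .
  qed
  hence "c = (\<lambda>i. hom_part_shifted (\<delta> i) e (t i) + (\<Sum>k\<in>K. D k i))" by blast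
  thus ?case using T_add[OF T_part[OF t[folded t_def]] TS[of K]] by simp
qed

text \<open>The first Koszul homology of \<open>g\<^sub>0, \<dots>, g\<^sub>n\<^sub>-\<^sub>1\<close> vanishes, stated for homogeneous relations only.\<close>

definition homogeneous_relations_koszul ::
    "nat \<Rightarrow> (nat \<Rightarrow> 'k::field poly4) \<Rightarrow> (nat \<Rightarrow> nat) \<Rightarrow> bool" where
  "homogeneous_relations_koszul n g \<delta> \<longleftrightarrow> (\<forall>e c. relation n g c \<longrightarrow>
     (\<forall>i. c i \<in> homogeneous_shifted (\<delta> i) e) \<longrightarrow> koszul_relation n g c)"

text \<open>The relations of \<open>g\<close> are Koszul up to a combination of the rows of \<open>1 - A B\<close> whose coefficients
  are the entries of the relation.  For minimal generators these entries have positive degree, so that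
  Nakayama applies.\<close>

lemma minimal_generators_koszul:
  fixes f g :: "nat \<Rightarrow> 'k::field poly4"
  assumes reg: "\<And>i x. i < r \<Longrightarrow> f i * x \<in> ideal_generated (f ` {..<i}) \<Longrightarrow> x \<in> ideal_generated (f ` {..<i})"
    and same: "ideal_generated (f ` {..<r}) = ideal_generated (g ` {..<n})"
    and g: "\<And>i. i < n \<Longrightarrow> g i \<in> homogeneous_polys (\<delta> i)"
    and minimal: "\<And>c k. relation n g c \<Longrightarrow> k < n \<Longrightarrow> lookup (c k) 0 = 0"
  shows "homogeneous_relations_koszul n g \<delta>"
proof -
  have "\<exists>a. g i = (\<Sum>j<r. a j * f j)" if "i < n" for i
  proof -
    have "g i \<in> ideal_generated (f ` {..<r})"
      unfolding same using that by (intro ideal.span_base) auto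
    thus ?thesis by (rule iffD1[OF mem_ideal_generated_image])
  qed
  then obtain A where A: "\<And>i. i < n \<Longrightarrow> g i = (\<Sum>j<r. A i j * f j)" by metis
  have "\<exists>b. f j = (\<Sum>k<n. b k * g k)" if "j < r" for j
  proof -
    have "f j \<in> ideal_generated (g ` {..<n})"
      unfolding same[symmetric] using that by (intro ideal.span_base) auto
    thus ?thesis by (rule iffD1[OF mem_ideal_generated_image])
  qed
  then obtain B where B: "\<And>j. j < r \<Longrightarrow> f j = (\<Sum>k<n. B j k * g k)" by metis
  define E where "E k i = (if k = i then 1 else 0) - (\<Sum>j<r. A k j * B j i)" for k i
  note change = relations_change_of_generators[OF regular_sequence_relations A B, OF reg,
      folded E_def]
  have relE: "relation n g (E k)" if "k < n" for k
    by (rule change(1)) (use that in auto)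
  have kosE: "koszul_relation n g (\<lambda>i. c i - (\<Sum>k<n. c k * E k i))" if "relation n g c" for c
    by (rule change(2)) (use that in auto)
  have "koszul_relation n g c" if "relation n g c" "\<forall>i. c i \<in> homogeneous_shifted (\<delta> i) e" for e c
    using that
  proof (rule graded_nakayama[rotated 5, where 'j = nat])
    fix c e assume c: "relation n g c" "\<forall>i. c i \<in> homogeneous_shifted (\<delta> i) e"
    define \<pi> where "\<pi> k = (if c k = 0 then 1 else e - \<delta> k)" for k
    have "c k \<in> homogeneous_polys (\<pi> k) \<and> \<pi> k > 0" if k: "k < n" for k
    proof (cases "c k = 0")
      case True
      thus ?thesis by (simp add: \<pi>_def mem_homogeneous_polys)
    next
      case False
      hence ck: "\<delta> k \<le> e" "c k \<in> homogeneous_polys (e - \<delta> k)"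
        using c(2)[rule_format, of k] by (auto simp: homogeneous_shifted_def split: if_splits)
      have "e - \<delta> k \<noteq> 0"
      proof
        assume 0: "e - \<delta> k = 0"
        have "c k = 0"
        proof (rule poly_mapping_eqI)
          fix \<alpha>
          show "lookup (c k) \<alpha> = lookup 0 \<alpha>"
          proof (cases "total_degree \<alpha> = 0")
            case True
            hence "\<alpha> = 0" by (rule total_degree_eq_0)
            thus ?thesis using minimal[OF c(1) k] by simp
          qed (use ck 0 in \<open>auto simp: mem_homogeneous_polys\<close>)
        qed
        thus False using False by simp
      qed
      thus ?thesis using False ck by (simp add: \<pi>_def)
    qed
    thus "\<exists>(K :: nat set) p \<pi> E. finite K \<and>
        (\<forall>k\<in>K. p k \<in> homogeneous_polys (\<pi> k) \<and> \<pi> k > 0 \<and> relation n g (E k)) \<and>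
        koszul_relation n g (\<lambda>i. c i - (\<Sum>k\<in>K. p k * E k i))"
      using kosE[OF c(1)] relE
      by (intro exI[of _ "{..<n}"] exI[of _ c] exI[of _ \<pi>] exI[of _ E]) simp
  next
    show "koszul_relation n g (\<lambda>i. hom_part_shifted (\<delta> i) e (c i))" if "koszul_relation n g c" for c e
      by (rule koszul_relation_hom_part) (use that g in auto)
    show "relation n g (\<lambda>i. hom_part_shifted (\<delta> i) e (c i))" if "relation n g c" for c e
      by (rule relation_hom_part) (use that g in auto)
  qed (auto intro: koszul_relation_add koszul_relation_times)
  thus ?thesis unfolding homogeneous_relations_koszul_def by blast
qed

lemma self_eq_neg_poly4:
  fixes p :: "'k::field_char_0 poly4"
  assumes "p = - p" shows "p = 0"
proof (rule poly_mapping_eqI)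
  fix \<alpha>
  have "p + p = 0"
    using assms by (simp only: eq_neg_iff_add_eq_0)
  hence "lookup p \<alpha> + lookup p \<alpha> = 0"
    by (simp flip: lookup_add)
  hence "2 * lookup p \<alpha> = 0"
    by (simp only: mult_2)
  thus "lookup p \<alpha> = lookup 0 \<alpha>" by simp
qed

text \<open>If \<open>x g\<^sub>l = \<Sum>a\<^sub>i g\<^sub>i\<close>, then \<open>(-a, x)\<close> is a relation, and its last entry \<open>x\<close> is the combination
  \<open>\<Sum>M\<^sub>l\<^sub>j g\<^sub>j\<close>, in which \<open>g\<^sub>l\<close> does not occur since the diagonal of \<open>M\<close> vanishes.\<close>

lemma homogeneous_nonzerodivisor:
  fixes g :: "nat \<Rightarrow> 'k::field_char_0 poly4"
  assumes kos: "homogeneous_relations_koszul (Suc l) g \<delta>"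
    and g: "\<And>i. i \<le> l \<Longrightarrow> g i \<in> homogeneous_polys (\<delta> i)"
    and x: "x \<in> homogeneous_shifted (\<delta> l) e" "x * g l \<in> ideal_generated (g ` {..<l})"
  shows "x \<in> ideal_generated (g ` {..<l})"
proof -
  obtain a where a: "x * g l = (\<Sum>i<l. a i * g i)"
    using x(2) by (auto simp: mem_ideal_generated_image)
  define c where "c i = (if i < l then - hom_part_shifted (\<delta> i) e (a i) else if i = l then x else 0)" for i
  have "x * g l = hom_part e (x * g l)"
    using homogeneous_shifted_mult[OF x(1) g] by (simp add: hom_part_same)
  also have "\<dots> = (\<Sum>i<l. hom_part_shifted (\<delta> i) e (a i) * g i)"
    unfolding a hom_part_sum by (intro sum.cong refl) (simp add: hom_part_times_homogeneous[OF g])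
  finally have "relation (Suc l) g c"
    by (simp add: relation_def c_def sum_negf)
  moreover have "c i \<in> homogeneous_shifted (\<delta> i) e" for i
    using x(1) hom_part_shifted_mem[of "\<delta> i" e "a i"]
      poly.subspace_neg[OF subspace_homogeneous_shifted] poly.subspace_0[OF subspace_homogeneous_shifted]
    by (auto simp: c_def)
  ultimately have "koszul_relation (Suc l) g c"
    using kos unfolding homogeneous_relations_koszul_def by blast
  then obtain M where M: "\<forall>i<Suc l. \<forall>j<Suc l. M i j = - M j i"
    and cM: "\<forall>i<Suc l. c i = (\<Sum>j<Suc l. M i j * g j)"
    unfolding koszul_relation_def by blast
  have "M l l = 0" using M[rule_format, of l l] by (intro self_eq_neg_poly4) blast
  hence "x = (\<Sum>j<l. M l j * g j)"
    using cM[rule_format, of l] by (simp add: c_def)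
  thus ?thesis by (rule sum_mem_ideal_generated_image)
qed

text \<open>A relation of \<open>g\<^sub>0, \<dots>, g\<^sub>l\<^sub>-\<^sub>1\<close>, extended by \<open>0\<close>, is Koszul with some matrix \<open>M\<close>.  Its last
  entry shows that the last column of \<open>M\<close> is itself a relation of \<open>g\<^sub>0, \<dots>, g\<^sub>l\<^sub>-\<^sub>1\<close>, and the given relation
  differs from a Koszul relation by \<open>g\<^sub>l\<close> times this column.  Since \<open>g\<^sub>l\<close> has positive degree,
  Nakayama applies.\<close>

lemma homogeneous_relations_koszul_drop:
  fixes g :: "nat \<Rightarrow> 'k::field_char_0 poly4"
  assumes kos: "homogeneous_relations_koszul (Suc l) g \<delta>"
    and g: "\<And>i. i \<le> l \<Longrightarrow> g i \<in> homogeneous_polys (\<delta> i)" and pos: "\<delta> l > 0"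
  shows "homogeneous_relations_koszul l g \<delta>"
proof -
  have "koszul_relation l g c" if "relation l g c" "\<forall>i. c i \<in> homogeneous_shifted (\<delta> i) e" for e c
    using that
  proof (rule graded_nakayama[rotated 5, where 'j = nat])
    fix c e assume c: "relation l g c" "\<forall>i. c i \<in> homogeneous_shifted (\<delta> i) e"
    define c' where "c' i = (if i < l then c i else 0)" for i
    have "relation (Suc l) g c'" "\<forall>i. c' i \<in> homogeneous_shifted (\<delta> i) e"
      using c poly.subspace_0[OF subspace_homogeneous_shifted] by (auto simp: relation_def c'_def)
    hence "koszul_relation (Suc l) g c'"
      using kos unfolding homogeneous_relations_koszul_def by blast
    then obtain M where M: "\<forall>i<Suc l. \<forall>j<Suc l. M i j = - M j i"
      and cM: "\<forall>i<Suc l. c' i = (\<Sum>j<Suc l. M i j * g j)"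
      unfolding koszul_relation_def by blast
    have Ml: "M l l = 0" using M[rule_format, of l l] by (intro self_eq_neg_poly4) blast
    have "(\<Sum>i<l. M i l * g i) = - (\<Sum>i<l. M l i * g i)"
    proof -
      have "M i l * g i = - (M l i * g i)" if "i < l" for i
        using M[rule_format, of i l] that by simp
      thus ?thesis by (simp flip: sum_negf)
    qed
    also have "(\<Sum>i<l. M l i * g i) = 0"
      using cM[rule_format, of l] Ml by (simp add: c'_def)
    finally have "relation l g (\<lambda>i. M i l)" by (simp add: relation_def)
    moreover have "koszul_relation l g (\<lambda>i. c i - g l * M i l)"
      unfolding koszul_relation_def
    proof (intro exI[of _ M] conjI allI impI)
      fix i assume i: "i < l"
      show "c i - g l * M i l = (\<Sum>j<l. M i j * g j)"
        using cM[rule_format, of i] i by (simp add: c'_def mult.commute)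
    qed (use M less_SucI in blast)
    ultimately show "\<exists>(K :: nat set) p \<pi> E. finite K \<and>
        (\<forall>k\<in>K. p k \<in> homogeneous_polys (\<pi> k) \<and> \<pi> k > 0 \<and> relation l g (E k)) \<and>
        koszul_relation l g (\<lambda>i. c i - (\<Sum>k\<in>K. p k * E k i))"
      using g pos
      by (intro exI[of _ "{0}"] exI[of _ "\<lambda>_. g l"] exI[of _ "\<lambda>_. \<delta> l"] exI[of _ "\<lambda>_ i. M i l"]) simp
  next
    show "koszul_relation l g (\<lambda>i. hom_part_shifted (\<delta> i) e (c i))" if "koszul_relation l g c" for c e
      by (rule koszul_relation_hom_part) (use that g in auto)
    show "relation l g (\<lambda>i. hom_part_shifted (\<delta> i) e (c i))" if "relation l g c" for c e
      by (rule relation_hom_part) (use that g in auto)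
  qed (auto intro: koszul_relation_add koszul_relation_times)
  thus ?thesis unfolding homogeneous_relations_koszul_def by blast
qed

lemma hom_part_mem_homogeneous_ideal:
  assumes "S \<subseteq> (\<Union>e. homogeneous_polys e)" "p \<in> ideal_generated S"
  shows "hom_part e p \<in> ideal_generated S"
  using assms(2)
proof (induction rule: ideal.span_induct_alt)
  case base
  show ?case by (simp add: ideal.span_zero)
next
  case (step c x y)
  obtain \<delta> where "x \<in> homogeneous_polys \<delta>" using step assms(1) by blast
  hence "hom_part e (c * x + y) = hom_part_shifted \<delta> e c * x + hom_part e y"
    by (simp add: hom_part_add hom_part_times_homogeneous)
  thus ?case using step by (simp add: ideal.span_add ideal.span_scale ideal.span_base)
qed

text \<open>Brings an element of the product into the form needed for Nakayama, with the variables as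
  the factors of positive degree.\<close>

lemma mem_irrelevant_product:
  assumes I: "is_ideal I" and q: "q \<in> ideal_product irrelevant_ideal I"
  shows "\<exists>E. (\<forall>i. E i \<in> I) \<and> q = (\<Sum>i\<in>UNIV. var i * E i)"
proof -
  have *: "\<exists>E. (\<forall>i. E i \<in> I) \<and> a * b = (\<Sum>i\<in>UNIV. var i * E i)"
    if "a \<in> irrelevant_ideal" and b: "b \<in> I" for a b
    using that(1) unfolding irrelevant_ideal_def
  proof (induction rule: ideal.span_induct_alt)
    case base
    show ?case using ideal.subspace_0[OF I] by (intro exI[of _ "\<lambda>_. 0"]) simp
  next
    case (step c x y)
    then obtain i E where i: "x = var i" and E: "\<forall>i. E i \<in> I" "y * b = (\<Sum>i\<in>UNIV. var i * E i)"
      by auto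
    have "(c * x + y) * b = var i * (c * b) + (\<Sum>j\<in>UNIV. var j * E j)"
      unfolding E(2)[symmetric] i by (simp add: algebra_simps)
    also have "\<dots> = (\<Sum>j\<in>UNIV. var j * (E j + (if j = i then c * b else 0)))"
      by (simp add: distrib_left sum.distrib if_distrib[of "\<lambda>t. _ * t"] cong: if_cong)
    finally show ?case
      using E(1) ideal.subspace_add[OF I] ideal.subspace_scale[OF I b]
      by (intro exI[of _ "\<lambda>j. E j + (if j = i then c * b else 0)"]) auto
  qed
  show ?thesis using q unfolding ideal_product_def
  proof (induction rule: ideal.span_induct_alt)
    case base
    show ?case using ideal.subspace_0[OF I] by (intro exI[of _ "\<lambda>_. 0"]) simp
  next
    case (step c x y)
    then obtain E E' where E: "\<forall>i. E i \<in> I" "x = (\<Sum>i\<in>UNIV. var i * E i)"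
      "\<forall>i. E' i \<in> I" "y = (\<Sum>i\<in>UNIV. var i * E' i)"
      using * by blast
    have "c * x + y = (\<Sum>i\<in>UNIV. var i * (c * E i + E' i))"
      by (simp add: E(2,4) sum_distrib_left distrib_left sum.distrib mult.left_commute)
    thus ?case using E(1,3) ideal.subspace_add[OF I] ideal.subspace_scale[OF I]
      by (intro exI[of _ "\<lambda>i. c * E i + E' i"]) auto
  qed
qed

lemma generators_of_nakayama:
  fixes g :: "nat \<Rightarrow> 'k::field poly4"
  assumes I: "is_ideal I" "homogeneous_ideal I"
    and g: "\<And>i. i < n \<Longrightarrow> g i \<in> I \<inter> homogeneous_polys (\<delta> i)"
    and gen: "\<And>p. p \<in> I \<Longrightarrow> \<exists>q\<in>ideal_generated (g ` {..<n}). p - q \<in> ideal_product irrelevant_ideal I"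
  shows "I = ideal_generated (g ` {..<n})"
proof
  show "ideal_generated (g ` {..<n}) \<subseteq> I"
    by (rule ideal.span_minimal) (use g I in auto)
  obtain S where S: "S \<subseteq> (\<Union>e. homogeneous_polys e)" "I = ideal_generated S"
    using I(2) unfolding homogeneous_ideal_def by blast
  have hg: "g ` {..<n} \<subseteq> (\<Union>e. homogeneous_polys e)" using g by blast
  have hom: "p \<in> ideal_generated (g ` {..<n})" if "p \<in> I" "p \<in> homogeneous_polys e" for p e
  proof -
    let ?T = "\<lambda>c :: nat \<Rightarrow> 'k poly4. c 0 \<in> ideal_generated (g ` {..<n})"
    let ?N = "\<lambda>c :: nat \<Rightarrow> 'k poly4. c 0 \<in> I"
    have "?T (\<lambda>_. p)"
    proof (rule graded_nakayama[where T = ?T and N = ?N and c = "\<lambda>_. p" and e = e and \<delta> = "\<lambda>_. 0" and 'j = 4])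
      fix c :: "nat \<Rightarrow> 'k poly4" and e
      assume c: "c 0 \<in> I"
      obtain q where q: "q \<in> ideal_generated (g ` {..<n})" "c 0 - q \<in> ideal_product irrelevant_ideal I"
        using gen[OF c] by blast
      obtain E where E: "\<forall>i. E i \<in> I" "c 0 - q = (\<Sum>i\<in>UNIV. var i * E i)"
        using mem_irrelevant_product[OF I(1) q(2)] by blast
      have "c 0 - (\<Sum>i\<in>UNIV. var i * E i) = q" using E(2) by (simp flip: E(2))
      moreover have "(var i :: 'k poly4) \<in> homogeneous_polys 1" for i
        by (simp add: var_def mem_homogeneous_polys lookup_single when_def total_degree_def)
      ultimately show "\<exists>(K :: 4 set) p \<pi> E. finite K \<and>
          (\<forall>k\<in>K. p k \<in> homogeneous_polys (\<pi> k) \<and> \<pi> k > 0 \<and> E k 0 \<in> I) \<and>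
          c 0 - (\<Sum>k\<in>K. p k * E k 0) \<in> ideal_generated (g ` {..<n})"
        using E(1) q(1)
        by (intro exI[of _ UNIV] exI[of _ var] exI[of _ "\<lambda>_. 1"] exI[of _ "\<lambda>k _. E k"]) simp
    next
      show "\<forall>i. p \<in> homogeneous_shifted 0 e"
        using that by (simp add: homogeneous_shifted_def)
    qed (use that S hg hom_part_mem_homogeneous_ideal in
        \<open>auto simp: hom_part_shifted_def ideal.span_add ideal.span_scale\<close>)
    thus ?thesis .
  qed
  show "I \<subseteq> ideal_generated (g ` {..<n})"
  proof
    fix p assume "p \<in> I"
    hence "hom_part e p \<in> ideal_generated (g ` {..<n})" for e
      using hom_part_mem_homogeneous_ideal[OF S(1)] S(2) hom[OF _ hom_part_mem] by blast
    hence "(\<Sum>e\<in>total_degree ` keys p. hom_part e p) \<in> ideal_generated (g ` {..<n})"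
      by (intro ideal.span_sum)
    thus "p \<in> ideal_generated (g ` {..<n})" by (simp add: sum_hom_parts)
  qed
qed

section \<open>The Specht module of shape (2,2)\<close>

lemma obtain_four_letters:
  obtains p q r s :: 4 where "distinct [p, q, r, s]" "UNIV = {p, q, r, s}"
proof -
  have "card (UNIV :: 4 set) = Suc (Suc (Suc (Suc 0)))" by simp
  then obtain p q r s :: 4 where "UNIV = {p, q, r, s}" "p \<notin> {q, r, s}" "q \<notin> {r, s}" "r \<notin> {s}"
    unfolding card_Suc_eq by blast
  thus ?thesis by (intro that[of p q r s]) auto
qed

text \<open>The tabloid of shape \<open>(2,2)\<close> with first row \<open>S\<close>, if \<open>S\<close> has two elements.\<close>

definition tabloid :: "4 set \<Rightarrow> 4 \<Rightarrow> nat" where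
  "tabloid S x = (if x \<in> S then 0 else 1)"

lemma tabloid_eq_iff [simp]: "tabloid S = tabloid S' \<longleftrightarrow> S = S'"
  by (auto simp: tabloid_def fun_eq_iff split: if_splits)

lemma cells_2_2: "cells [2, 2] = {(0, 0), (0, 1), (1, 0), (1, 1)}"
  by (auto simp: cells_def less_Suc_eq numeral_2_eq_2)

context
  fixes T :: "nat \<times> nat \<Rightarrow> 4" and a b c d :: 4
  assumes T: "T \<in> tableaux [2, 2]"
    and abcd: "a = T (0, 0)" "b = T (0, 1)" "c = T (1, 0)" "d = T (1, 1)"
begin

lemma tableau_inj: "inj_on T (cells [2, 2])"
  using T by (simp add: tableaux_def bij_betw_def)

lemma tableau_entries: "distinct [a, b, c, d]" "UNIV = {a, b, c, d}"
proof -
  show "UNIV = {a, b, c, d}"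
    using T by (auto simp: tableaux_def bij_betw_def cells_2_2 abcd)
  show "distinct [a, b, c, d]"
    using tableau_inj by (auto simp: inj_on_def cells_2_2 abcd)
qed

lemma tableau_neq:
  "a \<noteq> b" "b \<noteq> a" "a \<noteq> c" "c \<noteq> a" "a \<noteq> d" "d \<noteq> a"
  "b \<noteq> c" "c \<noteq> b" "b \<noteq> d" "d \<noteq> b" "c \<noteq> d" "d \<noteq> c"
  using tableau_entries(1) by auto

lemma inv_tableau:
  "inv_into (cells [2, 2]) T a = (0, 0)" "inv_into (cells [2, 2]) T b = (0, 1)"
  "inv_into (cells [2, 2]) T c = (1, 0)" "inv_into (cells [2, 2]) T d = (1, 1)"
  unfolding abcd using inv_into_f_f[OF tableau_inj] by (auto simp: cells_2_2)

lemma row_of_tableau: "row_of [2, 2] T = tabloid {a, b}"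
proof
  fix x
  have "x \<in> {a, b, c, d}" using tableau_entries by blast
  thus "row_of [2, 2] T x = tabloid {a, b} x"
    using tableau_entries(1) by (auto simp: row_of_def tabloid_def inv_tableau)
qed

lemma column_stabilizer_tableau:
  "column_stabilizer [2, 2] T = {1, swap a c, swap b d, swap a c * swap b d}"
proof -
  have col: "column_of [2, 2] T a = 0" "column_of [2, 2] T b = 1"
    "column_of [2, 2] T c = 0" "column_of [2, 2] T d = 1"
    by (simp_all add: column_of_def inv_tableau)
  have x: "x \<in> {a, b, c, d}" for x using tableau_entries by blast
  have col_iff: "(column_of [2, 2] T y = 0 \<longleftrightarrow> y \<in> {a, c}) \<and> (column_of [2, 2] T y = 1 \<longleftrightarrow> y \<in> {b, d})" for y
  proof -
    have "y = a \<or> y = b \<or> y = c \<or> y = d" using x[of y] by simp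
    thus ?thesis by (elim disjE) (simp_all add: col tableau_neq)
  qed
  note D = tableau_neq
  show ?thesis
  proof (intro equalityI subsetI)
    fix \<pi> assume "\<pi> \<in> column_stabilizer [2, 2] T"
    hence st: "column_of [2, 2] T (apply \<pi> y) = column_of [2, 2] T y" for y
      by (simp add: column_stabilizer_def)
    have inj: "apply \<pi> y = apply \<pi> z \<longleftrightarrow> y = z" for y z by (rule apply_inj)
    have "apply \<pi> a \<in> {a, c}" "apply \<pi> c \<in> {a, c}" "apply \<pi> b \<in> {b, d}" "apply \<pi> d \<in> {b, d}"
      using st[of a] st[of b] st[of c] st[of d] col col_iff[of "apply \<pi> a"] col_iff[of "apply \<pi> b"]
        col_iff[of "apply \<pi> c"] col_iff[of "apply \<pi> d"] by simp_all
    hence "(apply \<pi> a = a \<and> apply \<pi> c = c \<or> apply \<pi> a = c \<and> apply \<pi> c = a)"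
      "(apply \<pi> b = b \<and> apply \<pi> d = d \<or> apply \<pi> b = d \<and> apply \<pi> d = b)"
      using inj[of a c] inj[of b d] D by auto
    moreover have eq: "\<pi> = \<pi>'" if "apply \<pi> a = apply \<pi>' a" "apply \<pi> b = apply \<pi>' b"
      "apply \<pi> c = apply \<pi>' c" "apply \<pi> d = apply \<pi>' d" for \<pi>'
    proof (rule perm_eqI)
      fix y show "apply \<pi> y = apply \<pi>' y"
        using x[of y] by (elim insertE emptyE) (simp_all add: that)
    qed
    moreover have "\<pi> = 1" if "apply \<pi> a = a" "apply \<pi> c = c" "apply \<pi> b = b" "apply \<pi> d = d"
      by (rule eq) (simp_all add: that)
    moreover have "\<pi> = swap a c" if "apply \<pi> a = c" "apply \<pi> c = a" "apply \<pi> b = b" "apply \<pi> d = d"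
      by (rule eq) (use D in \<open>auto simp: that\<close>)
    moreover have "\<pi> = swap b d" if "apply \<pi> a = a" "apply \<pi> c = c" "apply \<pi> b = d" "apply \<pi> d = b"
      by (rule eq) (use D in \<open>auto simp: that\<close>)
    moreover have "\<pi> = swap a c * swap b d"
      if "apply \<pi> a = c" "apply \<pi> c = a" "apply \<pi> b = d" "apply \<pi> d = b"
      by (rule eq) (use D in \<open>auto simp: that apply_times\<close>)
    ultimately show "\<pi> \<in> {1, swap a c, swap b d, swap a c * swap b d}" by blast
  next
    fix \<pi> assume "\<pi> \<in> {1, swap a c, swap b d, swap a c * swap b d}"
    moreover have "column_of [2, 2] T (apply \<pi> y) = column_of [2, 2] T y"
      if "\<pi> \<in> {1, swap a c, swap b d, swap a c * swap b d}" for y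
      using x[of y] that D by (auto simp: apply_times col)
    ultimately show "\<pi> \<in> column_stabilizer [2, 2] T"
      by (simp add: column_stabilizer_def)
  qed
qed

end

lemma polytabloid_tableau:
  assumes T: "T \<in> tableaux [2, 2]"
    and abcd: "a = T (0, 0)" "b = T (0, 1)" "c = T (1, 0)" "d = T (1, 1)"
  shows "(polytabloid [2, 2] T :: (4 \<Rightarrow> nat) \<Rightarrow>\<^sub>0 'k::field) =
    single (tabloid {a, b}) 1 - single (tabloid {c, b}) 1
    - single (tabloid {a, d}) 1 + single (tabloid {c, d}) 1"
proof -
  note D = tableau_neq[OF T abcd]
  have row: "row_of [2, 2] (apply \<pi> \<circ> T) = tabloid {apply \<pi> a, apply \<pi> b}" for \<pi>
  proof (rule row_of_tableau)
    show "apply \<pi> \<circ> T \<in> tableaux [2, 2]"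
      using T bij_betw_trans[of T "cells [2, 2]" UNIV "apply \<pi>" UNIV] by (simp add: tableaux_def)
  qed (simp_all add: abcd)
  have sgn: "sign (apply (swap x y)) = (if x = y then 1 else - 1)" for x y :: 4
    by (simp add: swap.rep_eq sign_swap_id)
  have sgn2: "sign (apply (swap a c * swap b d)) = 1"
    using D by (simp add: apply_times sign_compose permutation_apply_S4 sgn)
  have "apply 1 a = a" "apply (swap a c) a = c" "apply (swap b d) a = a"
    "apply (swap a c * swap b d) a = c" "apply 1 b = b" "apply (swap a c) b = b"
    "apply (swap b d) b = d" "apply (swap a c * swap b d) b = d"
    using D by (simp_all add: apply_times)
  note ap = this
  have "1 \<noteq> swap a c" "1 \<noteq> swap b d" "1 \<noteq> swap a c * swap b d" "swap a c \<noteq> swap b d"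
    "swap a c \<noteq> swap a c * swap b d" "swap b d \<noteq> swap a c * swap b d"
    using D ap by metis+
  hence "(\<Sum>\<pi>\<in>{1, swap a c, swap b d, swap a c * swap b d}. F \<pi>)
      = F 1 + (F (swap a c) + (F (swap b d) + F (swap a c * swap b d)))"
    for F :: "S4 \<Rightarrow> (4 \<Rightarrow> nat) \<Rightarrow>\<^sub>0 'k" by simp
  thus ?thesis
    using D by (simp add: polytabloid_def column_stabilizer_tableau[OF T abcd] row sgn sgn2 ap single_uminus
        sign_identity[unfolded id_def] apply_one id_def)
qed

text \<open>A description of the Specht module inside the permutation module that is visibly invariant under
  the group.  A combination of tabloids invariant under exchanging the two rows is a function on the
  three ways to split the letters into two pairs, and the last condition says that the three values
  add up to \<open>0\<close>.\<close>

definition balanced_on_pairs :: "((4 \<Rightarrow> nat) \<Rightarrow>\<^sub>0 'k::field) \<Rightarrow> bool" where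
  "balanced_on_pairs v \<longleftrightarrow>
     (\<forall>t. lookup v t \<noteq> 0 \<longrightarrow> (\<exists>S. card S = 2 \<and> t = tabloid S)) \<and>
     (\<forall>S. lookup v (tabloid (- S)) = lookup v (tabloid S)) \<and>
     (\<forall>x. (\<Sum>y\<in>- {x}. lookup v (tabloid {x, y})) = 0)"

lemma balanced_polytabloid:
  assumes "T \<in> tableaux [2, 2]"
  shows "balanced_on_pairs (polytabloid [2, 2] T :: (4 \<Rightarrow> nat) \<Rightarrow>\<^sub>0 'k::field)"
proof -
  define a b c d where abcd: "a = T (0, 0)" "b = T (0, 1)" "c = T (1, 0)" "d = T (1, 1)"
  note D = tableau_neq[OF assms abcd]
  have U: "UNIV = {a, b, c, d}" by (rule tableau_entries[OF assms abcd])
  define v where "v = (polytabloid [2, 2] T :: (4 \<Rightarrow> nat) \<Rightarrow>\<^sub>0 'k::field)"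
  have l: "lookup v t = (1 when tabloid {a, b} = t) - (1 when tabloid {c, b} = t)
      - (1 when tabloid {a, d} = t) + (1 when tabloid {c, d} = t)" for t
    by (simp add: v_def polytabloid_tableau[OF assms abcd] lookup_minus lookup_add lookup_single)
  have "\<exists>S. card S = 2 \<and> t = tabloid S" if "lookup v t \<noteq> 0" for t
  proof -
    have "t \<in> {tabloid {a, b}, tabloid {c, b}, tabloid {a, d}, tabloid {c, d}}"
      using that by (auto simp: l when_def split: if_splits)
    moreover have "card {a, b} = 2" "card {c, b} = 2" "card {a, d} = 2" "card {c, d} = 2"
      using D by auto
    ultimately show ?thesis by blast
  qed
  moreover have "lookup v (tabloid (- S)) = lookup v (tabloid S)" for S
  proof -
    have "x = a \<or> x = b \<or> x = c \<or> x = d" for x using U by blast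
    hence C: "{c, d} = - {a, b}" "{a, d} = - {c, b}" using D by blast+
    have "({a, b} = - S) = ({c, d} = S)" "({c, d} = - S) = ({a, b} = S)"
      "({c, b} = - S) = ({a, d} = S)" "({a, d} = - S) = ({c, b} = S)"
      unfolding C by auto
    thus ?thesis by (simp add: l)
  qed
  moreover have "(\<Sum>y\<in>- {x}. lookup v (tabloid {x, y})) = 0" for x
  proof -
    have co: "- {a} = {b, c, d}" "- {b} = {a, c, d}" "- {c} = {a, b, d}" "- {d} = {a, b, c}"
      using D U by blast+
    have "x = a \<or> x = b \<or> x = c \<or> x = d" using U by blast
    thus ?thesis
      by (elim disjE) (simp_all add: l co when_def doubleton_eq_iff D)
  qed
  ultimately show ?thesis by (simp add: balanced_on_pairs_def v_def)
qed

lemma subspace_balanced: "poly.subspace {v :: (4 \<Rightarrow> nat) \<Rightarrow>\<^sub>0 'k::field. balanced_on_pairs v}"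
proof (rule poly.subspaceI)
  show "0 \<in> {v :: (4 \<Rightarrow> nat) \<Rightarrow>\<^sub>0 'k. balanced_on_pairs v}"
    by (simp add: balanced_on_pairs_def)
next
  fix u v :: "(4 \<Rightarrow> nat) \<Rightarrow>\<^sub>0 'k"
  assume uv: "u \<in> {v. balanced_on_pairs v}" "v \<in> {v. balanced_on_pairs v}"
  have "\<exists>S. card S = 2 \<and> t = tabloid S" if t: "lookup (u + v) t \<noteq> 0" for t
  proof -
    have "lookup u t \<noteq> 0 \<or> lookup v t \<noteq> 0"
      using t by (auto simp: lookup_add)
    thus ?thesis using uv unfolding balanced_on_pairs_def by blast
  qed
  thus "u + v \<in> {v. balanced_on_pairs v}"
    using uv by (simp add: balanced_on_pairs_def lookup_add sum.distrib)
next
  fix c :: 'k and v :: "(4 \<Rightarrow> nat) \<Rightarrow>\<^sub>0 'k"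
  assume v: "v \<in> {v. balanced_on_pairs v}"
  thus "scalar_mult c v \<in> {v. balanced_on_pairs v}"
    by (simp add: balanced_on_pairs_def flip: sum_distrib_left)
qed

lemma lookup_specht_act:
  "lookup (act (specht \<mu>) \<sigma> v) t = lookup v (t \<circ> apply \<sigma>)"
proof -
  have "apply (inverse \<sigma>) \<circ> apply \<sigma> = id" "apply \<sigma> \<circ> apply (inverse \<sigma>) = id"
    by (simp_all add: fun_eq_iff perm_conj_inverse_apply)
  hence *: "(r \<circ> apply (inverse \<sigma>) = t) = (r = t \<circ> apply \<sigma>)" for r :: "4 \<Rightarrow> nat"
    using comp_assoc[of r "apply (inverse \<sigma>)" "apply \<sigma>"] comp_assoc[of t "apply \<sigma>" "apply (inverse \<sigma>)"]
    by auto
  have "lookup (act (specht \<mu>) \<sigma> v) t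
      = (\<Sum>r\<in>keys v. if r = t \<circ> apply \<sigma> then lookup v r else 0)"
    by (simp only: specht_def rep.simps lookup_sum lookup_single when_def *)
  thus ?thesis by (simp add: in_keys_iff)
qed

lemma tabloid_comp: "tabloid S \<circ> apply \<sigma> = tabloid (apply (inverse \<sigma>) ` S)"
proof -
  have "apply \<sigma> x \<in> S \<longleftrightarrow> x \<in> apply (inverse \<sigma>) ` S" for x
  proof
    assume "apply \<sigma> x \<in> S"
    hence "apply (inverse \<sigma>) (apply \<sigma> x) \<in> apply (inverse \<sigma>) ` S" by (rule imageI)
    thus "x \<in> apply (inverse \<sigma>) ` S" by (simp only: perm_conj_inverse_apply)
  next
    assume "x \<in> apply (inverse \<sigma>) ` S"
    thus "apply \<sigma> x \<in> S" by (auto simp: perm_conj_inverse_apply)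
  qed
  thus ?thesis by (simp add: fun_eq_iff tabloid_def)
qed

lemma balanced_act:
  assumes v: "balanced_on_pairs v"
  shows "balanced_on_pairs (act (specht \<mu>) \<sigma> v)"
  unfolding balanced_on_pairs_def lookup_specht_act
proof (intro conjI allI impI)
  fix t assume "lookup v (t \<circ> apply \<sigma>) \<noteq> 0"
  then obtain S where S: "card S = 2" "t \<circ> apply \<sigma> = tabloid S"
    using v unfolding balanced_on_pairs_def by blast
  have "t = (t \<circ> apply \<sigma>) \<circ> apply (inverse \<sigma>)" by (simp add: fun_eq_iff perm_conj_inverse_apply)
  also have "\<dots> = tabloid (apply \<sigma> ` S)" unfolding S(2) tabloid_comp by simp
  finally have "t = tabloid (apply \<sigma> ` S)" .
  moreover have "card (apply \<sigma> ` S) = 2" using S(1) card_image[OF inj_on_subset[OF bij_is_inj[OF bij_apply] subset_UNIV], of \<sigma> S] by simp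
  ultimately show "\<exists>S. card S = 2 \<and> t = tabloid S" by blast
next
  fix S
  show "lookup v (tabloid (- S) \<circ> apply \<sigma>) = lookup v (tabloid S \<circ> apply \<sigma>)"
    using v by (simp add: tabloid_comp bij_image_Compl_eq balanced_on_pairs_def)
next
  fix x
  let ?x = "apply (inverse \<sigma>) x"
  have "bij_betw (apply (inverse \<sigma>)) (- {x}) (- {?x})"
    using bij_betw_subset[of "apply (inverse \<sigma>)" UNIV UNIV "- {x}" "- {?x}"]
    by (simp add: bij_image_Compl_eq)
  hence "(\<Sum>y\<in>- {x}. lookup v (tabloid {?x, apply (inverse \<sigma>) y}))
      = (\<Sum>y\<in>- {?x}. lookup v (tabloid {?x, y}))"
    by (rule sum.reindex_bij_betw)
  thus "(\<Sum>y\<in>- {x}. lookup v (tabloid {x, y} \<circ> apply \<sigma>)) = 0"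
    using v by (simp add: tabloid_comp balanced_on_pairs_def)
qed

lemma specht_act_one: "act (specht \<mu>) 1 v = v"
  by (rule poly_mapping_eqI) (simp add: lookup_specht_act)

lemma specht_act_times: "act (specht \<mu>) (\<sigma> * \<tau>) v = act (specht \<mu>) \<sigma> (act (specht \<mu>) \<tau> v)"
  by (rule poly_mapping_eqI) (simp add: lookup_specht_act apply_times comp_assoc)

lemma specht_act_add: "act (specht \<mu>) \<sigma> (u + v) = act (specht \<mu>) \<sigma> u + act (specht \<mu>) \<sigma> v"
  by (rule poly_mapping_eqI) (simp add: lookup_specht_act lookup_add)

lemma specht_act_scale: "act (specht \<mu>) \<sigma> (scalar_mult c v) = scalar_mult c (act (specht \<mu>) \<sigma> v)"
  by (rule poly_mapping_eqI) (simp add: lookup_specht_act)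

lemma specht_simps [simp]: "vadd (specht \<mu>) = (+)" "vscale (specht \<mu>) = scalar_mult"
  "vzero (specht \<mu>) = 0"
  by (simp_all add: specht_def)

context
  fixes p q r s :: 4
  assumes pqrs: "distinct [p, q, r, s]" and all: "UNIV = {p, q, r, s}"
begin

lemma letters_neq:
  "p \<noteq> q" "q \<noteq> p" "p \<noteq> r" "r \<noteq> p" "p \<noteq> s" "s \<noteq> p"
  "q \<noteq> r" "r \<noteq> q" "q \<noteq> s" "s \<noteq> q" "r \<noteq> s" "s \<noteq> r"
  using pqrs by auto

lemma pair_cases:
  assumes "card S = 2"
  shows "S \<in> {{p, q}, - {p, q}, {p, r}, - {p, r}, {p, s}, - {p, s}}"
proof -
  have C: "- {p, q} = {r, s}" "- {p, r} = {q, s}" "- {p, s} = {q, r}"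
    using letters_neq all by blast+
  obtain x y where xy: "S = {x, y}" "x \<noteq> y" using assms by (auto simp: card_2_iff)
  have "x \<in> {p, q, r, s}" "y \<in> {p, q, r, s}" using all by blast+
  hence "x = p \<or> x = q \<or> x = r \<or> x = s" "y = p \<or> y = q \<or> y = r \<or> y = s" by simp_all
  thus ?thesis unfolding C xy(1) using xy(2)
    by (elim disjE) (simp_all add: doubleton_eq_iff letters_neq)
qed

lemma balanced_value_ps:
  assumes "balanced_on_pairs v"
  shows "lookup v (tabloid {p, s})
    = - lookup v (tabloid {p, q}) - lookup v (tabloid {p, r})"
proof -
  have "- {p} = {q, r, s}" using letters_neq all by blast
  moreover have "(\<Sum>y\<in>- {p}. lookup v (tabloid {p, y})) = 0"
    using assms by (simp add: balanced_on_pairs_def)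
  ultimately have "lookup v (tabloid {p, q}) + (lookup v (tabloid {p, r})
      + lookup v (tabloid {p, s})) = 0"
    by (simp add: letters_neq)
  thus ?thesis by (simp add: algebra_simps eq_neg_iff_add_eq_0)
qed

lemma balanced_complement:
  "balanced_on_pairs v \<Longrightarrow>
    lookup v (tabloid (- S)) = lookup v (tabloid S)"
  by (simp add: balanced_on_pairs_def)

text \<open>Of the three splittings two determine the third, so that a balanced vector has two coordinates.\<close>

lemma balanced_eqI:
  assumes "balanced_on_pairs u" "balanced_on_pairs v"
    and "lookup u (tabloid {p, q}) = lookup v (tabloid {p, q})"
    and "lookup u (tabloid {p, r}) = lookup v (tabloid {p, r})"
  shows "u = v"
proof (rule poly_mapping_eqI)
  fix t
  show "lookup u t = lookup v t"
  proof (cases "\<exists>S. card S = 2 \<and> t = tabloid S")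
    case True
    then obtain S where S: "card S = 2" "t = tabloid S" by blast
    have "lookup u (tabloid {p, s}) = lookup v (tabloid {p, s})"
      using assms by (simp add: balanced_value_ps)
    thus ?thesis
      using pair_cases[OF S(1)] assms unfolding S(2)
      by (elim insertE emptyE) (simp_all add: balanced_complement)
  next
    case False
    hence "lookup u t = 0" "lookup v t = 0"
      using assms(1,2) unfolding balanced_on_pairs_def by blast+
    thus ?thesis by simp
  qed
qed

text \<open>The polytabloids dual to the coordinates at \<open>{p, q}\<close> and \<open>{p, r}\<close>.\<close>

definition specht_vector :: "nat \<Rightarrow> (4 \<Rightarrow> nat) \<Rightarrow>\<^sub>0 'k::field" where
  "specht_vector i = polytabloid [2, 2] (\<lambda>c. if c = (0, 0) then p
     else if c = (0, 1) then (if i = 0 then q else r)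
     else if c = (1, 0) then (if i = 0 then r else q) else s)"

lemma specht_tableau:
  "(\<lambda>c. if c = (0, 0) then p else if c = (0, 1) then (if i = 0 then q else r)
     else if c = (1, 0) then (if i = 0 then r else q) else s) \<in> tableaux [2, 2]" (is "?T \<in> _")
  unfolding tableaux_def mem_Collect_eq bij_betw_def
proof
  show "inj_on ?T (cells [2, 2])" using letters_neq by (auto simp: cells_2_2 inj_on_def)
  show "?T ` cells [2, 2] = UNIV" unfolding all by (auto simp: cells_2_2)
qed

lemma specht_vector_values:
  "lookup (specht_vector 0) (tabloid {p, q}) = (1 :: 'k::field)"
  "lookup (specht_vector 0) (tabloid {p, r}) = (0 :: 'k::field)"
  "lookup (specht_vector (Suc 0)) (tabloid {p, q}) = (0 :: 'k::field)"
  "lookup (specht_vector (Suc 0)) (tabloid {p, r}) = (1 :: 'k::field)"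
  unfolding specht_vector_def polytabloid_tableau[OF specht_tableau refl refl refl refl]
  by (simp_all add: letters_neq lookup_minus lookup_add lookup_single when_def doubleton_eq_iff)

lemma balanced_specht_vector: "balanced_on_pairs (specht_vector i)"
  unfolding specht_vector_def by (rule balanced_polytabloid[OF specht_tableau])

lemma space_specht: "space (specht [2, 2] :: ('k::field, _) rep) = {v. balanced_on_pairs v}"
proof -
  have "poly.span (polytabloid [2, 2] ` tableaux [2, 2] :: ((4 \<Rightarrow> nat) \<Rightarrow>\<^sub>0 'k) set)
      = {v. balanced_on_pairs v}"
  proof (rule poly.span_subspace)
    show "polytabloid [2, 2] ` tableaux [2, 2] \<subseteq> {v :: (4 \<Rightarrow> nat) \<Rightarrow>\<^sub>0 'k. balanced_on_pairs v}"
      using balanced_polytabloid by blast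
    show "{v. balanced_on_pairs v} \<subseteq> poly.span (polytabloid [2, 2] ` tableaux [2, 2] :: ((4 \<Rightarrow> nat) \<Rightarrow>\<^sub>0 'k) set)"
    proof
      fix v :: "(4 \<Rightarrow> nat) \<Rightarrow>\<^sub>0 'k" assume "v \<in> {v. balanced_on_pairs v}"
      hence v: "balanced_on_pairs v" by simp
      define w where "w = scalar_mult (lookup v (tabloid {p, q})) (specht_vector 0)
        + scalar_mult (lookup v (tabloid {p, r})) (specht_vector (Suc 0))"
      have "balanced_on_pairs w"
        unfolding w_def
        by (intro poly.subspace_add[OF subspace_balanced, unfolded mem_Collect_eq]
            poly.subspace_scale[OF subspace_balanced, unfolded mem_Collect_eq] balanced_specht_vector)
      hence "v = w"
        by (intro balanced_eqI v) (simp_all add: w_def lookup_add specht_vector_values)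
      also have "w \<in> poly.span (polytabloid [2, 2] ` tableaux [2, 2])"
        unfolding w_def specht_vector_def
        by (intro poly.span_add poly.span_scale poly.span_base imageI specht_tableau)
      finally show "v \<in> poly.span (polytabloid [2, 2] ` tableaux [2, 2])" .
    qed
  qed (rule subspace_balanced)
  thus ?thesis by (simp add: specht_def)
qed

definition specht_coordinates :: "((4 \<Rightarrow> nat) \<Rightarrow>\<^sub>0 'k::field) \<Rightarrow> nat \<Rightarrow> 'k" where
  "specht_coordinates v = (\<lambda>i. if i = 0 then lookup v (tabloid {p, q})
     else if i = 1 then lookup v (tabloid {p, r}) else 0)"

lemma specht_coordinates_vector:
  "i < 2 \<Longrightarrow> specht_coordinates (specht_vector i) = unit_vector i"
  by (auto simp: specht_coordinates_def unit_vector_def fun_eq_iff specht_vector_values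
      less_Suc_eq numeral_2_eq_2)

lemma coordinates_specht:
  "coordinates (specht [2, 2]) 2 (specht_coordinates :: _ \<Rightarrow> nat \<Rightarrow> 'k::field)"
proof -
  let ?V = "{v :: (4 \<Rightarrow> nat) \<Rightarrow>\<^sub>0 'k. balanced_on_pairs v}"
  have "inj_on specht_coordinates ?V"
  proof (rule inj_onI)
    fix u v :: "(4 \<Rightarrow> nat) \<Rightarrow>\<^sub>0 'k" assume "u \<in> ?V" "v \<in> ?V" and eq: "specht_coordinates u = specht_coordinates v"
    moreover have "specht_coordinates u 0 = specht_coordinates v 0"
      "specht_coordinates u 1 = specht_coordinates v 1" using eq by simp_all
    ultimately show "u = v"
      unfolding specht_coordinates_def by (intro balanced_eqI) simp_all
  qed
  moreover have "specht_coordinates ` ?V = {a. \<forall>i\<ge>2. a i = 0}"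
  proof (intro equalityI subsetI)
    fix a :: "nat \<Rightarrow> 'k" assume a: "a \<in> {a. \<forall>i\<ge>2. a i = 0}"
    define w where "w = scalar_mult (a 0) (specht_vector 0) + scalar_mult (a 1) (specht_vector (Suc 0))"
    have "balanced_on_pairs w"
      unfolding w_def
      by (intro poly.subspace_add[OF subspace_balanced, unfolded mem_Collect_eq]
          poly.subspace_scale[OF subspace_balanced, unfolded mem_Collect_eq] balanced_specht_vector)
    moreover have "specht_coordinates w = a"
    proof
      fix i show "specht_coordinates w i = a i"
        using a by (cases "i \<ge> 2")
          (auto simp: specht_coordinates_def w_def lookup_add specht_vector_values not_le less_2_cases_iff)
    qed
    ultimately show "a \<in> specht_coordinates ` ?V" by blast
  qed (auto simp: specht_coordinates_def)
  ultimately show ?thesis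
    by (auto simp: coordinates_def bij_betw_def space_specht specht_coordinates_def lookup_add fun_eq_iff)
qed

text \<open>In terms of the values \<open>x, y, z\<close> at the three splittings, \<open>\<omega> = x y' - y x'\<close> is also \<open>y z' - z y'\<close>
  and \<open>z x' - x z'\<close>, because \<open>x + y + z = 0\<close>.  A transposition of letters exchanges two splittings and
  fixes the third, hence changes the sign of \<open>\<omega>\<close>, and transpositions generate the group.\<close>

lemma specht_determinant:
  assumes "balanced_on_pairs (u :: _ \<Rightarrow>\<^sub>0 'k::field)" "balanced_on_pairs v"
  defines "\<omega> \<equiv> \<lambda>u v. specht_coordinates u 0 * specht_coordinates v 1
    - specht_coordinates u 1 * (specht_coordinates v 0 :: 'k)"
  shows "\<omega> (act (specht [2, 2]) \<sigma> u) (act (specht [2, 2]) \<sigma> v) = of_int (sign (apply \<sigma>)) * \<omega> u v"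
proof -
  have pair: "lookup v (tabloid {q, p}) = lookup v (tabloid {p, q})"
    "lookup v (tabloid {r, s}) = lookup v (tabloid {p, q})"
    "lookup v (tabloid {s, r}) = lookup v (tabloid {p, q})"
    "lookup v (tabloid {r, p}) = lookup v (tabloid {p, r})"
    "lookup v (tabloid {q, s}) = lookup v (tabloid {p, r})"
    "lookup v (tabloid {s, q}) = lookup v (tabloid {p, r})"
    "lookup v (tabloid {p, s}) = - lookup v (tabloid {p, q}) - lookup v (tabloid {p, r})"
    "lookup v (tabloid {s, p}) = - lookup v (tabloid {p, q}) - lookup v (tabloid {p, r})"
    "lookup v (tabloid {q, r}) = - lookup v (tabloid {p, q}) - lookup v (tabloid {p, r})"
    "lookup v (tabloid {r, q}) = - lookup v (tabloid {p, q}) - lookup v (tabloid {p, r})"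
    if v: "balanced_on_pairs v" for v :: "_ \<Rightarrow>\<^sub>0 'k"
  proof -
    have C: "{r, s} = - {p, q}" "{q, s} = - {p, r}" "{q, r} = - {p, s}"
      using letters_neq all by blast+
    have sw: "{q, p} = {p, q}" "{s, r} = {r, s}" "{r, p} = {p, r}" "{s, q} = {q, s}"
      "{s, p} = {p, s}" "{r, q} = {q, r}" by blast+
    note * = balanced_complement[OF v] balanced_value_ps[OF v]
    show "lookup v (tabloid {q, p}) = lookup v (tabloid {p, q})"
      "lookup v (tabloid {r, p}) = lookup v (tabloid {p, r})"
      unfolding sw by (rule refl)+
    show "lookup v (tabloid {r, s}) = lookup v (tabloid {p, q})"
      "lookup v (tabloid {s, r}) = lookup v (tabloid {p, q})"
      "lookup v (tabloid {q, s}) = lookup v (tabloid {p, r})"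
      "lookup v (tabloid {s, q}) = lookup v (tabloid {p, r})"
      unfolding sw C * by (rule refl)+
    show "lookup v (tabloid {p, s}) = - lookup v (tabloid {p, q}) - lookup v (tabloid {p, r})"
      "lookup v (tabloid {s, p}) = - lookup v (tabloid {p, q}) - lookup v (tabloid {p, r})"
      "lookup v (tabloid {q, r}) = - lookup v (tabloid {p, q}) - lookup v (tabloid {p, r})"
      "lookup v (tabloid {r, q}) = - lookup v (tabloid {p, q}) - lookup v (tabloid {p, r})"
      unfolding sw C * by (rule refl)+
  qed
  have swap_case: "\<omega> (act (specht [2, 2]) (swap a b) u) (act (specht [2, 2]) (swap a b) v) = - \<omega> u v"
    if ab: "a \<noteq> b" and u: "balanced_on_pairs u" and v: "balanced_on_pairs v" for a b u v
  proof -
    have inv: "inverse (swap a b) = swap a b"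
      by (rule perm_eqI) (metis apply_eq_iff_S4 apply_swap_simp apply_swap_same)
    have "a = p \<or> a = q \<or> a = r \<or> a = s" "b = p \<or> b = q \<or> b = r \<or> b = s" using all by blast+
    thus ?thesis using ab
      unfolding \<omega>_def specht_coordinates_def lookup_specht_act tabloid_comp inv
      by (elim disjE) (simp_all add: letters_neq pair[OF u] pair[OF v] algebra_simps)
  qed
  have "\<forall>\<sigma> u v. apply \<sigma> = f \<longrightarrow> balanced_on_pairs u \<longrightarrow> balanced_on_pairs v \<longrightarrow>
      \<omega> (act (specht [2, 2]) \<sigma> u) (act (specht [2, 2]) \<sigma> v) = of_int (sign f) * \<omega> u v"
    if "f permutes UNIV" for f :: "4 \<Rightarrow> 4"
    using that finite
  proof (induction rule: permutes_induct)
    case id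
    have "\<sigma> = 1" if "apply \<sigma> = id" for \<sigma> :: S4 using that by (intro perm_eqI) simp
    thus ?case by (metis specht_act_one sign_id of_int_1 mult_1)
  next
    case (swap a b f)
    show ?case
    proof (intro allI impI)
      fix \<sigma> :: S4 and u v :: "_ \<Rightarrow>\<^sub>0 'k"
      assume \<sigma>: "apply \<sigma> = Transposition.transpose a b \<circ> f" and u: "balanced_on_pairs u" and v: "balanced_on_pairs v"
      define \<tau> where "\<tau> = Perm.swap a b * \<sigma>"
      have \<tau>: "apply \<tau> = f" by (simp add: \<tau>_def apply_times \<sigma> swap.rep_eq fun_eq_iff)
      have "\<sigma> = Perm.swap a b * \<tau>"
        by (rule perm_eqI) (simp add: apply_times \<tau> \<sigma> swap.rep_eq)
      hence "\<omega> (act (specht [2, 2]) \<sigma> u) (act (specht [2, 2]) \<sigma> v)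
          = - \<omega> (act (specht [2, 2]) \<tau> u) (act (specht [2, 2]) \<tau> v)"
        using swap_case[OF swap.hyps(3) balanced_act[OF u] balanced_act[OF v]]
        by (simp add: specht_act_times)
      also have "\<dots> = - (of_int (sign f) * \<omega> u v)"
        using swap.IH \<tau> u v by simp
      also have "sign (Transposition.transpose a b \<circ> f) = - sign f"
        using swap.hyps(3) permutation_apply_S4[of "Perm.swap a b"] permutation_apply_S4[of \<tau>]
        by (simp add: sign_compose sign_swap_id swap.rep_eq \<tau>)
      hence "- (of_int (sign f) * \<omega> u v) = of_int (sign (Transposition.transpose a b \<circ> f)) * \<omega> u v"
        by simp
      finally show "\<omega> (act (specht [2, 2]) \<sigma> u) (act (specht [2, 2]) \<sigma> v)
          = of_int (sign (Transposition.transpose a b \<circ> f)) * \<omega> u v" .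
    qed
  qed
  moreover have "apply \<sigma> permutes UNIV" by (rule bij_imp_permutes) simp_all
  ultimately show ?thesis using assms(1,2) by blast
qed

end

lemma specht_2_2_basis:
  obtains \<kappa> :: "((4 \<Rightarrow> nat) \<Rightarrow>\<^sub>0 'k::field) \<Rightarrow> nat \<Rightarrow> 'k" and e
  where "coordinates (specht [2, 2]) 2 \<kappa>"
    and "\<And>i. i < 2 \<Longrightarrow> e i \<in> space (specht [2, 2])"
    and "\<And>i. i < 2 \<Longrightarrow> \<kappa> (e i) = unit_vector i"
    and "\<And>\<sigma>. class_fun_apply (character (specht [2, 2])) \<sigma>
      = \<kappa> (act (specht [2, 2]) \<sigma> (e 0)) 0 + \<kappa> (act (specht [2, 2]) \<sigma> (e 1)) 1"
    and "\<And>\<sigma>. \<kappa> (act (specht [2, 2]) \<sigma> (e 0)) 0 * \<kappa> (act (specht [2, 2]) \<sigma> (e 1)) 1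
      - \<kappa> (act (specht [2, 2]) \<sigma> (e 0)) 1 * \<kappa> (act (specht [2, 2]) \<sigma> (e 1)) 0
      = of_int (sign (apply \<sigma>))"
    and "\<And>\<sigma> v. v \<in> space (specht [2, 2] :: ('k, _) rep) \<Longrightarrow> act (specht [2, 2]) \<sigma> v \<in> space (specht [2, 2])"
proof -
  obtain p q r s :: 4 where D: "distinct [p, q, r, s]" "UNIV = {p, q, r, s}"
    by (rule obtain_four_letters)
  define \<kappa> :: "((4 \<Rightarrow> nat) \<Rightarrow>\<^sub>0 'k) \<Rightarrow> nat \<Rightarrow> 'k" where "\<kappa> = specht_coordinates p q r"
  define e :: "nat \<Rightarrow> (4 \<Rightarrow> nat) \<Rightarrow>\<^sub>0 'k" where "e = specht_vector p q r s"
  let ?V = "specht [2, 2] :: ('k, _) rep"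
  note sp = space_specht[OF D]
  have co: "coordinates ?V 2 \<kappa>" unfolding \<kappa>_def by (rule coordinates_specht[OF D])
  have e: "e i \<in> space ?V" for i
    unfolding sp e_def using balanced_specht_vector[OF D] by simp
  have \<kappa>e: "\<kappa> (e i) = unit_vector i" if "i < 2" for i
    unfolding \<kappa>_def e_def by (rule specht_coordinates_vector[OF D that])
  have closed: "act ?V \<sigma> v \<in> space ?V" if "v \<in> space ?V" for \<sigma> v
    using that balanced_act unfolding sp by blast
  have sub: "u + v \<in> space ?V" "scalar_mult c v \<in> space ?V" if "u \<in> space ?V" "v \<in> space ?V" for u v c
    using that poly.subspace_add[OF subspace_balanced] poly.subspace_scale[OF subspace_balanced]
    unfolding sp by blast+
  have "class_fun_apply (character ?V) \<sigma> = \<kappa> (act ?V \<sigma> (e 0)) 0 + \<kappa> (act ?V \<sigma> (e 1)) 1" for \<sigma>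
  proof -
    have "class_fun_apply (character ?V) \<sigma> = trace ?V (act ?V \<sigma>)"
      by (rule class_fun_apply_character)
        (auto simp: closed specht_act_add specht_act_scale specht_act_one specht_act_times)
    also have "\<dots> = matrix_trace ?V 2 \<kappa> (act ?V \<sigma>)"
      by (rule trace_eq_matrix_trace)
        (auto simp: closed specht_act_add specht_act_scale sub co)
    also have "\<dots> = (\<Sum>i<2. \<kappa> (act ?V \<sigma> (e i)) i)"
      unfolding matrix_trace_def
    proof (intro sum.cong refl)
      fix i :: nat assume "i \<in> {..<2}"
      hence "inv_into (space ?V) \<kappa> (unit_vector i) = e i"
        using co e \<kappa>e[of i] by (intro inv_into_f_eq) (auto simp: coordinates_def bij_betw_def)
      thus "\<kappa> (act ?V \<sigma> (inv_into (space ?V) \<kappa> (unit_vector i))) i = \<kappa> (act ?V \<sigma> (e i)) i"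
        by simp
    qed
    finally show ?thesis by (simp add: numeral_2_eq_2)
  qed
  moreover have "\<kappa> (act ?V \<sigma> (e 0)) 0 * \<kappa> (act ?V \<sigma> (e 1)) 1
      - \<kappa> (act ?V \<sigma> (e 0)) 1 * \<kappa> (act ?V \<sigma> (e 1)) 0 = of_int (sign (apply \<sigma>))" for \<sigma>
    using specht_determinant[OF D, of "e 0" "e 1" \<sigma>] e[of 0] e[of 1] \<kappa>e[of 0] \<kappa>e[of 1]
    by (simp add: sp flip: \<kappa>_def) (simp add: unit_vector_def)
  ultimately show ?thesis using that[of \<kappa> e] co e \<kappa>e closed by blast
qed

section \<open>Equivariant minimal generators\<close>

lemma subspace_of_ideal: "is_ideal J \<Longrightarrow> poly.subspace (J :: 'k::field poly4 set)"
  by (rule poly.subspaceI)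
    (auto simp: scalar_mult_eq_times ideal.subspace_0 ideal.subspace_add ideal.subspace_scale)

lemma ideal_product_subset: "is_ideal I \<Longrightarrow> ideal_product J I \<subseteq> I"
  unfolding ideal_product_def by (rule ideal.span_minimal) (auto intro: ideal.subspace_scale)

lemma permute_vars_inverse [simp]:
  "permute_vars (inverse \<sigma>) (permute_vars \<sigma> p) = p"
  "permute_vars \<sigma> (permute_vars (inverse \<sigma>) p) = p"
  by (simp_all flip: permute_vars_mult_perm)

lemma permute_vars_ideal_generated:
  assumes "\<And>x. x \<in> S \<Longrightarrow> permute_vars \<sigma> x \<in> ideal_generated S" "p \<in> ideal_generated S"
  shows "permute_vars \<sigma> p \<in> ideal_generated S"
  using assms(2)
proof (induction rule: ideal.span_induct_alt)
  case base
  show ?case by (simp add: ideal.span_zero)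
next
  case (step c x y)
  thus ?case
    by (simp add: permute_vars_add permute_vars_times ideal.span_add ideal.span_scale assms(1))
qed

lemma stable_image:
  assumes "\<And>\<sigma> p. p \<in> J \<Longrightarrow> permute_vars \<sigma> p \<in> J"
  shows "permute_vars \<sigma> ` J = J"
proof (intro equalityI subsetI)
  fix p assume "p \<in> J"
  hence "permute_vars (inverse \<sigma>) p \<in> J" by (rule assms)
  thus "p \<in> permute_vars \<sigma> ` J" by (metis imageI permute_vars_inverse(2))
qed (use assms in auto)

lemma permute_vars_irrelevant_product:
  assumes "\<And>\<sigma> p. p \<in> I \<Longrightarrow> permute_vars \<sigma> p \<in> I"
    and "p \<in> ideal_product irrelevant_ideal I"
  shows "permute_vars \<sigma> p \<in> ideal_product irrelevant_ideal I"
  using assms(2) unfolding ideal_product_def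
proof (rule permute_vars_ideal_generated[rotated])
  fix x assume "x \<in> {a * b | a b. a \<in> irrelevant_ideal \<and> b \<in> I}"
  then obtain a b where ab: "x = a * b" "a \<in> irrelevant_ideal" "b \<in> I" by blast
  have "permute_vars \<sigma> (var i) = (var (apply \<sigma> i) :: 'a poly4)" for i
  proof -
    have "permute_exponents \<sigma> (single i 1) = single (apply \<sigma> i) 1"
      by (rule poly_mapping_eqI)
        (simp add: lookup_permute_exponents lookup_single when_def flip: apply_eq_iff_S4)
    thus ?thesis by (simp add: var_def permute_vars_single)
  qed
  hence "permute_vars \<sigma> a \<in> irrelevant_ideal"
    unfolding irrelevant_ideal_def
    by (intro permute_vars_ideal_generated[OF _ ab(2)[unfolded irrelevant_ideal_def]])
      (auto simp: ideal.span_base)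
  thus "permute_vars \<sigma> x \<in> ideal_generated {a * b | a b. a \<in> irrelevant_ideal \<and> b \<in> I}"
    using ab assms(1) by (intro ideal.span_base) (auto simp: permute_vars_times)
qed

lemma in_degree_simps [simp]:
  "space (in_degree c V) = space V" "vzero (in_degree c V) = vzero V" "vadd (in_degree c V) = vadd V"
  "vscale (in_degree c V) = vscale V" "act (in_degree c V) = act V"
  "homog (in_degree c V) e = (if e = c then space V else {vzero V})"
  by (simp_all add: in_degree_def rep.defs graded_rep.defs)

lemma poly_rep_simps [simp]:
  "vadd (subrep poly_rep J) = (+)" "vscale (subrep poly_rep J) = scalar_mult"
  "act (subrep poly_rep J) = permute_vars" "homog (subrep poly_rep J) e = homogeneous_polys e \<inter> J"
  "space (subrep poly_rep J) = J"
  "vadd poly_rep = (+)" "vscale poly_rep = scalar_mult" "act poly_rep = permute_vars"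
  "homog poly_rep e = homogeneous_polys e" "space poly_rep = UNIV" "vzero poly_rep = 0"
  by (simp_all add: subrep_def poly_rep_def)

lemma coset_stable:
  assumes V: "vadd V = (+)" and st: "\<And>\<sigma> p. p \<in> W \<Longrightarrow> permute_vars \<sigma> p \<in> W"
  shows "permute_vars \<sigma> ` coset V W p = coset V W (permute_vars \<sigma> p)"
proof -
  have "permute_vars \<sigma> ` coset V W p = (+) (permute_vars \<sigma> p) ` (permute_vars \<sigma> ` W)"
    by (auto simp: coset_def V permute_vars_add image_image)
  thus ?thesis using stable_image[of W \<sigma>, OF st] by (simp add: coset_def V)
qed

text \<open>The generators are numbered from \<open>0\<close>: the first two span the Specht module, and the trivial
  summand with index \<open>i \<ge> 1\<close> has number \<open>i + 1\<close>.\<close>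

definition generator_degree :: "nat \<Rightarrow> (nat \<Rightarrow> nat) \<Rightarrow> nat \<Rightarrow> nat" where
  "generator_degree d c k = (if k < 2 then d else c (k - 1))"

definition block_matrix :: "(nat \<Rightarrow> nat \<Rightarrow> 'k::zero_neq_one) \<Rightarrow> nat \<Rightarrow> nat \<Rightarrow> 'k" where
  "block_matrix r i j = (if i < 2 \<and> j < 2 then r i j else if i = j then 1 else 0)"

text \<open>The isomorphism is only used through the functionals \<open>\<psi>\<close> on \<open>I\<close>, the coordinates of a class modulo
  \<open>\<mm>I\<close> in the basis given by the right-hand side.  This replaces cosets and nested products by
  linear conditions on polynomials.\<close>

lemma coordinates_of_generators:
  fixes I :: "'k::field poly4 set" and \<kappa> :: "((4 \<Rightarrow> nat) \<Rightarrow>\<^sub>0 'k) \<Rightarrow> nat \<Rightarrow> 'k"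
  assumes I: "is_ideal I" and stable: "\<And>\<sigma> p. p \<in> I \<Longrightarrow> permute_vars \<sigma> p \<in> I"
    and iso: "graded_iso
      (quotient_rep (subrep poly_rep I) (ideal_product irrelevant_ideal I))
      (direct_sum (in_degree d (specht [2, 2]))
        (direct_sum_family {1..m} (\<lambda>i. in_degree (c i) trivial_rep)))"
    and \<kappa>: "coordinates (specht [2, 2]) 2 \<kappa>"
    and e: "\<And>i. i < 2 \<Longrightarrow> e i \<in> space (specht [2, 2])" "\<And>i. i < 2 \<Longrightarrow> \<kappa> (e i) = unit_vector i"
    and closed: "\<And>\<sigma> v. v \<in> space (specht [2, 2] :: ('k, _) rep) \<Longrightarrow> act (specht [2, 2]) \<sigma> v \<in> space (specht [2, 2])"
  defines "\<rho> \<equiv> \<lambda>\<sigma>. block_matrix (\<lambda>i j. \<kappa> (act (specht [2, 2]) \<sigma> (e i)) j)"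
  obtains \<psi> :: "'k poly4 \<Rightarrow> nat \<Rightarrow> 'k" where
    "\<And>p q j. p \<in> I \<Longrightarrow> q \<in> I \<Longrightarrow> \<psi> (p + q) j = \<psi> p j + \<psi> q j"
    "\<And>a p j. p \<in> I \<Longrightarrow> \<psi> (scalar_mult a p) j = a * \<psi> p j"
    "\<And>p. p \<in> I \<Longrightarrow> (\<forall>j<m + 2. \<psi> p j = 0) \<longleftrightarrow> p \<in> ideal_product irrelevant_ideal I"
    "\<And>k. k < m + 2 \<Longrightarrow> \<exists>u \<in> I \<inter> homogeneous_polys (generator_degree d c k).
        \<forall>j<m + 2. \<psi> u j = (if j = k then 1 else 0)"
    "\<And>\<sigma> p j. p \<in> I \<Longrightarrow> j < m + 2 \<Longrightarrow> \<psi> (permute_vars \<sigma> p) j = (\<Sum>i<m + 2. \<psi> p i * \<rho> \<sigma> i j)"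
proof -
  define W where "W = ideal_product irrelevant_ideal I"
  define V :: "('k, 'k poly4) graded_rep" where "V = subrep poly_rep I"
  define Q where "Q = quotient_rep V W"
  define S :: "('k, (4 \<Rightarrow> nat) \<Rightarrow>\<^sub>0 'k) rep" where "S = specht [2, 2]"
  define F :: "('k, nat \<Rightarrow> 'k) graded_rep" where
    "F = direct_sum_family {1..m} (\<lambda>i. in_degree (c i) trivial_rep)"
  define D where "D = direct_sum (in_degree d S) F"
  define p where "p = coset V W"
  have W_ideal: "is_ideal W" unfolding W_def ideal_product_def by (rule ideal.subspace_span)
  have WI: "W \<subseteq> I" unfolding W_def by (rule ideal_product_subset[OF I])
  have W_stable: "permute_vars \<sigma> q \<in> W" if "q \<in> W" for \<sigma> q
    using that permute_vars_irrelevant_product[OF stable] unfolding W_def by blast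
  have V: "vadd V = (+)" "vscale V = scalar_mult" "act V = permute_vars" "space V = I"
    by (simp_all add: V_def)
  have "poly.presents I (I \<inter> W) (coset (V\<lparr>homog := \<lambda>_. I\<rparr>) W) (component (quotient_rep (V\<lparr>homog := \<lambda>_. I\<rparr>) W) 0)"
    by (rule poly.presents_coset) (simp_all add: V subspace_of_ideal I W_ideal)
  moreover have "coset (V\<lparr>homog := \<lambda>_. I\<rparr>) W = p"
    by (auto simp: coset_def p_def)
  ultimately have pres: "poly.presents I (I \<inter> W) p (component (quotient_rep (V\<lparr>homog := \<lambda>_. I\<rparr>) W) 0)"
    by simp
  have Q_add: "vadd Q (p x) (p y) = p (x + y)" if "x \<in> I" "y \<in> I" for x y
    using pres that by (simp add: poly.presents_def Q_def component_def quotient_rep_def)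
  have Q_scale: "vscale Q a (p x) = p (scalar_mult a x)" if "x \<in> I" for x a
    using pres that by (simp add: poly.presents_def Q_def component_def quotient_rep_def)
  have p_eq: "p x = p y \<longleftrightarrow> x - y \<in> W" if "x \<in> I" "y \<in> I" for x y
    using pres that WI by (auto simp: poly.presents_def)
  have Q_space: "space Q = p ` I" by (simp add: Q_def quotient_rep_def p_def V)
  have Q_act: "act Q \<sigma> (p x) = p (permute_vars \<sigma> x)" for \<sigma> x
    using coset_stable[of V W, OF V(1) W_stable] by (simp add: Q_def quotient_rep_def p_def V)
  have Q_homog: "homog Q k = p ` (homogeneous_polys k \<inter> I)" for k
    by (simp add: Q_def quotient_rep_def p_def V_def)
  have "graded_iso Q D"
    using iso by (simp only: Q_def D_def V_def W_def S_def F_def)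
  then obtain \<Phi> where \<Phi>: "bij_betw \<Phi> (space Q) (space D) \<and>
     (\<forall>u\<in>space Q. \<forall>v\<in>space Q. \<Phi> (vadd Q u v) = vadd D (\<Phi> u) (\<Phi> v)) \<and>
     (\<forall>a. \<forall>v\<in>space Q. \<Phi> (vscale Q a v) = vscale D a (\<Phi> v)) \<and>
     (\<forall>\<sigma>. \<forall>v\<in>space Q. \<Phi> (act Q \<sigma> v) = act D \<sigma> (\<Phi> v)) \<and>
     (\<forall>k. \<Phi> ` homog Q k = homog D k)"
    unfolding graded_iso_def by (elim exE)
  have bij: "bij_betw \<Phi> (space Q) (space D)"
    and \<Phi>_add: "\<And>u v. u \<in> space Q \<Longrightarrow> v \<in> space Q \<Longrightarrow> \<Phi> (vadd Q u v) = vadd D (\<Phi> u) (\<Phi> v)"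
    and \<Phi>_scale: "\<And>a v. v \<in> space Q \<Longrightarrow> \<Phi> (vscale Q a v) = vscale D a (\<Phi> v)"
    and \<Phi>_act: "\<And>\<sigma> v. v \<in> space Q \<Longrightarrow> \<Phi> (act Q \<sigma> v) = act D \<sigma> (\<Phi> v)"
    and \<Phi>_homog: "\<And>k. \<Phi> ` homog Q k = homog D k"
    using \<Phi> by simp_all
  define f where "f x = \<Phi> (p x)" for x
  have fD: "f x \<in> space D" if "x \<in> I" for x
    using bij that by (auto simp: f_def Q_space bij_betw_def)
  have D_space: "space D = space S \<times> (\<Pi>\<^sub>E i\<in>{1..m}. UNIV)"
    by (simp add: D_def direct_sum_def F_def direct_sum_family_def trivial_rep_def)
  have f_fst: "fst (f x) \<in> space S" and f_snd: "snd (f x) \<in> (\<Pi>\<^sub>E i\<in>{1..m}. UNIV)" if "x \<in> I" for x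
    using fD[OF that] by (auto simp: D_space mem_Times_iff)
  have f_add: "fst (f (x + y)) = fst (f x) + fst (f y)"
    "i \<in> {1..m} \<Longrightarrow> snd (f (x + y)) i = snd (f x) i + snd (f y) i" if "x \<in> I" "y \<in> I" for x y i
  proof -
    have "f (x + y) = vadd D (f x) (f y)"
      using \<Phi>_add[of "p x" "p y"] that by (simp add: f_def Q_add Q_space)
    thus "fst (f (x + y)) = fst (f x) + fst (f y)"
      "i \<in> {1..m} \<Longrightarrow> snd (f (x + y)) i = snd (f x) i + snd (f y) i"
      by (simp_all add: D_def direct_sum_def F_def direct_sum_family_def trivial_rep_def S_def
          split_beta)
  qed
  have f_scale: "fst (f (scalar_mult a x)) = scalar_mult a (fst (f x))"
    "i \<in> {1..m} \<Longrightarrow> snd (f (scalar_mult a x)) i = a * snd (f x) i" if "x \<in> I" for x a i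
  proof -
    have "f (scalar_mult a x) = vscale D a (f x)"
      using \<Phi>_scale[of "p x" a] that by (simp add: f_def Q_scale Q_space)
    thus "fst (f (scalar_mult a x)) = scalar_mult a (fst (f x))"
      "i \<in> {1..m} \<Longrightarrow> snd (f (scalar_mult a x)) i = a * snd (f x) i"
      by (simp_all add: D_def direct_sum_def F_def direct_sum_family_def trivial_rep_def S_def
          split_beta)
  qed
  have f_act: "fst (f (permute_vars \<sigma> x)) = act S \<sigma> (fst (f x))"
    "i \<in> {1..m} \<Longrightarrow> snd (f (permute_vars \<sigma> x)) i = snd (f x) i" if "x \<in> I" for x \<sigma> i
  proof -
    have "f (permute_vars \<sigma> x) = act D \<sigma> (f x)"
      using \<Phi>_act[of "p x" \<sigma>] that by (simp add: f_def Q_act Q_space)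
    thus "fst (f (permute_vars \<sigma> x)) = act S \<sigma> (fst (f x))"
      "i \<in> {1..m} \<Longrightarrow> snd (f (permute_vars \<sigma> x)) i = snd (f x) i"
      by (simp_all add: D_def direct_sum_def F_def direct_sum_family_def trivial_rep_def S_def
          split_beta)
  qed
  have f_eq: "f x = f y \<longleftrightarrow> x - y \<in> W" if "x \<in> I" "y \<in> I" for x y
    using bij that p_eq[OF that] by (auto simp: f_def Q_space bij_betw_def inj_on_def)
  have \<kappa>_inj: "inj_on \<kappa> (space S)" and \<kappa>_add: "\<And>u v. u \<in> space S \<Longrightarrow> v \<in> space S \<Longrightarrow> \<kappa> (u + v) = (\<lambda>i. \<kappa> u i + \<kappa> v i)"
    and \<kappa>_scale: "\<And>a v. v \<in> space S \<Longrightarrow> \<kappa> (scalar_mult a v) = (\<lambda>i. a * \<kappa> v i)"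
    and \<kappa>_img: "\<kappa> ` space S = {a. \<forall>i\<ge>2. a i = 0}"
    using \<kappa> by (auto simp: coordinates_def bij_betw_def S_def)
  define \<psi> where "\<psi> x j = (if j < 2 then \<kappa> (fst (f x)) j else if j < m + 2 then snd (f x) (j - 1) else 0)" for x j
  have idx: "j - 1 \<in> {1..m}" if "\<not> j < 2" "j < m + 2" for j using that by auto
  have \<psi>_add: "\<psi> (x + y) j = \<psi> x j + \<psi> y j" if "x \<in> I" "y \<in> I" for x y j
    using that idx[of j] by (auto simp: \<psi>_def f_add f_fst \<kappa>_add)
  have \<psi>_scale: "\<psi> (scalar_mult a x) j = a * \<psi> x j" if "x \<in> I" for a x j
    using that idx[of j] by (auto simp: \<psi>_def f_scale f_fst \<kappa>_scale)
  have I0: "0 \<in> I" by (rule ideal.subspace_0[OF I])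
  have \<psi>0: "\<psi> 0 j = 0" for j using \<psi>_scale[OF I0, of 0 j] by simp
  have \<psi>_eq: "f x = f y" if xy: "x \<in> I" "y \<in> I" and eq: "\<And>j. j < m + 2 \<Longrightarrow> \<psi> x j = \<psi> y j" for x y
  proof (rule prod_eqI)
    have "\<kappa> (fst (f x)) j = \<kappa> (fst (f y)) j" for j
    proof (cases "j < 2")
      case True
      thus ?thesis using eq[of j] by (simp add: \<psi>_def)
    next
      case False
      have "\<kappa> (fst (f z)) \<in> {a. \<forall>i\<ge>2. a i = 0}" if "z \<in> I" for z
        using f_fst[OF that] \<kappa>_img by blast
      thus ?thesis using xy False by auto
    qed
    thus "fst (f x) = fst (f y)"
      using inj_onD[OF \<kappa>_inj _ f_fst[OF xy(1)] f_fst[OF xy(2)]] by blast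
    have "snd (f x) i = snd (f y) i" if "i \<in> {1..m}" for i
    proof -
      have "\<not> i + 1 < 2" "i + 1 < m + 2" using that by auto
      thus ?thesis using eq[of "i + 1"] unfolding \<psi>_def by simp
    qed
    thus "snd (f x) = snd (f y)" by (rule PiE_ext[OF f_snd[OF xy(1)] f_snd[OF xy(2)]])
  qed
  have \<psi>_W: "(\<forall>j<m + 2. \<psi> x j = 0) \<longleftrightarrow> x \<in> W" if x: "x \<in> I" for x
  proof
    assume "\<forall>j<m + 2. \<psi> x j = 0"
    hence "f x = f 0" using \<psi>_eq[OF x I0] \<psi>0 by simp
    thus "x \<in> W" using f_eq[OF x I0] by simp
  next
    assume "x \<in> W"
    hence "f x = f 0" using f_eq[OF x I0] by simp
    hence "\<psi> x = \<psi> 0" by (auto simp: \<psi>_def fun_eq_iff)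
    thus "\<forall>j<m + 2. \<psi> x j = 0" using \<psi>0 by simp
  qed
  have \<psi>_basis: "\<exists>u \<in> I \<inter> homogeneous_polys (generator_degree d c k).
        \<forall>j<m + 2. \<psi> u j = (if j = k then 1 else 0)" if k: "k < m + 2" for k
  proof -
    define E where "E = (if k < 2 then e k else 0, \<lambda>i\<in>{1..m}. if i + 1 = k then 1 else (0 :: 'k))"
    have zero_S: "0 \<in> space (specht [2, 2] :: ('k, _) rep)" by (simp add: specht_def poly.span_zero)
    have "E \<in> homog D (generator_degree d c k)"
      using e(1)[of k] zero_S
      by (auto simp: E_def D_def direct_sum_def F_def direct_sum_family_def trivial_rep_def
          generator_degree_def S_def)
    then obtain v where v: "v \<in> homog Q (generator_degree d c k)" "\<Phi> v = E"
      using \<Phi>_homog[of "generator_degree d c k"] by (metis imageE)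
    then obtain u where u: "u \<in> I \<inter> homogeneous_polys (generator_degree d c k)" "f u = E"
      by (auto simp: Q_homog f_def)
    have \<kappa>0: "\<kappa> 0 j = 0" for j
    proof -
      have "fst (f 0) = 0" using f_scale(1)[OF I0, of 0] by simp
      hence "0 \<in> space S" using f_fst[OF I0] by simp
      thus ?thesis using \<kappa>_scale[of 0 0] by simp
    qed
    have "\<psi> u j = (if j = k then 1 else 0)" if j: "j < m + 2" for j
    proof (cases "j < 2")
      case True
      thus ?thesis using e(2)[of k] by (auto simp: \<psi>_def u(2) E_def \<kappa>0 unit_vector_def)
    next
      case False
      thus ?thesis using idx[OF False j] by (auto simp: \<psi>_def u(2) E_def j)
    qed
    thus ?thesis using u(1) by blast
  qed
  have \<psi>_act: "\<psi> (permute_vars \<sigma> x) j = (\<Sum>i<m + 2. \<psi> x i * \<rho> \<sigma> i j)"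
    if x: "x \<in> I" and j: "j < m + 2" for \<sigma> x j
  proof (cases "j < 2")
    case True
    have closS: "u + v \<in> space S" "scalar_mult a v \<in> space S" if "u \<in> space S" "v \<in> space S" for u v a
      using that unfolding S_def specht_def
      by (simp_all add: poly.span_add poly.span_scale)
    have inv: "inv_into (space S) \<kappa> (unit_vector i) = e i" if "i < 2" for i
      using e(1)[OF that] e(2)[OF that] by (intro inv_into_f_eq[OF \<kappa>_inj]) (auto simp: S_def)
    have "\<kappa> (act S \<sigma> (fst (f x))) j
        = (\<Sum>i<2. \<kappa> (fst (f x)) i * \<kappa> (act S \<sigma> (inv_into (space S) \<kappa> (unit_vector i))) j)"
    proof (rule linear_functional_expansion[where g = "\<lambda>v. \<kappa> (act S \<sigma> v) j" and V = S])
      show "coordinates S 2 \<kappa>" using \<kappa> by (simp add: S_def)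
    qed (use f_fst[OF x] closed closS in
        \<open>auto simp: S_def specht_act_add specht_act_scale \<kappa>_add[unfolded S_def] \<kappa>_scale[unfolded S_def]\<close>)
    also have "\<dots> = (\<Sum>i<2. \<psi> x i * \<rho> \<sigma> i j)"
      by (intro sum.cong refl) (use True in \<open>auto simp: \<psi>_def \<rho>_def block_matrix_def inv[unfolded S_def] S_def\<close>)
    also have "\<dots> = (\<Sum>i<m + 2. \<psi> x i * \<rho> \<sigma> i j)"
      by (intro sum.mono_neutral_left) (use True in \<open>auto simp: \<rho>_def block_matrix_def\<close>)
    finally show ?thesis using True by (simp add: \<psi>_def f_act(1)[OF x])
  next
    case False
    have "(\<Sum>i<m + 2. \<psi> x i * \<rho> \<sigma> i j) = (\<Sum>i<m + 2. if i = j then \<psi> x i else 0)"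
      by (intro sum.cong refl) (use False in \<open>auto simp: \<rho>_def block_matrix_def\<close>)
    also have "\<dots> = \<psi> x j" using j by simp
    also have "\<dots> = \<psi> (permute_vars \<sigma> x) j"
      using False j idx[OF False j] by (simp add: \<psi>_def f_act(2)[OF x])
    finally show ?thesis by simp
  qed
  show ?thesis
    by (rule that[of \<psi>]) (use \<psi>_add \<psi>_scale \<psi>_W \<psi>_basis \<psi>_act W_def in auto)
qed

lemma finite_S4: "finite (UNIV :: S4 set)"
proof -
  have "inj (apply :: S4 \<Rightarrow> _)" by (auto simp: inj_def perm_eq_iff)
  moreover have "finite (range (apply :: S4 \<Rightarrow> _))" by (rule finite_subset[OF subset_UNIV]) simp
  ultimately show ?thesis using finite_imageD by blast
qed

text \<open>Averaging \<open>\<sigma> \<cdot> s(\<sigma>\<^sup>-\<^sup>1 \<cdot> v)\<close> over the group makes a linear section \<open>s\<close> of \<open>\<psi>\<close> equivariant.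
  The matrices \<open>\<rho>\<close> multiply in reversed order, since their rows are the images of the basis vectors.\<close>

lemma equivariant_lift:
  fixes I :: "'k::field_char_0 poly4 set" and n :: nat
  assumes I: "is_ideal I" and stable: "\<And>\<sigma> p. p \<in> I \<Longrightarrow> permute_vars \<sigma> p \<in> I"
    and \<psi>_add: "\<And>p q j. p \<in> I \<Longrightarrow> q \<in> I \<Longrightarrow> \<psi> (p + q) j = \<psi> p j + (\<psi> q j :: 'k)"
    and \<psi>_scale: "\<And>a p j. p \<in> I \<Longrightarrow> \<psi> (scalar_mult a p) j = a * \<psi> p j"
    and \<psi>_basis: "\<And>k. k < n \<Longrightarrow> \<exists>u \<in> I \<inter> homogeneous_polys (\<delta> k).
        \<forall>j<n. \<psi> u j = (if j = k then 1 else 0)"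
    and \<psi>_act: "\<And>\<sigma> p j. p \<in> I \<Longrightarrow> j < n \<Longrightarrow> \<psi> (permute_vars \<sigma> p) j = (\<Sum>i<n. \<psi> p i * \<rho> \<sigma> i j)"
    and \<rho>_degree: "\<And>\<sigma> i j. i < n \<Longrightarrow> j < n \<Longrightarrow> \<delta> i \<noteq> \<delta> j \<Longrightarrow> \<rho> \<sigma> i j = 0"
  obtains g where "\<And>k. k < n \<Longrightarrow> g k \<in> I \<inter> homogeneous_polys (\<delta> k)"
    "\<And>k j. k < n \<Longrightarrow> j < n \<Longrightarrow> \<psi> (g k) j = (if j = k then 1 else 0)"
    "\<And>\<tau> k. k < n \<Longrightarrow> permute_vars \<tau> (g k) = (\<Sum>l<n. scalar_mult (\<rho> \<tau> k l) (g l))"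
proof -
  note Isub = subspace_of_ideal[OF I]
  obtain u where u: "\<And>k. k < n \<Longrightarrow> u k \<in> I \<inter> homogeneous_polys (\<delta> k)"
    "\<And>k j. k < n \<Longrightarrow> j < n \<Longrightarrow> \<psi> (u k) j = (if j = k then 1 else 0)"
    using \<psi>_basis by metis
  have \<psi>0: "\<psi> 0 j = 0" for j
    using \<psi>_scale[OF ideal.subspace_0[OF I], of 0 j] by simp
  have \<psi>_sum: "\<psi> (\<Sum>x\<in>A. f x) j = (\<Sum>x\<in>A. \<psi> (f x) j)" if "\<And>x. x \<in> A \<Longrightarrow> f x \<in> I"
    for A :: "'x set" and f j
    using that
  proof (induction A rule: infinite_finite_induct)
    case (insert x A)
    thus ?case using \<psi>_add[of "f x" "\<Sum>x\<in>A. f x" j] poly.subspace_sum[OF Isub, of A f] by simp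
  qed (simp_all add: \<psi>0)
  have \<psi>_u: "\<psi> (permute_vars \<sigma> (u i)) j = \<rho> \<sigma> i j" if "i < n" "j < n" for \<sigma> i j
  proof -
    have "\<psi> (permute_vars \<sigma> (u i)) j = (\<Sum>l<n. if l = i then \<rho> \<sigma> l j else 0)"
      using \<psi>_act[of "u i" j \<sigma>] u(1)[OF that(1)] u(2)[OF that(1)] that
      by (simp add: if_distrib[of "\<lambda>t. t * _"] cong: if_cong)
    thus ?thesis using that by simp
  qed
  have \<rho>_one: "\<rho> 1 i j = (if j = i then 1 else 0)" if "i < n" "j < n" for i j
    using \<psi>_u[OF that, of 1] u(2)[OF that] by simp
  have \<rho>_mult: "\<rho> (\<sigma> * \<tau>) i j = (\<Sum>l<n. \<rho> \<tau> i l * \<rho> \<sigma> l j)" if ij: "i < n" "j < n" for \<sigma> \<tau> i j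
  proof -
    have "\<rho> (\<sigma> * \<tau>) i j = \<psi> (permute_vars \<sigma> (permute_vars \<tau> (u i))) j"
      using \<psi>_u[OF ij, of "\<sigma> * \<tau>"] by (simp add: permute_vars_mult_perm)
    also have "\<dots> = (\<Sum>l<n. \<psi> (permute_vars \<tau> (u i)) l * \<rho> \<sigma> l j)"
      using u(1)[OF ij(1)] stable by (intro \<psi>_act) (auto simp: ij)
    also have "\<dots> = (\<Sum>l<n. \<rho> \<tau> i l * \<rho> \<sigma> l j)"
      by (intro sum.cong refl) (simp add: \<psi>_u ij)
    finally show ?thesis .
  qed
  define N :: 'k where "N = of_nat (card (UNIV :: S4 set))"
  have N: "N \<noteq> 0" using finite_S4 by (simp add: N_def card_eq_0_iff)
  \<comment> \<open>the average before division by the order of the group; the inner sum is \<open>\<sigma> \<cdot> s(\<sigma>\<^sup>-\<^sup>1 \<cdot> v\<^sub>k)\<close>\<close>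
  define h where "h k = (\<Sum>\<sigma>\<in>(UNIV :: S4 set). \<Sum>j<n.
    scalar_mult (\<rho> (inverse \<sigma>) k j) (permute_vars \<sigma> (u j)))" for k
  define g where "g k = scalar_mult (1 / N) (h k)" for k
  have uI: "permute_vars \<sigma> (u j) \<in> I" if "j < n" for \<sigma> j
    using u(1)[OF that] stable by blast
  have hI: "h k \<in> I" for k
    unfolding h_def by (intro poly.subspace_sum[OF Isub] poly.subspace_scale[OF Isub] uI) auto
  have h_deg: "h k \<in> homogeneous_polys (\<delta> k)" if k: "k < n" for k
    unfolding h_def
  proof (intro poly.subspace_sum[OF subspace_homogeneous_polys])
    fix \<sigma> j assume "j \<in> {..<n}"
    hence j: "j < n" by simp
    show "scalar_mult (\<rho> (inverse \<sigma>) k j) (permute_vars \<sigma> (u j)) \<in> homogeneous_polys (\<delta> k)"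
    proof (cases "\<delta> k = \<delta> j")
      case True
      thus ?thesis using u(1)[OF j]
        by (intro poly.subspace_scale[OF subspace_homogeneous_polys]) (auto intro: permute_vars_homogeneous)
    next
      case False
      thus ?thesis
        using \<rho>_degree[OF k j False] poly.subspace_0[OF subspace_homogeneous_polys] by simp
    qed
  qed
  have \<psi>h: "\<psi> (h k) l = N * (if l = k then 1 else 0)" if kl: "k < n" "l < n" for k l
  proof -
    have "\<psi> (\<Sum>j<n. scalar_mult (\<rho> (inverse \<sigma>) k j) (permute_vars \<sigma> (u j))) l
        = (if l = k then 1 else 0)" for \<sigma> :: S4
    proof -
      have "\<psi> (\<Sum>j<n. scalar_mult (\<rho> (inverse \<sigma>) k j) (permute_vars \<sigma> (u j))) l
          = (\<Sum>j<n. \<psi> (scalar_mult (\<rho> (inverse \<sigma>) k j) (permute_vars \<sigma> (u j))) l)"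
        by (intro \<psi>_sum poly.subspace_scale[OF Isub] uI) simp
      also have "\<dots> = (\<Sum>j<n. \<rho> (inverse \<sigma>) k j * \<rho> \<sigma> j l)"
        by (intro sum.cong refl) (simp add: \<psi>_scale uI \<psi>_u kl)
      also have "\<dots> = \<rho> (\<sigma> * inverse \<sigma>) k l" by (rule \<rho>_mult[OF kl, symmetric])
      finally show ?thesis by (simp add: \<rho>_one kl)
    qed
    moreover have "\<psi> (h k) l = (\<Sum>\<sigma>\<in>UNIV. \<psi> (\<Sum>j<n.
        scalar_mult (\<rho> (inverse \<sigma>) k j) (permute_vars \<sigma> (u j))) l)"
      unfolding h_def
      by (intro \<psi>_sum poly.subspace_sum[OF Isub] poly.subspace_scale[OF Isub] uI) simp
    ultimately show ?thesis by (simp add: N_def)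
  qed
  have h_act: "permute_vars \<tau> (h k) = (\<Sum>l<n. scalar_mult (\<rho> \<tau> k l) (h l))" if k: "k < n" for \<tau> k
  proof -
    have "permute_vars \<tau> (h k) = (\<Sum>\<sigma>\<in>(UNIV :: S4 set). \<Sum>j<n.
        scalar_mult (\<rho> (inverse \<sigma>) k j) (permute_vars (\<tau> * \<sigma>) (u j)))"
      by (simp add: h_def permute_vars_sum permute_vars_scale permute_vars_mult_perm)
    also have "\<dots> = (\<Sum>\<sigma>\<in>(UNIV :: S4 set). \<Sum>j<n.
        scalar_mult (\<rho> (inverse \<sigma> * \<tau>) k j) (permute_vars \<sigma> (u j)))"
    proof -
      have "inverse \<sigma> * inverse \<tau> * \<tau> = inverse \<sigma>" for \<sigma> by (simp add: mult.assoc)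
      thus ?thesis
        by (intro sum.reindex_bij_witness[where i = "\<lambda>\<sigma>. inverse \<tau> * \<sigma>" and j = "\<lambda>\<sigma>. \<tau> * \<sigma>"])
          (simp_all add: mult.assoc[symmetric])
    qed
    also have "\<dots> = (\<Sum>\<sigma>\<in>(UNIV :: S4 set). \<Sum>l<n. scalar_mult (\<rho> \<tau> k l)
        (\<Sum>j<n. scalar_mult (\<rho> (inverse \<sigma>) l j) (permute_vars \<sigma> (u j))))"
    proof (rule sum.cong[OF refl])
      fix \<sigma> :: S4
      have "(\<Sum>j<n. scalar_mult (\<rho> (inverse \<sigma> * \<tau>) k j) (permute_vars \<sigma> (u j)))
          = (\<Sum>j<n. \<Sum>l<n. scalar_mult (\<rho> \<tau> k l * \<rho> (inverse \<sigma>) l j) (permute_vars \<sigma> (u j)))"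
        by (intro sum.cong refl) (simp add: \<rho>_mult k poly.scale_sum_left)
      also have "\<dots> = (\<Sum>l<n. \<Sum>j<n. scalar_mult (\<rho> \<tau> k l * \<rho> (inverse \<sigma>) l j) (permute_vars \<sigma> (u j)))"
        by (rule sum.swap)
      finally show "(\<Sum>j<n. scalar_mult (\<rho> (inverse \<sigma> * \<tau>) k j) (permute_vars \<sigma> (u j)))
          = (\<Sum>l<n. scalar_mult (\<rho> \<tau> k l)
              (\<Sum>j<n. scalar_mult (\<rho> (inverse \<sigma>) l j) (permute_vars \<sigma> (u j))))"
        by (simp add: poly.scale_sum_right)
    qed
    also have "\<dots> = (\<Sum>l<n. \<Sum>\<sigma>\<in>(UNIV :: S4 set). scalar_mult (\<rho> \<tau> k l)
        (\<Sum>j<n. scalar_mult (\<rho> (inverse \<sigma>) l j) (permute_vars \<sigma> (u j))))"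
      by (rule sum.swap)
    also have "\<dots> = (\<Sum>l<n. scalar_mult (\<rho> \<tau> k l) (h l))"
      by (simp only: h_def poly.scale_sum_right)
    finally show ?thesis .
  qed
  show ?thesis
  proof (rule that[of g])
    show "g k \<in> I \<inter> homogeneous_polys (\<delta> k)" if "k < n" for k
      unfolding g_def using hI h_deg[OF that]
      by (auto intro: poly.subspace_scale[OF Isub] poly.subspace_scale[OF subspace_homogeneous_polys])
    show "\<psi> (g k) j = (if j = k then 1 else 0)" if "k < n" "j < n" for k j
      using N by (simp add: g_def \<psi>_scale hI \<psi>h that)
    show "permute_vars \<tau> (g k) = (\<Sum>l<n. scalar_mult (\<rho> \<tau> k l) (g l))" if "k < n" for \<tau> k
      by (simp add: g_def permute_vars_scale h_act that poly.scale_sum_right mult.commute)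
  qed
qed

lemma constant_term_zero_irrelevant:
  fixes p :: "'k::field poly4"
  assumes "lookup p 0 = 0"
  shows "p \<in> irrelevant_ideal"
proof -
  have "single \<alpha> a \<in> irrelevant_ideal" if "\<alpha> \<noteq> 0" for \<alpha> and a :: 'k
  proof -
    obtain i where i: "lookup \<alpha> i \<noteq> 0"
      using \<open>\<alpha> \<noteq> 0\<close> by (metis lookup_zero poly_mapping_eqI)
    have "\<alpha> = single i 1 + (\<alpha> - single i 1)"
      using i by (intro poly_mapping_eqI) (auto simp: lookup_add lookup_minus lookup_single when_def)
    hence "single \<alpha> a = single (\<alpha> - single i 1) a * var i"
      by (simp add: var_def mult_single add.commute)
    thus ?thesis unfolding irrelevant_ideal_def by (simp add: ideal.span_scale ideal.span_base)
  qed
  hence "(\<Sum>\<alpha>\<in>keys p. single \<alpha> (lookup p \<alpha>)) \<in> irrelevant_ideal"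
    unfolding irrelevant_ideal_def using assms
    by (intro ideal.span_sum) (metis in_keys_iff)
  thus ?thesis by (simp add: sum_singles)
qed

section \<open>Traces on ideals generated by pairs and invariants\<close>

interpretation poly_pair: endomorphism_traces
  "scale_pair (scalar_mult :: 'k::field \<Rightarrow> ('a \<Rightarrow>\<^sub>0 'k) \<Rightarrow> ('a \<Rightarrow>\<^sub>0 'k))"
  by (rule poly.endomorphism_traces_pair)

lemma permute_vars_shifted:
  "p \<in> homogeneous_shifted \<delta> e \<Longrightarrow> permute_vars \<sigma> p \<in> homogeneous_shifted \<delta> e"
  by (auto simp: homogeneous_shifted_def permute_vars_homogeneous split: if_splits)

lemma endomorphism_permute:
  "(\<And>p. p \<in> X \<Longrightarrow> permute_vars \<sigma> p \<in> X) \<Longrightarrow> poly.endomorphism X (permute_vars \<sigma>)"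
  by (auto simp: poly.endomorphism_def permute_vars_add permute_vars_scale)

text \<open>For an ideal \<open>J\<close> this is the coefficient at \<open>t\<^sup>e\<close> of the graded character of \<open>J\<close>, evaluated at \<open>\<sigma>\<close>.\<close>

definition piece_trace :: "S4 \<Rightarrow> 'k::field poly4 set \<Rightarrow> nat \<Rightarrow> 'k" where
  "piece_trace \<sigma> J e = poly.subspace_trace (homogeneous_polys e \<inter> J) (permute_vars \<sigma>)"

lemma shifted_trace:
  assumes "0 \<in> J"
  shows "poly.subspace_trace (homogeneous_shifted \<delta> e \<inter> J) (permute_vars \<sigma>)
    = (if \<delta> \<le> e then piece_trace \<sigma> J (e - \<delta>) else (0 :: 'k::field))"
proof (cases "\<delta> \<le> e")
  case True
  thus ?thesis by (simp add: homogeneous_shifted_def piece_trace_def)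
next
  case False
  moreover have "{0} \<inter> J = {0}" using assms by auto
  moreover have "poly.endomorphism {0 :: 'k poly4} (permute_vars \<sigma>)"
    by (rule endomorphism_permute) simp
  ultimately show ?thesis by (simp add: homogeneous_shifted_def poly.subspace_trace_zero)
qed

lemma pair_span:
  fixes B :: "('a \<Rightarrow>\<^sub>0 'k::field) set"
  assumes "x \<in> poly.span B" "y \<in> poly.span B"
  shows "(x, y) \<in> poly_pair.span ((\<lambda>b. (b, 0)) ` B \<union> (\<lambda>b. (0, b)) ` B)"
proof -
  let ?S = "(\<lambda>b. (b, 0)) ` B \<union> (\<lambda>b. (0, b)) ` B"
  have "(x, 0) \<in> poly_pair.span ?S"
    using assms(1)
  proof (induction rule: poly.span_induct_alt)
    case base
    show ?case using poly_pair.span_zero by (simp add: zero_prod_def)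
  next
    case (step c a b)
    have "(scalar_mult c a + b, 0) = scale_pair scalar_mult c (a, 0) + (b, 0)"
      by (simp add: scale_pair_def)
    also have "\<dots> \<in> poly_pair.span ?S"
      by (rule poly_pair.span_add[OF poly_pair.span_scale[OF poly_pair.span_base]]) (use step in auto)
    finally show ?case .
  qed
  moreover have "(0, y) \<in> poly_pair.span ?S"
    using assms(2)
  proof (induction rule: poly.span_induct_alt)
    case base
    show ?case using poly_pair.span_zero by (simp add: zero_prod_def)
  next
    case (step c a b)
    have "(0, scalar_mult c a + b) = scale_pair scalar_mult c (0, a) + (0, b)"
      by (simp add: scale_pair_def)
    also have "\<dots> \<in> poly_pair.span ?S"
      by (rule poly_pair.span_add[OF poly_pair.span_scale[OF poly_pair.span_base]]) (use step in auto)
    finally show ?case .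
  qed
  ultimately have "(x, 0) + (0, y) \<in> poly_pair.span ?S" by (rule poly_pair.span_add)
  thus ?thesis by simp
qed

text \<open>Degree \<open>e\<close> of the Koszul complex.  The map \<open>\<mu>\<close> sends \<open>(p, q)\<close> to \<open>p g\<^sub>0 + q g\<^sub>1\<close> and is equivariant
  when \<open>\<sigma>\<close> acts on pairs by \<open>F\<close>, that is, on coefficients and by the given matrix on the two basis
  vectors.  Its kernel is the image of the injective map \<open>\<nu>\<close>, which sends \<open>x\<close> to \<open>(x g\<^sub>1, -x g\<^sub>0)\<close> and
  turns \<open>\<sigma>\<close> multiplied by the determinant into \<open>F\<close>.\<close>

lemma trace_ideal_of_pair:
  fixes g :: "nat \<Rightarrow> 'k::field_char_0 poly4" and a b c d' :: 'k
  assumes g: "g 0 \<in> homogeneous_polys d" "g 1 \<in> homogeneous_polys d"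
    and kos: "homogeneous_relations_koszul 2 g (\<lambda>_. d)"
    and nzd: "\<And>x e. x \<in> homogeneous_shifted d e \<Longrightarrow> x * g 0 = 0 \<Longrightarrow> x = 0"
    and \<sigma>0: "permute_vars \<sigma> (g 0) = scalar_mult a (g 0) + scalar_mult b (g 1)"
    and \<sigma>1: "permute_vars \<sigma> (g 1) = scalar_mult c (g 0) + scalar_mult d' (g 1)"
  shows "piece_trace \<sigma> (ideal_generated (g ` {..<2})) e
    = (if d \<le> e then (a + d') * piece_trace \<sigma> UNIV (e - d) else 0)
      - (if 2 * d \<le> e then (a * d' - b * c) * piece_trace \<sigma> UNIV (e - 2 * d) else 0)"
proof -
  define H :: "'k poly4 set" where "H = homogeneous_shifted d e"
  define C :: "'k poly4 set" where "C = homogeneous_shifted (2 * d) e"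
  define J where "J = ideal_generated (g ` {..<2})"
  define Y where "Y = homogeneous_polys e \<inter> J"
  define \<mu> where "\<mu> v = fst v * g 0 + snd v * g 1" for v
  define A where "A = {v \<in> H \<times> H. \<mu> v = 0}"
  define \<nu> where "\<nu> x = (x * g 1, - (x * g 0))" for x
  define F where "F v = (scalar_mult a (permute_vars \<sigma> (fst v)) + scalar_mult c (permute_vars \<sigma> (snd v)),
    scalar_mult b (permute_vars \<sigma> (fst v)) + scalar_mult d' (permute_vars \<sigma> (snd v)))" for v
  define B :: "'k poly4 set" where "B = monomials_of_degree (e - d)"
  define B' :: "'k poly4 set" where "B' = monomials_of_degree (e - 2 * d)"
  have Hsub: "poly.subspace H" unfolding H_def by (rule subspace_homogeneous_shifted)
  have Csub: "poly.subspace C" unfolding C_def by (rule subspace_homogeneous_shifted)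
  have B: "finite B" "H \<subseteq> poly.span B"
    unfolding B_def H_def by (rule finite_monomials_of_degree homogeneous_shifted_span)+
  have B': "finite B'" "C \<subseteq> poly.span B'"
    unfolding B'_def C_def by (rule finite_monomials_of_degree homogeneous_shifted_span)+
  let ?S = "(\<lambda>b. (b, 0)) ` B \<union> (\<lambda>b. (0, b)) ` B"
  have HH: "poly_pair.subspace (H \<times> H)"
    by (rule poly_pair.subspaceI)
      (auto simp: zero_prod_def scale_pair_def poly.subspace_0[OF Hsub] poly.subspace_add[OF Hsub]
        poly.subspace_scale[OF Hsub])
  have HHspan: "H \<times> H \<subseteq> poly_pair.span ?S"
    using B(2) pair_span by blast
  have fS: "finite ?S" using B(1) by simp
  have \<mu>_add: "\<mu> (u + v) = \<mu> u + \<mu> v" for u v by (simp add: \<mu>_def algebra_simps)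
  have \<mu>_scale: "\<mu> (scale_pair scalar_mult k v) = scalar_mult k (\<mu> v)" for k v
    by (simp add: \<mu>_def scale_pair_def scalar_mult_times_left poly.scale_right_distrib)
  have \<mu>0: "\<mu> 0 = 0" by (simp add: \<mu>_def)
  have Asub: "poly_pair.subspace A"
    unfolding A_def using HH
    by (intro poly_pair.subspaceI)
      (auto simp: \<mu>_add \<mu>_scale \<mu>0 poly_pair.subspace_0 poly_pair.subspace_add poly_pair.subspace_scale)
  have mem_J: "x \<in> J \<longleftrightarrow> (\<exists>p q. x = p * g 0 + q * g 1)" for x
  proof -
    have "(\<exists>a. x = (\<Sum>i<2. a i * g i)) \<longleftrightarrow> (\<exists>p q. x = p * g 0 + q * g 1)"
    proof
      assume "\<exists>p q. x = p * g 0 + q * g 1"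
      then obtain p q where "x = p * g 0 + q * g 1" by blast
      thus "\<exists>a. x = (\<Sum>i<2. a i * g i)"
        by (intro exI[of _ "\<lambda>i. if i = 0 then p else q"]) (simp add: numeral_2_eq_2)
    qed (auto simp: numeral_2_eq_2)
    thus ?thesis by (simp only: J_def mem_ideal_generated_image)
  qed
  have \<mu>_Y: "\<mu> ` (H \<times> H) = Y"
  proof (intro equalityI subsetI)
    fix y assume "y \<in> \<mu> ` (H \<times> H)"
    then obtain p q where pq: "p \<in> H" "q \<in> H" "y = p * g 0 + q * g 1" by (auto simp: \<mu>_def)
    hence "y \<in> homogeneous_polys e"
      using homogeneous_shifted_mult g poly.subspace_add[OF subspace_homogeneous_polys]
      unfolding H_def by metis
    thus "y \<in> Y" using pq(3) mem_J by (auto simp: Y_def)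
  next
    fix y assume "y \<in> Y"
    then obtain p q where y: "y = p * g 0 + q * g 1" "y \<in> homogeneous_polys e"
      unfolding Y_def Int_iff mem_J by blast
    have "y = hom_part e (p * g 0 + q * g 1)" using y by (simp add: hom_part_same)
    also have "\<dots> = \<mu> (hom_part_shifted d e p, hom_part_shifted d e q)"
      unfolding \<mu>_def fst_conv snd_conv hom_part_add
        hom_part_times_homogeneous[OF g(1)] hom_part_times_homogeneous[OF g(2)] ..
    finally show "y \<in> \<mu> ` (H \<times> H)"
      unfolding H_def using hom_part_shifted_mem by (metis imageI mem_Sigma_iff)
  qed
  have F_H: "F v \<in> H \<times> H" if "v \<in> H \<times> H" for v
    using that by (auto simp: F_def H_def intro!: permute_vars_shifted
        poly.subspace_add[OF subspace_homogeneous_shifted] poly.subspace_scale[OF subspace_homogeneous_shifted])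
  have F_end: "poly_pair.endomorphism (H \<times> H) F"
    unfolding poly_pair.endomorphism_def
  proof (intro conjI)
    show "F ` (H \<times> H) \<subseteq> H \<times> H" using F_H by blast
    show "\<forall>x\<in>H \<times> H. \<forall>y\<in>H \<times> H. F (x + y) = F x + F y"
      by (auto simp: F_def permute_vars_add poly.scale_right_distrib)
    show "\<forall>k. \<forall>x\<in>H \<times> H. F (scale_pair scalar_mult k x) = scale_pair scalar_mult k (F x)"
      by (auto simp: F_def scale_pair_def permute_vars_scale poly.scale_right_distrib mult.commute)
  qed
  have \<mu>F: "permute_vars \<sigma> (\<mu> v) = \<mu> (F v)" for v
    by (simp add: \<mu>_def F_def permute_vars_add permute_vars_times \<sigma>0 \<sigma>1 scalar_mult_eq_times algebra_simps
        del: One_nat_def)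
  have FA: "F ` A \<subseteq> A"
  proof
    fix w assume "w \<in> F ` A"
    then obtain v where v: "v \<in> H \<times> H" "\<mu> v = 0" "w = F v" by (auto simp: A_def)
    thus "w \<in> A" using F_H[OF v(1)] \<mu>F[of v] by (simp add: A_def)
  qed
  have "poly_pair.presents (H \<times> H) A \<mu> (poly.space_rep Y)"
    unfolding poly_pair.presents_def
  proof (intro conjI ballI allI)
    show "\<mu> x = \<mu> y \<longleftrightarrow> x - y \<in> A" if "x \<in> H \<times> H" "y \<in> H \<times> H" for x y
    proof -
      have "\<mu> x = \<mu> (x - y) + \<mu> y" using \<mu>_add[of "x - y" y] by simp
      thus ?thesis using poly_pair.subspace_diff[OF HH that] by (simp add: A_def)
    qed
  qed (use HH Asub \<mu>_Y \<mu>_add \<mu>_scale in \<open>auto simp: poly.space_rep_def A_def\<close>)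
  hence "trace (poly.space_rep Y) (permute_vars \<sigma>)
      = poly_pair.subspace_trace (H \<times> H) F - poly_pair.subspace_trace A F"
    by (rule poly_pair.trace_presented[OF _ fS HHspan F_end FA]) (rule \<mu>F)
  moreover have "poly_pair.subspace_trace (H \<times> H) F = (a + d') * poly.subspace_trace H (permute_vars \<sigma>)"
    by (rule poly.trace_on_square[OF Hsub B])
      (auto simp: F_def fun_eq_iff intro!: endomorphism_permute simp: H_def permute_vars_shifted)
  moreover have "poly_pair.subspace_trace A F = (a * d' - b * c) * poly.subspace_trace C (permute_vars \<sigma>)"
  proof -
    have \<nu>_add: "\<nu> (x + y) = \<nu> x + \<nu> y" for x y by (simp add: \<nu>_def algebra_simps)
    have \<nu>_scale: "\<nu> (scalar_mult k x) = scale_pair scalar_mult k (\<nu> x)" for k x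
      by (simp add: \<nu>_def scale_pair_def scalar_mult_times_left)
    have CH: "x * g i \<in> H" if "x \<in> C" "g i \<in> homogeneous_polys d" for x i
    proof (cases "2 * d \<le> e")
      case True
      hence "x * g i \<in> homogeneous_polys (e - 2 * d + d)"
        using that by (intro homogeneous_polys_mult) (simp_all add: C_def homogeneous_shifted_def)
      moreover have "e - 2 * d + d = e - d" using True by simp
      ultimately show ?thesis using True by (simp add: H_def homogeneous_shifted_def)
    next
      case False
      hence "x = 0" using that by (simp add: C_def homogeneous_shifted_def)
      thus ?thesis using poly.subspace_0[OF Hsub] by simp
    qed
    have \<nu>_A: "\<nu> ` C = A"
    proof (intro equalityI subsetI)
      fix v assume "v \<in> \<nu> ` C"
      thus "v \<in> A" using CH g poly.subspace_neg[OF Hsub]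
        by (auto simp: \<nu>_def A_def \<mu>_def algebra_simps)
    next
      fix v assume v: "v \<in> A"
      define t where "t i = (if i = 0 then fst v else if i = 1 then snd v else 0)" for i :: nat
      have "relation 2 g t" using v by (simp add: relation_def t_def A_def \<mu>_def numeral_2_eq_2)
      moreover have "t i \<in> homogeneous_shifted d e" for i
        using v poly.subspace_0[OF Hsub] by (auto simp: t_def A_def H_def)
      ultimately have "koszul_relation 2 g t"
        using kos unfolding homogeneous_relations_koszul_def by blast
      then obtain M where M: "\<forall>i<2. \<forall>j<2. M i j = - M j i" "\<forall>i<2. t i = (\<Sum>j<2. M i j * g j)"
        unfolding koszul_relation_def by blast
      have M0: "M 0 0 = 0" "M 1 1 = 0"
        using M(1)[rule_format, of 0 0] M(1)[rule_format, of 1 1]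
        by (auto intro!: self_eq_neg_poly4)
      have M1: "M 1 0 = - M 0 1" using M(1)[rule_format, of 1 0] by simp
      have v0: "fst v = M 0 1 * g 1"
        using M(2)[rule_format, of 0] M0 by (simp add: t_def numeral_2_eq_2)
      have v1: "snd v = - (M 0 1 * g 0)"
        using M(2)[rule_format, of 1] M0 M1 by (simp add: t_def numeral_2_eq_2)
      have part: "hom_part_shifted d e (M 0 1 * g i) = hom_part_shifted (2 * d) e (M 0 1) * g i"
        if "g i \<in> homogeneous_polys d" for i
        unfolding mult.commute[of _ "g i"] mult_2 by (rule hom_part_shifted_times[OF that])
      have minus: "hom_part_shifted d e (- x) = - hom_part_shifted d e x" for x :: "'k poly4"
        by (simp add: hom_part_shifted_def hom_part_minus)
      have "fst v = hom_part_shifted d e (fst v)" "snd v = hom_part_shifted d e (snd v)"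
        using v by (auto intro!: hom_part_shifted_same[symmetric] simp: A_def H_def mem_Times_iff)
      hence "v = \<nu> (hom_part_shifted (2 * d) e (M 0 1))"
        unfolding v0 v1 minus part[OF g(1)] part[OF g(2)] \<nu>_def by (simp add: prod_eq_iff v0 v1)
      thus "v \<in> \<nu> ` C" unfolding C_def using hom_part_shifted_mem by blast
    qed
    have \<nu>_inj: "x = 0" if "x \<in> C" "\<nu> x = 0" for x
    proof (rule nzd[of x "e - d"])
      show "x * g 0 = 0" using that(2) by (simp add: \<nu>_def zero_prod_def)
      show "x \<in> homogeneous_shifted d (e - d)"
        using that(1) by (auto simp: C_def homogeneous_shifted_def mult_2 mem_homogeneous_polys
            diff_diff_left split: if_splits)
    qed
    have "poly.presents C {0} \<nu> (poly_pair.space_rep A)"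
      unfolding poly.presents_def
    proof (intro conjI ballI allI)
      show "\<nu> x = \<nu> y \<longleftrightarrow> x - y \<in> {0}" if "x \<in> C" "y \<in> C" for x y
      proof
        assume "\<nu> x = \<nu> y"
        hence "\<nu> (x - y) = 0" using \<nu>_add[of "x - y" y] by simp
        thus "x - y \<in> {0}" using \<nu>_inj[OF poly.subspace_diff[OF Csub that]] by simp
      qed simp
    qed (use Csub \<nu>_A \<nu>_add \<nu>_scale poly.subspace_0 in \<open>auto simp: poly_pair.space_rep_def\<close>)
    moreover have Cend: "poly.endomorphism C (permute_vars \<sigma>)"
      by (rule endomorphism_permute) (simp add: C_def permute_vars_shifted)
    hence "poly.endomorphism C (\<lambda>x. scalar_mult (a * d' - b * c) (permute_vars \<sigma> x))"
      using poly.subspace_scale[OF Csub] by (auto simp: poly.endomorphism_def poly.scale_right_distrib mult.commute)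
    moreover have "F (\<nu> x) = \<nu> (scalar_mult (a * d' - b * c) (permute_vars \<sigma> x))" for x
    proof -
      have s: "single 0 (a * d' - b * c) = single 0 a * single 0 d'
          - (single 0 b * single 0 c :: 'k poly4)"
        by (simp add: mult_single single_diff)
      show ?thesis
        unfolding F_def \<nu>_def fst_conv snd_conv permute_vars_minus permute_vars_times \<sigma>0 \<sigma>1
          scalar_mult_eq_times s by (simp add: algebra_simps)
    qed
    ultimately have "trace (poly_pair.space_rep A) F
        = poly.subspace_trace C (\<lambda>x. scalar_mult (a * d' - b * c) (permute_vars \<sigma> x))
          - poly.subspace_trace {0} (\<lambda>x. scalar_mult (a * d' - b * c) (permute_vars \<sigma> x))"
      by (intro poly.trace_presented[OF _ B']) auto
    also have "poly.subspace_trace {0} (\<lambda>x. scalar_mult (a * d' - b * c) (permute_vars \<sigma> x)) = 0"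
      by (rule poly.subspace_trace_zero) (simp add: poly.endomorphism_def)
    also have "poly.subspace_trace C (\<lambda>x. scalar_mult (a * d' - b * c) (permute_vars \<sigma> x))
        = (a * d' - b * c) * poly.subspace_trace C (permute_vars \<sigma>)"
      by (rule poly.subspace_trace_scale[OF Csub B' Cend])
    finally show ?thesis by (simp add: poly_pair.subspace_trace_def)
  qed
  moreover have "poly.subspace_trace H (permute_vars \<sigma>) = (if d \<le> e then piece_trace \<sigma> UNIV (e - d) else 0)"
    using shifted_trace[of "UNIV :: 'k poly4 set" d e \<sigma>] by (simp add: H_def)
  moreover have "poly.subspace_trace C (permute_vars \<sigma>) = (if 2 * d \<le> e then piece_trace \<sigma> UNIV (e - 2 * d) else 0)"
    using shifted_trace[of "UNIV :: 'k poly4 set" "2 * d" e \<sigma>] by (simp add: C_def)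
  ultimately show ?thesis
    by (simp add: piece_trace_def poly.subspace_trace_def Y_def J_def)
qed

text \<open>Multiplication by \<open>g\<^sub>l\<close> identifies \<open>R/J\<close>, shifted by \<open>\<delta>\<^sub>l\<close>, with \<open>J'/J\<close>, where \<open>J\<close> is generated by
  the previous elements and \<open>J'\<close> also by \<open>g\<^sub>l\<close>; it commutes with \<open>\<sigma>\<close> since \<open>g\<^sub>l\<close> is fixed.\<close>

lemma trace_adjoin_invariant:
  fixes g :: "nat \<Rightarrow> 'k::field poly4"
  assumes g: "\<And>i. i \<le> l \<Longrightarrow> g i \<in> homogeneous_polys (\<delta> i)"
    and nzd: "\<And>x e. x \<in> homogeneous_shifted (\<delta> l) e \<Longrightarrow> x * g l \<in> ideal_generated (g ` {..<l})
        \<Longrightarrow> x \<in> ideal_generated (g ` {..<l})"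
    and inv: "permute_vars \<sigma> (g l) = g l"
    and stable: "\<And>p. p \<in> ideal_generated (g ` {..<l}) \<Longrightarrow> permute_vars \<sigma> p \<in> ideal_generated (g ` {..<l})"
  shows "piece_trace \<sigma> (ideal_generated (g ` {..<Suc l})) e - piece_trace \<sigma> (ideal_generated (g ` {..<l})) e
    = (if \<delta> l \<le> e then piece_trace \<sigma> UNIV (e - \<delta> l)
        - piece_trace \<sigma> (ideal_generated (g ` {..<l})) (e - \<delta> l) else 0)"
proof -
  define J where "J = ideal_generated (g ` {..<l})"
  define J' where "J' = ideal_generated (g ` {..<Suc l})"
  define H :: "'k poly4 set" where "H = homogeneous_shifted (\<delta> l) e"
  let ?R = "homogeneous_polys e :: 'k poly4 set"
  have JJ': "J \<subseteq> J'" unfolding J_def J'_def by (rule ideal.span_mono) auto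
  have Jsub: "poly.subspace J" "poly.subspace J'" unfolding J_def J'_def
    by (rule subspace_of_ideal, rule ideal.subspace_span)+
  have Rsub: "poly.subspace ?R" by (rule subspace_homogeneous_polys)
  have Hsub: "poly.subspace H" unfolding H_def by (rule subspace_homogeneous_shifted)
  have gJ': "g l \<in> J'" unfolding J'_def by (rule ideal.span_base) simp
  have J'_stable: "permute_vars \<sigma> p \<in> J'" if "p \<in> J'" for p
    unfolding J'_def
  proof (rule permute_vars_ideal_generated)
    fix x assume "x \<in> g ` {..<Suc l}"
    then obtain i where "i < Suc l" and x: "x = g i" by blast
    hence i: "i \<le> l" "x = g i" by simp_all
    show "permute_vars \<sigma> x \<in> ideal_generated (g ` {..<Suc l})"
    proof (cases "i = l")
      case True
      thus ?thesis using gJ' inv i by (simp add: J'_def)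
    next
      case False
      hence "g i \<in> J" unfolding J_def using i by (intro ideal.span_base) auto
      hence "permute_vars \<sigma> (g i) \<in> J" using stable by (simp add: J_def)
      thus ?thesis using JJ' i by (auto simp: J'_def)
    qed
  qed (use that in \<open>simp add: J'_def\<close>)
  have J_stable: "permute_vars \<sigma> p \<in> J" if "p \<in> J" for p using that stable by (simp add: J_def)
  have "poly.subspace_trace (?R \<inter> J') (permute_vars \<sigma>) - poly.subspace_trace (?R \<inter> J) (permute_vars \<sigma>)
      = poly.subspace_trace H (permute_vars \<sigma>) - poly.subspace_trace (H \<inter> J) (permute_vars \<sigma>)"
  proof (rule poly.trace_isomorphic_quotients[where \<mu> = "\<lambda>x. x * g l"])
    show "finite (monomials_of_degree (e - \<delta> l) :: 'k poly4 set)" "finite (monomials_of_degree e :: 'k poly4 set)"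
      by (rule finite_monomials_of_degree)+
    show "H \<subseteq> poly.span (monomials_of_degree (e - \<delta> l))" unfolding H_def by (rule homogeneous_shifted_span)
    show "?R \<inter> J' \<subseteq> poly.span (monomials_of_degree e)" using homogeneous_polys_span by blast
    show "poly.endomorphism H (permute_vars \<sigma>)"
      by (rule endomorphism_permute) (simp add: H_def permute_vars_shifted)
    show "poly.endomorphism (?R \<inter> J') (permute_vars \<sigma>)"
      by (rule endomorphism_permute) (simp add: permute_vars_homogeneous J'_stable)
    show "permute_vars \<sigma> ` (H \<inter> J) \<subseteq> H \<inter> J" "permute_vars \<sigma> ` (?R \<inter> J) \<subseteq> ?R \<inter> J"
      using J_stable by (auto simp: H_def permute_vars_shifted permute_vars_homogeneous)
    show "x * g l \<in> ?R \<inter> J'" if "x \<in> H" for x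
      using that homogeneous_shifted_mult[OF _ g[of l]] gJ'
      by (auto simp: H_def J'_def ideal.span_scale)
    show "x * g l \<in> ?R \<inter> J \<longleftrightarrow> x \<in> H \<inter> J" if "x \<in> H" for x
    proof
      assume "x * g l \<in> ?R \<inter> J"
      thus "x \<in> H \<inter> J" using nzd[of x e] that by (auto simp: J_def H_def)
    next
      assume "x \<in> H \<inter> J"
      thus "x * g l \<in> ?R \<inter> J"
        using homogeneous_shifted_mult[OF _ g[of l], of x e] ideal.span_scale[of x "g ` {..<l}" "g l"]
        by (auto simp: H_def J_def mult.commute)
    qed
    show "\<exists>x\<in>H. y - x * g l \<in> ?R \<inter> J" if y: "y \<in> ?R \<inter> J'" for y
    proof -
      obtain a where a: "y = (\<Sum>i<Suc l. a i * g i)"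
        using y unfolding J'_def by (auto simp: mem_ideal_generated_image)
      define x where "x = hom_part_shifted (\<delta> l) e (a l)"
      have "y = hom_part e y" using y by (simp add: hom_part_same)
      also have "\<dots> = hom_part e (\<Sum>i<Suc l. a i * g i)" by (simp only: a)
      also have "\<dots> = (\<Sum>i<Suc l. hom_part_shifted (\<delta> i) e (a i) * g i)"
        unfolding hom_part_sum by (intro sum.cong refl) (simp add: hom_part_times_homogeneous g)
      finally have "y - x * g l = (\<Sum>i<l. hom_part_shifted (\<delta> i) e (a i) * g i)"
        by (simp add: x_def)
      hence "y - x * g l \<in> J" unfolding J_def by (rule sum_mem_ideal_generated_image)
      moreover have xH: "x \<in> H" unfolding x_def H_def by (rule hom_part_shifted_mem)
      moreover have "y - x * g l \<in> ?R"
        using y homogeneous_shifted_mult[OF xH[unfolded H_def] g[of l]] poly.subspace_diff[OF Rsub] by blast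
      ultimately show ?thesis by blast
    qed
  qed (use Hsub Rsub Jsub JJ' poly.subspace_inter in
      \<open>auto simp: distrib_right scalar_mult_times_left permute_vars_times inv\<close>)
  thus ?thesis
    using shifted_trace[of "UNIV :: 'k poly4 set" "\<delta> l" e \<sigma>] shifted_trace[of J "\<delta> l" e \<sigma>] poly.subspace_0[OF Jsub(1)]
    by (simp add: piece_trace_def H_def J_def J'_def)
qed

section \<open>The graded character of the quotient\<close>

lemma class_fun_apply_graded_character_poly_rep:
  "class_fun_apply (fps_nth (graded_character (poly_rep :: ('k::field, 'k poly4) graded_rep)) e) \<sigma>
    = piece_trace \<sigma> UNIV e"
proof -
  let ?V = "component (poly_rep :: ('k, 'k poly4) graded_rep) e"
  have V: "space ?V = homogeneous_polys e" "vadd ?V = (+)" "vscale ?V = scalar_mult" "act ?V = permute_vars"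
    by (simp_all add: component_def)
  have sub: "poly.subspace (homogeneous_polys e :: 'k poly4 set)" by (rule subspace_homogeneous_polys)
  have "class_fun_apply (character ?V) \<sigma> = trace ?V (act ?V \<sigma>)"
    by (rule class_fun_apply_character)
      (auto simp: V permute_vars_homogeneous permute_vars_add permute_vars_scale permute_vars_mult_perm)
  also have "\<dots> = poly.subspace_trace (homogeneous_polys e) (permute_vars \<sigma>)
      - poly.subspace_trace {0} (permute_vars \<sigma>)"
    unfolding V(4)
  proof (rule poly.trace_presented[where p = "\<lambda>x. x", OF _ finite_monomials_of_degree homogeneous_polys_span])
    show "poly.presents (homogeneous_polys e) {0} (\<lambda>x. x) ?V"
      using sub poly.subspace_0[OF sub] by (auto simp: poly.presents_def V)
  qed (auto intro: endomorphism_permute permute_vars_homogeneous)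
  also have "poly.subspace_trace {0 :: 'k poly4} (permute_vars \<sigma>) = 0"
    by (rule poly.subspace_trace_zero, rule endomorphism_permute) simp
  finally show ?thesis by (simp add: graded_character_def piece_trace_def)
qed

lemma class_fun_apply_graded_character_quotient:
  fixes I :: "'k::field poly4 set"
  assumes I: "is_ideal I" and stable: "\<And>\<sigma> p. p \<in> I \<Longrightarrow> permute_vars \<sigma> p \<in> I"
  shows "class_fun_apply (fps_nth (graded_character (quotient_rep poly_rep I)) e) \<sigma>
    = piece_trace \<sigma> UNIV e - piece_trace \<sigma> I e"
proof -
  let ?V = "component (quotient_rep poly_rep I) e"
  let ?R = "homogeneous_polys e :: 'k poly4 set"
  define p where "p = coset poly_rep I"
  have pres: "poly.presents ?R (?R \<inter> I) p ?V"
    unfolding p_def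
    by (rule poly.presents_coset) (simp_all add: subspace_homogeneous_polys subspace_of_ideal I)
  note pres' = pres[unfolded poly.presents_def]
  have act: "act ?V \<tau> (p x) = p (permute_vars \<tau> x)" for \<tau> x
    using coset_stable[of poly_rep I, OF _ stable] by (simp add: component_def quotient_rep_def p_def)
  have sp: "space ?V = p ` ?R" using pres' by simp
  have add: "p (x + y) = vadd ?V (p x) (p y)" if "x \<in> ?R" "y \<in> ?R" for x y
    using pres' that by blast
  have scl: "p (scalar_mult c x) = vscale ?V c (p x)" if "x \<in> ?R" for x c
    using pres' that by blast
  have "class_fun_apply (character ?V) \<sigma> = trace ?V (act ?V \<sigma>)"
    by (rule class_fun_apply_character)
      (auto simp: sp act permute_vars_homogeneous permute_vars_add permute_vars_scale
        permute_vars_mult_perm simp flip: add scl)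
  also have "\<dots> = poly.subspace_trace ?R (permute_vars \<sigma>) - poly.subspace_trace (?R \<inter> I) (permute_vars \<sigma>)"
    by (rule poly.trace_presented[OF pres finite_monomials_of_degree homogeneous_polys_span])
      (auto simp: act stable permute_vars_homogeneous endomorphism_permute)
  finally show ?thesis by (simp add: graded_character_def piece_trace_def)
qed

lemma degree_zero_in_proper_ideal:
  fixes p :: "'k::field poly4"
  assumes I: "is_ideal I" "I \<noteq> UNIV" and p: "p \<in> I" "p \<in> homogeneous_polys 0"
  shows "p = 0"
proof (rule ccontr)
  define a where "a = lookup p 0"
  assume "p \<noteq> 0"
  have "lookup p \<alpha> = (a when \<alpha> = 0)" for \<alpha>
    using p(2) total_degree_eq_0[of \<alpha>] by (auto simp: mem_homogeneous_polys a_def when_def)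
  hence p_eq: "p = single 0 a"
    by (intro poly_mapping_eqI) (simp add: lookup_single eq_commute)
  hence "a \<noteq> 0" using \<open>p \<noteq> 0\<close> by auto
  hence "single 0 (inverse a) * p = 1"
    by (simp add: p_eq mult_single)
  hence "1 \<in> I" using ideal.subspace_scale[OF I(1) p(1)] by metis
  hence "I = UNIV" using ideal.subspace_scale[OF I(1), of 1] by auto
  thus False using I(2) by blast
qed

text \<open>Evaluation at a permutation is a ring homomorphism, and jointly over all permutations these
  homomorphisms are injective; so the identity may be checked for one permutation at a time.\<close>

definition evaluate_at :: "S4 \<Rightarrow> 'k::comm_ring_1 class_fun fps \<Rightarrow> 'k fps" where
  "evaluate_at \<sigma> A = Abs_fps (\<lambda>n. class_fun_apply (fps_nth A n) \<sigma>)"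

lemma fps_class_fun_eqI:
  assumes "\<And>\<sigma>. evaluate_at \<sigma> A = evaluate_at \<sigma> B"
  shows "A = B"
proof (rule fps_ext)
  fix n
  have "class_fun_apply (fps_nth A n) \<sigma> = class_fun_apply (fps_nth B n) \<sigma>" for \<sigma>
    using arg_cong[OF assms[of \<sigma>], of "\<lambda>F. fps_nth F n"] by (simp add: evaluate_at_def)
  thus "fps_nth A n = fps_nth B n" by (simp add: fun_eq_iff flip: class_fun_apply_inject)
qed

lemma class_fun_apply_simps [simp]:
  "class_fun_apply (0 :: 'k::comm_ring_1 class_fun) \<sigma> = 0"
  "class_fun_apply (1 :: 'k class_fun) \<sigma> = 1"
  "class_fun_apply (x + y) \<sigma> = class_fun_apply x \<sigma> + (class_fun_apply y \<sigma> :: 'k)"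
  "class_fun_apply (x - y) \<sigma> = class_fun_apply x \<sigma> - (class_fun_apply y \<sigma> :: 'k)"
  "class_fun_apply (x * y) \<sigma> = class_fun_apply x \<sigma> * (class_fun_apply y \<sigma> :: 'k)"
  by (simp_all add: zero_class_fun.rep_eq one_class_fun.rep_eq plus_class_fun.rep_eq
      minus_class_fun.rep_eq times_class_fun.rep_eq)

lemma class_fun_apply_sum:
  "class_fun_apply (sum f A) \<sigma> = (\<Sum>x\<in>A. class_fun_apply (f x) \<sigma> :: 'k::comm_ring_1)"
  by (induction A rule: infinite_finite_induct) simp_all

lemma evaluate_at_simps [simp]:
  "evaluate_at \<sigma> 1 = 1"
  "evaluate_at \<sigma> (A + B) = evaluate_at \<sigma> A + evaluate_at \<sigma> B"
  "evaluate_at \<sigma> (A - B) = evaluate_at \<sigma> A - evaluate_at \<sigma> B"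
  "evaluate_at \<sigma> (A * B) = evaluate_at \<sigma> A * evaluate_at \<sigma> B"
  "evaluate_at \<sigma> (fps_const x) = fps_const (class_fun_apply x \<sigma>)"
  "evaluate_at \<sigma> (fps_X ^ n) = fps_X ^ n"
  by (rule fps_ext;
      simp add: evaluate_at_def fps_mult_nth class_fun_apply_sum fps_X_power_nth fps_one_nth if_distrib)+

lemma evaluate_at_prod:
  "evaluate_at \<sigma> (prod f A) = (\<Prod>x\<in>A. evaluate_at \<sigma> (f x :: 'k::comm_ring_1 class_fun fps))"
  by (induction A rule: infinite_finite_induct) simp_all

theorem theorem3p9:
  fixes I :: "'k::field_char_0 poly4 set"
    and d m :: nat
    and c :: "nat \<Rightarrow> nat"
  assumes "is_ideal I"
    and "homogeneous_ideal I"
    and "S4_stable I"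
    and "complete_intersection I"
    and "graded_iso
      (quotient_rep (subrep poly_rep I) (ideal_product irrelevant_ideal I))
      (direct_sum (in_degree d (specht [2, 2]))
        (direct_sum_family {1..m} (\<lambda>i. in_degree (c i) trivial_rep)))"
  shows "graded_character (quotient_rep poly_rep I) =
    graded_character poly_rep *
    (fps_const 1 - fps_const (character (specht [2, 2])) * fps_X ^ d
      + fps_const sign_class_fun * fps_X ^ (2 * d)) *
    (\<Prod>i\<in>{1..m}. (1 - fps_X ^ c i))"
proof -
  note I = assms(1,2)
  have stable: "permute_vars \<sigma> p \<in> I" if "p \<in> I" for \<sigma> p
    using assms(3) that unfolding S4_stable_def by blast
  obtain fs where fs: "regular_sequence fs" "I = ideal_generated (set fs)"
    using assms(4) unfolding complete_intersection_def by blast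
  obtain \<kappa> :: "((4 \<Rightarrow> nat) \<Rightarrow>\<^sub>0 'k) \<Rightarrow> nat \<Rightarrow> 'k" and e where \<kappa>: "coordinates (specht [2, 2]) 2 \<kappa>"
    and e: "\<And>i. i < 2 \<Longrightarrow> e i \<in> space (specht [2, 2])" "\<And>i. i < 2 \<Longrightarrow> \<kappa> (e i) = unit_vector i"
    and chi: "\<And>\<sigma>. class_fun_apply (character (specht [2, 2])) \<sigma>
      = \<kappa> (act (specht [2, 2]) \<sigma> (e 0)) 0 + \<kappa> (act (specht [2, 2]) \<sigma> (e 1)) 1"
    and det: "\<And>\<sigma>. \<kappa> (act (specht [2, 2]) \<sigma> (e 0)) 0 * \<kappa> (act (specht [2, 2]) \<sigma> (e 1)) 1
      - \<kappa> (act (specht [2, 2]) \<sigma> (e 0)) 1 * \<kappa> (act (specht [2, 2]) \<sigma> (e 1)) 0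
      = of_int (sign (apply \<sigma>))"
    and closed: "\<And>\<sigma> v. v \<in> space (specht [2, 2] :: ('k, _) rep) \<Longrightarrow> act (specht [2, 2]) \<sigma> v \<in> space (specht [2, 2])"
    using specht_2_2_basis by blast
  \<comment> \<open>row \<open>i\<close> holds the coordinates of the image of the \<open>i\<close>-th basis vector\<close>
  define r where "r \<sigma> i j = \<kappa> (act (specht [2, 2]) \<sigma> (e i)) j" for \<sigma> i j
  define \<rho> where "\<rho> \<sigma> = block_matrix (r \<sigma>)" for \<sigma>
  define \<delta> where "\<delta> = generator_degree d c"
  define n where "n = m + 2"
  obtain \<psi> :: "'k poly4 \<Rightarrow> nat \<Rightarrow> 'k" where
    \<psi>_add: "\<And>p q j. p \<in> I \<Longrightarrow> q \<in> I \<Longrightarrow> \<psi> (p + q) j = \<psi> p j + \<psi> q j" and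
    \<psi>_scale: "\<And>a p j. p \<in> I \<Longrightarrow> \<psi> (scalar_mult a p) j = a * \<psi> p j" and
    \<psi>_kernel: "\<And>p. p \<in> I \<Longrightarrow> (\<forall>j<n. \<psi> p j = 0) \<longleftrightarrow> p \<in> ideal_product irrelevant_ideal I" and
    \<psi>_basis: "\<And>k. k < n \<Longrightarrow> \<exists>u \<in> I \<inter> homogeneous_polys (\<delta> k). \<forall>j<n. \<psi> u j = (if j = k then 1 else 0)" and
    \<psi>_act: "\<And>\<sigma> p j. p \<in> I \<Longrightarrow> j < n \<Longrightarrow> \<psi> (permute_vars \<sigma> p) j = (\<Sum>i<n. \<psi> p i * \<rho> \<sigma> i j)"
    using coordinates_of_generators[OF I(1) stable assms(5) \<kappa> e closed]
    unfolding r_def \<rho>_def \<delta>_def n_def by blast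
  have \<rho>_degree: "\<rho> \<sigma> i j = 0" if "i < n" "j < n" "\<delta> i \<noteq> \<delta> j" for \<sigma> i j
    using that by (auto simp: \<rho>_def \<delta>_def block_matrix_def generator_degree_def)
  obtain g where g: "\<And>k. k < n \<Longrightarrow> g k \<in> I \<inter> homogeneous_polys (\<delta> k)"
    and \<psi>g: "\<And>k j. k < n \<Longrightarrow> j < n \<Longrightarrow> \<psi> (g k) j = (if j = k then 1 else 0)"
    and g_act: "\<And>\<tau> k. k < n \<Longrightarrow> permute_vars \<tau> (g k) = (\<Sum>l<n. scalar_mult (\<rho> \<tau> k l) (g l))"
  proof (rule equivariant_lift[where n = n and \<rho> = \<rho> and \<delta> = \<delta> and \<psi> = \<psi>,
        OF I(1) stable \<psi>_add \<psi>_scale \<psi>_basis \<psi>_act \<rho>_degree])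
    fix g assume "\<And>k. k < n \<Longrightarrow> g k \<in> I \<inter> homogeneous_polys (\<delta> k)"
      "\<And>k j. k < n \<Longrightarrow> j < n \<Longrightarrow> \<psi> (g k) j = (if j = k then 1 else 0)"
      "\<And>\<tau> k. k < n \<Longrightarrow> permute_vars \<tau> (g k) = (\<Sum>l<n. scalar_mult (\<rho> \<tau> k l) (g l))"
    thus thesis by (rule that)
  qed
  have \<psi>_combination: "\<psi> (\<Sum>k<l. scalar_mult (a k) (g k)) j = (\<Sum>k<l. a k * \<psi> (g k) j) \<and>
    (\<Sum>k<l. scalar_mult (a k) (g k)) \<in> I" if "l \<le> n" for l a j
    using that
  proof (induction l)
    case 0
    have "\<psi> 0 j = 0" using \<psi>_scale[OF ideal.subspace_0[OF I(1)], of 0 j] by simp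
    thus ?case using ideal.subspace_0[OF I(1)] by simp
  next
    case (Suc l)
    have gl: "g l \<in> I" "scalar_mult (a l) (g l) \<in> I"
      using g[of l] Suc.prems poly.subspace_scale[OF subspace_of_ideal[OF I(1)]] by auto
    thus ?case
      using Suc ideal.subspace_add[OF I(1)] by (simp add: \<psi>_add \<psi>_scale)
  qed
  have \<psi>_comb: "\<psi> (\<Sum>k<n. scalar_mult (a k) (g k)) j = a j" if "j < n" for a j
  proof -
    have "\<psi> (\<Sum>k<n. scalar_mult (a k) (g k)) j = (\<Sum>k<n. if j = k then a k else 0)"
      unfolding conjunct1[OF \<psi>_combination[OF order_refl]]
      by (intro sum.cong refl) (use that in \<open>simp add: \<psi>g\<close>)
    thus ?thesis using that by simp
  qed
  have generate: "I = ideal_generated (g ` {..<n})"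
  proof (rule generators_of_nakayama[OF I g])
    fix p assume p: "p \<in> I"
    define q where "q = (\<Sum>k<n. scalar_mult (\<psi> p k) (g k))"
    have q: "q \<in> I" unfolding q_def using \<psi>_combination[OF order_refl] by blast
    have pq: "p - q \<in> I" using ideal.subspace_diff[OF I(1) p q] .
    have "\<psi> (p - q) j = 0" if "j < n" for j
    proof -
      have "\<psi> p j = \<psi> (p - q) j + \<psi> q j" using \<psi>_add[OF pq q, of j] by simp
      thus ?thesis using \<psi>_comb[OF that] by (simp add: q_def)
    qed
    hence "p - q \<in> ideal_product irrelevant_ideal I" using \<psi>_kernel[OF pq] by simp
    moreover have "q \<in> ideal_generated (g ` {..<n})"
      unfolding q_def scalar_mult_eq_times by (rule sum_mem_ideal_generated_image[OF refl])
    ultimately show "\<exists>q\<in>ideal_generated (g ` {..<n}). p - q \<in> ideal_product irrelevant_ideal I" by blast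
  qed
  \<comment> \<open>minimality: modulo \<open>\<mm>I\<close> a relation becomes a linear relation between the classes of the
  generators, with the constant terms as coefficients\<close>
  have minimal: "lookup (a k) 0 = 0" if rel: "relation n g a" and k: "k < n" for a k
  proof -
    define t where "t k = lookup (a k) 0" for k
    have "(\<Sum>k<n. scalar_mult (t k) (g k)) = (\<Sum>k<n. (single 0 (t k) - a k) * g k)"
      using rel by (simp add: scalar_mult_eq_times relation_def left_diff_distrib sum_subtractf)
    also have "\<dots> \<in> ideal_product irrelevant_ideal I"
      unfolding ideal_product_def
    proof (intro ideal.span_sum ideal.span_base)
      fix k assume "k \<in> {..<n}"
      hence "g k \<in> I" using g by auto
      moreover have "single 0 (t k) - a k \<in> irrelevant_ideal"
        by (rule constant_term_zero_irrelevant) (simp add: lookup_minus t_def)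
      ultimately show "(single 0 (t k) - a k) * g k
          \<in> {a * b | a b. a \<in> irrelevant_ideal \<and> b \<in> I}" by blast
    qed
    finally have "\<psi> (\<Sum>k<n. scalar_mult (t k) (g k)) k = 0"
      using \<psi>_kernel[OF conjunct2[OF \<psi>_combination[OF order_refl]]] k by blast
    thus ?thesis using \<psi>_comb[OF k] by (simp add: t_def)
  qed
  \<comment> \<open>a generator of degree \<open>0\<close> would be a constant in a proper ideal, hence \<open>0\<close>, and not a basis vector\<close>
  have \<delta>_pos: "\<delta> k > 0" if k: "k < n" for k
  proof (rule ccontr)
    assume "\<not> \<delta> k > 0"
    hence "g k \<in> I \<inter> homogeneous_polys 0" using g[OF k] by simp
    moreover have "I \<noteq> UNIV" using fs unfolding regular_sequence_def by simp
    ultimately have "g k = 0" using degree_zero_in_proper_ideal[OF I(1)] by blast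
    hence "\<psi> (scalar_mult 0 (g k)) k = 1" using \<psi>g[OF k k] by simp
    thus False using \<psi>_scale[of "g k" 0 k] g[OF k] by simp
  qed
  have take_image: "set (take i fs) = (!) fs ` {..<i}" if "i \<le> length fs" for i
    using nth_image[OF that] by (simp add: atLeast0LessThan)
  have kos: "homogeneous_relations_koszul n g \<delta>"
  proof (rule minimal_generators_koszul[where f = "(!) fs" and r = "length fs"])
    show "x \<in> ideal_generated ((!) fs ` {..<i})"
      if "i < length fs" "fs ! i * x \<in> ideal_generated ((!) fs ` {..<i})" for i x
      using fs(1) that unfolding regular_sequence_def take_image[OF less_imp_le[OF that(1)], symmetric]
      by blast
    show "ideal_generated ((!) fs ` {..<length fs}) = ideal_generated (g ` {..<n})"
      using fs(2) generate take_image[of "length fs"] by simp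
  qed (use g minimal in auto)
  have g_hom: "g i \<in> homogeneous_polys (\<delta> i)" if "i < n" for i using g[OF that] by blast
  have kos_l: "homogeneous_relations_koszul l g \<delta>" if "l \<le> n" for l
    using that
  proof (induction rule: inc_induct)
    case (step l)
    show ?case
      by (rule homogeneous_relations_koszul_drop[OF step.IH]) (use step.hyps g_hom \<delta>_pos in auto)
  qed (rule kos)
  have nzd: "x \<in> ideal_generated (g ` {..<l})"
    if "l < n" "x \<in> homogeneous_shifted (\<delta> l) k" "x * g l \<in> ideal_generated (g ` {..<l})" for l x k
    by (rule homogeneous_nonzerodivisor[OF kos_l]) (use that g_hom in auto)
  have g_act_pair: "permute_vars \<tau> (g k) = scalar_mult (r \<tau> k 0) (g 0) + scalar_mult (r \<tau> k 1) (g 1)"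
    if "k < 2" for \<tau> k
  proof -
    have "permute_vars \<tau> (g k) = (\<Sum>l<n. scalar_mult (\<rho> \<tau> k l) (g l))"
      by (rule g_act) (use that in \<open>simp add: n_def\<close>)
    also have "\<dots> = (\<Sum>l<2. scalar_mult (\<rho> \<tau> k l) (g l))"
      by (rule sum.mono_neutral_right) (use that in \<open>auto simp: n_def \<rho>_def block_matrix_def\<close>)
    finally show ?thesis using that by (simp add: numeral_2_eq_2 \<rho>_def block_matrix_def)
  qed
  have g_invariant: "permute_vars \<tau> (g k) = g k" if "2 \<le> k" "k < n" for \<tau> k
  proof -
    have "permute_vars \<tau> (g k) = (\<Sum>l<n. if l = k then g l else 0)"
      unfolding g_act[OF that(2)]
      by (intro sum.cong refl) (use that in \<open>auto simp: \<rho>_def block_matrix_def\<close>)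
    thus ?thesis using that by simp
  qed
  define J where "J l = ideal_generated (g ` {..<l})" for l
  have J_stable: "permute_vars \<tau> p \<in> J l" if l: "2 \<le> l" "l \<le> n" and "p \<in> J l" for l \<tau> p
    unfolding J_def
  proof (rule permute_vars_ideal_generated)
    fix x assume "x \<in> g ` {..<l}"
    then obtain k where k: "k < l" "x = g k" by blast
    have gen: "g i \<in> ideal_generated (g ` {..<l})" if "i < l" for i
      using that by (intro ideal.span_base) auto
    show "permute_vars \<tau> x \<in> ideal_generated (g ` {..<l})"
    proof (cases "k < 2")
      case True
      have "scalar_mult a (g i) \<in> ideal_generated (g ` {..<l})" if "i < 2" for a i
        unfolding scalar_mult_eq_times using that l by (intro ideal.span_scale gen) simp
      thus ?thesis unfolding k(2) g_act_pair[OF True] by (intro ideal.span_add) simp_all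
    next
      case False
      thus ?thesis using g_invariant[of k \<tau>] k l gen by simp
    qed
  qed (use that in \<open>simp add: J_def\<close>)
  \<comment> \<open>the series of \<open>R\<close> and of \<open>R\<close> modulo the first \<open>l\<close> generators, evaluated at \<open>\<sigma>\<close>\<close>
  define PR where "PR \<sigma> = Abs_fps (\<lambda>e. piece_trace \<sigma> (UNIV :: 'k poly4 set) e)" for \<sigma>
  define P where "P \<sigma> l = Abs_fps (\<lambda>e. piece_trace \<sigma> UNIV e - piece_trace \<sigma> (J l) e)" for \<sigma> l
  have \<delta>01: "\<delta> 0 = d" "\<delta> 1 = d" by (simp_all add: \<delta>_def generator_degree_def)
  \<comment> \<open>only the degrees of the first two generators matter, and these are both \<open>d\<close>\<close>
  have kos2: "homogeneous_relations_koszul 2 g (\<lambda>_. d)"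
    unfolding homogeneous_relations_koszul_def
  proof (intro allI impI)
    fix k t assume rel: "relation 2 g t" and t: "\<forall>i. t i \<in> homogeneous_shifted d k"
    define t' where "t' i = (if i < 2 then t i else 0)" for i :: nat
    have "relation 2 g t'" using rel by (simp add: relation_def t'_def)
    moreover have "t' i \<in> homogeneous_shifted (\<delta> i) k" for i
      using t poly.subspace_0[OF subspace_homogeneous_shifted]
      by (auto simp: t'_def \<delta>_def generator_degree_def)
    ultimately have "koszul_relation 2 g t'"
      using kos_l[of 2] unfolding homogeneous_relations_koszul_def n_def by fastforce
    thus "koszul_relation 2 g t" by (simp add: koszul_relation_def t'_def)
  qed
  have P2: "P \<sigma> 2 = PR \<sigma> * (1 - fps_const (class_fun_apply (character (specht [2, 2])) \<sigma>) * fps_X ^ d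
      + fps_const (of_int (sign (apply \<sigma>))) * fps_X ^ (2 * d))" for \<sigma>
  proof -
    define \<chi> where "\<chi> = class_fun_apply (character (specht [2, 2] :: ('k, _) rep)) \<sigma>"
    define s :: 'k where "s = of_int (sign (apply \<sigma>))"
    have \<chi>: "\<chi> = r \<sigma> 0 0 + r \<sigma> 1 1" by (simp add: \<chi>_def chi r_def)
    have s: "s = r \<sigma> 0 0 * r \<sigma> 1 1 - r \<sigma> 0 1 * r \<sigma> 1 0" using det[of \<sigma>] by (simp add: s_def r_def)
    have pt: "piece_trace \<sigma> (J 2) k = (if d \<le> k then \<chi> * piece_trace \<sigma> UNIV (k - d) else 0)
      - (if 2 * d \<le> k then s * piece_trace \<sigma> UNIV (k - 2 * d) else 0)" for k
      unfolding \<chi> s J_def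
    proof (rule trace_ideal_of_pair)
      show "g 0 \<in> homogeneous_polys d" "g 1 \<in> homogeneous_polys d"
        using g_hom[of 0] g_hom[of 1] \<delta>01 by (simp_all add: n_def)
      show "x = 0" if "x \<in> homogeneous_shifted d k" "x * g 0 = 0" for x k
        using nzd[of 0 x k] that \<delta>01 by (simp add: n_def)
      show "permute_vars \<sigma> (g 0) = scalar_mult (r \<sigma> 0 0) (g 0) + scalar_mult (r \<sigma> 0 1) (g 1)"
        by (rule g_act_pair) simp
      show "permute_vars \<sigma> (g 1) = scalar_mult (r \<sigma> 1 0) (g 0) + scalar_mult (r \<sigma> 1 1) (g 1)"
        by (rule g_act_pair) simp
    qed (rule kos2)
    have "PR \<sigma> * (1 - fps_const \<chi> * fps_X ^ d + fps_const s * fps_X ^ (2 * d))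
        = PR \<sigma> - fps_const \<chi> * (PR \<sigma> * fps_X ^ d) + fps_const s * (PR \<sigma> * fps_X ^ (2 * d))"
      by (simp add: algebra_simps)
    also have "\<dots> = P \<sigma> 2"
      by (rule fps_ext) (auto simp: P_def PR_def pt fps_X_power_mult_right_nth)
    finally show ?thesis by (simp add: \<chi>_def s_def)
  qed
  have P_step: "P \<sigma> (Suc l) = P \<sigma> l * (1 - fps_X ^ \<delta> l)" if l: "2 \<le> l" "l < n" for \<sigma> l
  proof -
    have "piece_trace \<sigma> (J (Suc l)) k - piece_trace \<sigma> (J l) k = (if \<delta> l \<le> k
        then piece_trace \<sigma> UNIV (k - \<delta> l) - piece_trace \<sigma> (J l) (k - \<delta> l) else 0)" for k
      unfolding J_def
    proof (rule trace_adjoin_invariant)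
      show "permute_vars \<sigma> (g l) = g l" by (rule g_invariant[OF l])
      show "permute_vars \<sigma> p \<in> ideal_generated (g ` {..<l})" if "p \<in> ideal_generated (g ` {..<l})" for p
        using J_stable[of l p \<sigma>] that l by (simp add: J_def)
    qed (use g_hom l nzd[OF l(2)] in auto)
    hence pt: "piece_trace \<sigma> (J (Suc l)) k = piece_trace \<sigma> (J l) k + (if \<delta> l \<le> k
        then piece_trace \<sigma> UNIV (k - \<delta> l) - piece_trace \<sigma> (J l) (k - \<delta> l) else 0)" for k
      by (simp add: diff_eq_eq add.commute)
    have "P \<sigma> l * (1 - fps_X ^ \<delta> l) = P \<sigma> l - P \<sigma> l * fps_X ^ \<delta> l" by (simp add: algebra_simps)
    also have "\<dots> = P \<sigma> (Suc l)"
      by (rule fps_ext) (auto simp: P_def pt fps_X_power_mult_right_nth)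
    finally show ?thesis by simp
  qed
  have P_prod: "P \<sigma> (2 + k) = P \<sigma> 2 * (\<Prod>i\<in>{1..k}. 1 - fps_X ^ c i)" if "k \<le> m" for \<sigma> k
    using that
  proof (induction k)
    case (Suc k)
    have "\<delta> (2 + k) = c (Suc k)" by (simp add: \<delta>_def generator_degree_def)
    thus ?case using Suc P_step[of "2 + k" \<sigma>] by (simp add: n_def mult.assoc)
  qed simp
  have J_n: "J (2 + m) = I" using generate by (simp add: J_def n_def add.commute)
  show ?thesis
  proof (rule fps_class_fun_eqI)
    fix \<sigma>
    have "evaluate_at \<sigma> (graded_character (quotient_rep poly_rep I)) = P \<sigma> (2 + m)"
      by (simp only: evaluate_at_def P_def J_n class_fun_apply_graded_character_quotient[OF I(1) stable])
    moreover have "evaluate_at \<sigma> (graded_character poly_rep) = PR \<sigma>"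
      by (simp add: evaluate_at_def PR_def class_fun_apply_graded_character_poly_rep)
    moreover have "class_fun_apply sign_class_fun \<sigma> = (of_int (sign (apply \<sigma>)) :: 'k)"
      by (simp add: sign_class_fun.rep_eq)
    ultimately show "evaluate_at \<sigma> (graded_character (quotient_rep poly_rep I)) = evaluate_at \<sigma>
      (graded_character poly_rep *
      (fps_const 1 - fps_const (character (specht [2, 2])) * fps_X ^ d
        + fps_const sign_class_fun * fps_X ^ (2 * d)) *
      (\<Prod>i\<in>{1..m}. (1 - fps_X ^ c i)))"
      using P_prod[of m \<sigma>] by (simp add: P2 evaluate_at_prod)
  qed
qed

end
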